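(* Let $\beta>0$, $\alpha\ge0$, $1\le p<\infty$, and let $\mathcal{C}_\beta^*:\mathcal{T}_p^{(\alpha)}(t^\alpha)\to\mathcal{T}_p^{(\alpha)}(t^\alpha)$ be the generalized dual Cesàro operator. Then $$\sigma(\mathcal{C}_\beta^* )=\Gamma(\beta+1)\,\overline{\left\{\frac{\Gamma(\frac1p+it)}{\Gamma(\beta+\frac1p+it)}:\ t\in\mathbb{R}\right\}}=\beta\,\overline{B(\beta,1/p+i\mathbb{R})},$$ where $B$ is the Beta function.
   Context: $\mathcal{S}_+$ denotes the Schwartz class on $[0,\infty)$. For $\alpha>0$ and $f\in\mathcal{S}_+$, the Weyl fractional integral is $W_+^{-\alpha}f(t)=\frac{1}{\Gamma(\alpha)}\int_t^\infty (s-t)^{\alpha-1}f(s)\,ds$, and the Weyl fractional derivative is $W_+^{\alpha}f(t)=(-1)^n\frac{d^n}{dt^n}W_+^{-(n-\alpha)}f(t)$ with $n=[\alpha]+1$. For $\alpha>0$ and $1\le p<\infty$, $\mathcal{T}_p^{(\alpha)}(t^\alpha)$ is the completion of $\mathcal{S}_+$ in the norm $\|f\|_{\alpha,p}=\frac{1}{\Gamma(\alpha+1)}\left(\int_0^\infty |W_+^\alpha f(t)|^p t^{\alpha p}\,dt\right)^{1/p}$; $\mathcal{T}_p^{(0)}(t^0)=L^p(\mathbb{R}^+)$. These spaces embed continuously into $L^p(\mathbb{R}^+)$. The generalized dual Cesàro operator is $\mathcal{C}_\beta^*f(t)=\beta\int_t^\infty\frac{(s-t)^{\beta-1}}{s^\beta}f(s)\,ds$,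 $t>0$. $\sigma$ denotes the spectrum and $B(x,y)=\Gamma(x)\Gamma(y)/\Gamma(x+y)$. *)

theory Defs
  imports "HOL-Analysis.Analysis"
begin

(* All functions are complex valued functions on the real line, only their
   values on [0,oo) (resp. a.e. on (0,oo)) matter. *)

definition schwartz_plus :: "(real \<Rightarrow> complex) set" where
  "schwartz_plus = {f. \<exists>D :: nat \<Rightarrow> real \<Rightarrow> complex.
      (\<forall>t\<ge>0. D 0 t = f t) \<and>
      (\<forall>n. \<forall>t\<ge>0. (D n has_vector_derivative D (Suc n) t) (at t within {0..})) \<and>
      (\<forall>n k. \<exists>C. \<forall>t\<ge>0. t ^ k * norm (D n t) \<le> C)}"

definition weyl_int :: "real \<Rightarrow> (real \<Rightarrow> complex) \<Rightarrow> real \<Rightarrow> complex" where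
  "weyl_int a f t = (1 / Gamma a) *\<^sub>R (LINT s:{t<..}|lborel. ((s - t) powr (a - 1)) *\<^sub>R f s)"

definition vderiv :: "(real \<Rightarrow> complex) \<Rightarrow> real \<Rightarrow> complex" where
  "vderiv g = (\<lambda>t. vector_derivative g (at t))"

definition weyl_der :: "real \<Rightarrow> (real \<Rightarrow> complex) \<Rightarrow> real \<Rightarrow> complex" where
  "weyl_der a f = (let n = nat \<lfloor>a\<rfloor> + 1 in
     (\<lambda>t. ((-1) ^ n) *\<^sub>R (vderiv ^^ n) (weyl_int (real n - a) f) t))"

definition snorm :: "real \<Rightarrow> real \<Rightarrow> (real \<Rightarrow> complex) \<Rightarrow> real" where
  "snorm a p f = (1 / Gamma (a + 1)) *
     (LINT t:{0<..}|lborel. norm (weyl_der a f t) powr p * t powr (a * p)) powr (1 / p)"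

definition Lp_plus :: "real \<Rightarrow> (real \<Rightarrow> complex) set" where
  "Lp_plus p = {f. set_borel_measurable lborel {0<..} f \<and>
                   set_integrable lborel {0<..} (\<lambda>t. norm (f t) powr p)}"

definition Lp_norm :: "real \<Rightarrow> (real \<Rightarrow> complex) \<Rightarrow> real" where
  "Lp_norm p f = (LINT t:{0<..}|lborel. norm (f t) powr p) powr (1 / p)"

text \<open>phi is a Schwartz sequence, Cauchy for ||.||_{a,p}, converging to f in L^p
  (via the continuous embedding of the completion into L^p).\<close>
definition approx_seq :: "real \<Rightarrow> real \<Rightarrow> (nat \<Rightarrow> real \<Rightarrow> complex) \<Rightarrow> (real \<Rightarrow> complex) \<Rightarrow> bool" where
  "approx_seq a p \<phi> f \<longleftrightarrow> (\<forall>n. \<phi> n \<in> schwartz_plus) \<and>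
     (\<forall>e>0. \<exists>N. \<forall>m\<ge>N. \<forall>n\<ge>N. snorm a p (\<lambda>t. \<phi> m t - \<phi> n t) < e) \<and>
     (\<lambda>n. Lp_norm p (\<lambda>t. \<phi> n t - f t)) \<longlonglongrightarrow> 0"

definition Tsp :: "real \<Rightarrow> real \<Rightarrow> (real \<Rightarrow> complex) set" where
  "Tsp a p = (if a = 0 then Lp_plus p
              else {f \<in> Lp_plus p. \<exists>\<phi>. approx_seq a p \<phi> f})"

definition Tnorm :: "real \<Rightarrow> real \<Rightarrow> (real \<Rightarrow> complex) \<Rightarrow> real" where
  "Tnorm a p f = (if a = 0 then Lp_norm p f
                  else lim (\<lambda>n. snorm a p ((SOME \<phi>. approx_seq a p \<phi> f) n)))"

text \<open>Equality almost everywhere on (0,oo) (elements of the space are classes).\<close>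
definition ae_eq :: "(real \<Rightarrow> complex) \<Rightarrow> (real \<Rightarrow> complex) \<Rightarrow> bool" where
  "ae_eq f g \<longleftrightarrow> (AE t in lborel. t > 0 \<longrightarrow> f t = g t)"

text \<open>Spectrum of an operator T on T_p^(a): lambda is in the resolvent set iff
  lambda I - T is onto and bounded below (i.e. invertible with bounded inverse).\<close>
definition spectrum_T :: "real \<Rightarrow> real \<Rightarrow> ((real \<Rightarrow> complex) \<Rightarrow> (real \<Rightarrow> complex)) \<Rightarrow> complex set" where
  "spectrum_T a p T = {c. \<not> ((\<forall>g\<in>Tsp a p. \<exists>f\<in>Tsp a p. ae_eq (\<lambda>t. c * f t - T f t) g) \<and>
        (\<exists>M. \<forall>f\<in>Tsp a p. Tnorm a p f \<le> M * Tnorm a p (\<lambda>t. c * f t - T f t)))}"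

definition dual_cesaro :: "real \<Rightarrow> (real \<Rightarrow> complex) \<Rightarrow> real \<Rightarrow> complex" where
  "dual_cesaro b f t = b *\<^sub>R (LINT s:{t<..}|lborel. ((s - t) powr (b - 1) / s powr b) *\<^sub>R f s)"

end

theory Submission
  imports Defs "HOL-Probability.Probability" "HOL-Complex_Analysis.Complex_Analysis"
begin

text \<open>
  The substitution \<open>t = exp x\<close> identifies \<open>L\<^sup>p\<close> of the half-line isometrically with \<open>L\<^sup>p\<close> of the line and
  turns the dual Cesaro operator of order \<open>\<beta>\<close> into correlation with the integrable kernel
  \<open>\<beta> (1 - exp (- y))\<^bsup>\<beta> - 1\<^esup> exp (- y / p)\<close> on \<open>y > 0\<close>, whose Fourier transform is \<open>\<beta> B(\<beta>, 1/p + \<i>\<xi>)\<close>.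

  Truncated characters are approximate eigenvectors, so the closure of the range of the Fourier
  transform lies in the spectrum. Conversely, let \<open>\<mu>\<close> be outside the closure and split the kernel \<open>k\<close> as
  \<open>u + g\<close>, where \<open>g\<close> is \<open>k\<close> convolved with a narrow Gaussian and \<open>u\<close> has \<open>L\<^sup>1\<close> norm below \<open>|\<mu>|\<close>. The function
  \<open>h\<close> with transform \<open>g^ / (\<mu> - k^)\<close> is integrable, because that quotient is smooth with Gaussian
  decay, and \<open>(\<mu> - k)(1 + h) = \<mu> - u\<close> is invertible by a Neumann series.

  For \<open>\<alpha> > 0\<close> the map \<open>f \<mapsto> t\<^sup>\<alpha> W\<^sup>\<alpha> f\<close> is an isometry, up to the factor \<open>\<Gamma>(\<alpha> + 1)\<close>, of the Sobolev space onto
  \<open>L\<^sup>p\<close>; its inverse is a multiple of the dual Cesaro operator of order \<open>\<alpha>\<close>, which is injective and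
  commutes with the one of order \<open>\<beta>\<close>. Hence the spectrum does not depend on \<open>\<alpha>\<close>.
\<close>

section \<open>The space of p-integrable functions and correlation operators\<close>

text \<open>The resolvent step does the work of Wiener's lemma by hand. For p \<noteq> 2 a bounded
  multiplier need not act on L^p, so the inverse of \<open>\<mu> - k^\<close> must be realised by
  L^1 kernels. For \<beta> < 1 the kernel is unbounded at 0 and its transform decays only like
  |\<xi>| to the power -\<beta>, too slowly to integrate; the Gaussian factor restores
  integrability, and the part of the kernel that it misses needs no Fourier analysis. Small means
  below |\<mu>|, so \<mu> must not be 0: the Riemann-Lebesgue lemma puts 0 into the closure.

  For \<alpha> > 0 everything rests on one composition law: beta kernels of orders a and b compose
  to order a + b when the second exponential rate exceeds the first by a. It ties together f,
  \<open>t powr \<alpha>\<close> times its Weyl derivative, and t^n times its n-th derivative, n =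
  [\<alpha>] + 1, and it gives injectivity by raising the order to an integer. That the isometry is
  onto is a density statement, tractable because exponentials are eigenfunctions of Weyl
  derivatives.\<close>

definition Lp :: "real \<Rightarrow> (real \<Rightarrow> complex) set" where
  "Lp p = {F \<in> borel_measurable borel. integrable lborel (\<lambda>x. norm (F x) powr p)}"

definition Lnorm :: "real \<Rightarrow> (real \<Rightarrow> complex) \<Rightarrow> real" where
  "Lnorm p F = (LINT x|lborel. norm (F x) powr p) powr (1 / p)"

definition cor :: "(real \<Rightarrow> complex) \<Rightarrow> (real \<Rightarrow> complex) \<Rightarrow> real \<Rightarrow> complex" where
  "cor k F x = (LINT y|lborel. k y * F (x + y))"

definition conv :: "(real \<Rightarrow> complex) \<Rightarrow> (real \<Rightarrow> complex) \<Rightarrow> real \<Rightarrow> complex" where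
  "conv k l w = (LINT y|lborel. k y * l (w - y))"

definition L1 :: "(real \<Rightarrow> complex) \<Rightarrow> real" where
  "L1 k = (LINT y|lborel. norm (k y))"

lemma L1_nonneg [simp]: "0 \<le> L1 k"
  by (simp add: L1_def)

lemma Lnorm_nonneg [simp]: "0 \<le> Lnorm p F"
  by (simp add: Lnorm_def)

lemma Lp_measurable [measurable_dest]: "F \<in> Lp p \<Longrightarrow> F \<in> borel_measurable borel"
  by (simp add: Lp_def)

lemma Lp_integrable: "F \<in> Lp p \<Longrightarrow> integrable lborel (\<lambda>x. norm (F x) powr p)"
  by (simp add: Lp_def)

lemma Lp_iff_nn_integral:
  assumes [measurable]: "F \<in> borel_measurable borel"
  shows "F \<in> Lp p \<longleftrightarrow> (\<integral>\<^sup>+x. ennreal (norm (F x) powr p) \<partial>lborel) < \<infinity>"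
  by (auto simp: Lp_def integrable_iff_bounded)

lemma nn_integral_Lp:
  assumes "F \<in> Lp p" "p \<ge> 1"
  shows "(\<integral>\<^sup>+x. ennreal (norm (F x) powr p) \<partial>lborel) = ennreal (Lnorm p F powr p)"
  using assms unfolding Lnorm_def
  by (subst nn_integral_eq_integral[OF Lp_integrable]) (auto simp: powr_powr)

text \<open>The hypothesis bounds a nonnegative integral, which makes sense before integrability is
  known; one estimate thus yields both membership and the norm bound.\<close>

lemma Lnorm_leI:
  assumes "F \<in> borel_measurable borel" "p \<ge> 1" "C \<ge> 0"
    "(\<integral>\<^sup>+x. ennreal (norm (F x) powr p) \<partial>lborel) \<le> ennreal (C powr p)"
  shows "F \<in> Lp p" "Lnorm p F \<le> C"
proof -
  show *: "F \<in> Lp p"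
    using assms by (subst Lp_iff_nn_integral) (auto simp: order_le_less_trans)
  have "Lnorm p F powr p \<le> C powr p"
    using assms(4) nn_integral_Lp[OF * assms(2)] by (simp add: ennreal_le_iff)
  then show "Lnorm p F \<le> C"
    using assms(2,3) powr_less_mono2[of p C "Lnorm p F"] by linarith
qed

lemma Lp_AE_cong:
  assumes "F \<in> Lp p" "G \<in> borel_measurable borel" "AE x in lborel. F x = G x"
  shows "G \<in> Lp p" "Lnorm p G = Lnorm p F"
proof -
  have [measurable]: "F \<in> borel_measurable borel" "G \<in> borel_measurable borel" using assms by auto
  have "integrable lborel (\<lambda>x. norm (F x) powr p) = integrable lborel (\<lambda>x. norm (G x) powr p)"
    using assms(3) by (intro integrable_cong_AE) auto
  then show "G \<in> Lp p" using assms(1) by (simp add: Lp_def)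
  have "(LINT x|lborel. norm (F x) powr p) = (LINT x|lborel. norm (G x) powr p)"
    using assms(3) by (intro integral_cong_AE) auto
  then show "Lnorm p G = Lnorm p F" by (simp add: Lnorm_def)
qed

section \<open>Minkowski's inequality from convexity of powers\<close>

text \<open>Convexity of the p-th power in tangent form; Minkowski's and Jensen's inequalities below
  are averages of it. The derivative criterion lives on the open half-line, so \<open>a = 0\<close>
  is done by hand, where the claim is \<open>(1 - p) * m powr p \<le> 0\<close>.\<close>

lemma powr_above_tangent:
  fixes a m p :: real
  assumes "a \<ge> 0" "m > 0" "p \<ge> 1"
  shows "m powr p + p * m powr (p - 1) * (a - m) \<le> a powr p"
proof (cases "a = 0")
  case True
  have "m powr (p - 1) * m = m powr p" using assms by (simp add: powr_diff)
  with assms True show ?thesis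
    by (simp add: mult.assoc mult_le_cancel_right1)
next
  case False
  have "a powr p - m powr p \<ge> p * m powr (p - 1) * (a - m)"
  proof (rule convex_on_imp_above_tangent[where A = "{0<..}" and f = "\<lambda>x. x powr p"])
    show "convex_on {0<..} (\<lambda>x. x powr p)"
      using assms by (intro powr_convex)
    show "((\<lambda>x. x powr p) has_real_derivative p * m powr (p - 1)) (at m within {0<..})"
      using assms by (auto intro!: derivative_eq_intros)
  qed (use assms False in \<open>auto simp: interior_open\<close>)
  then show ?thesis by linarith
qed

text \<open>Jensen's inequality at the points \<open>a / s\<close> and \<open>b / t\<close> with
  weights s and t: at their weighted mean \<open>m\<close> the linear terms of the two tangents
  cancel. With s and t just above the two norms it integrates to the triangle inequality, without
  Hoelder's inequality.\<close>

lemma powr_weighted_add_le: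
  fixes a b s t p :: real
  assumes "a \<ge> 0" "b \<ge> 0" "s > 0" "t > 0" "p \<ge> 1"
  shows "(a + b) powr p \<le> (s + t) powr (p - 1) * (s powr (1 - p) * a powr p + t powr (1 - p) * b powr p)"
proof (cases "a + b = 0")
  case True
  then show ?thesis using assms by (auto intro!: mult_nonneg_nonneg)
next
  case False
  define m where "m = (a + b) / (s + t)"
  have m: "m > 0" using assms False by (auto simp: m_def field_simps)
  have 1: "m powr p + p * m powr (p - 1) * (a / s - m) \<le> (a / s) powr p"
    "m powr p + p * m powr (p - 1) * (b / t - m) \<le> (b / t) powr p"
    by (rule powr_above_tangent; use assms m in simp)+
  have "s * (m powr p + p * m powr (p - 1) * (a / s - m)) + t * (m powr p + p * m powr (p - 1) * (b / t - m))
     \<le> s * (a / s) powr p + t * (b / t) powr p"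
    using 1 assms by (intro add_mono mult_left_mono) auto
  also have "s * (m powr p + p * m powr (p - 1) * (a / s - m)) + t * (m powr p + p * m powr (p - 1) * (b / t - m))
     = (s + t) * m powr p + p * m powr (p - 1) * (a + b - (s + t) * m)"
    using assms by (simp add: field_simps)
  also have "a + b - (s + t) * m = 0" using assms by (simp add: m_def)
  finally have 2: "(s + t) * m powr p \<le> s * (a / s) powr p + t * (b / t) powr p" by simp
  have 3: "s * (a / s) powr p = s powr (1 - p) * a powr p" "t * (b / t) powr p = t powr (1 - p) * b powr p"
    using assms by (auto simp: powr_divide powr_diff)
  have "(a + b) powr p = (s + t) powr (p - 1) * ((s + t) * m powr p)"
    using assms by (simp add: m_def powr_divide powr_diff)
  also have "\<dots> \<le> (s + t) powr (p - 1) * (s powr (1 - p) * a powr p + t powr (1 - p) * b powr p)"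
    using 2 3 by (intro mult_left_mono) auto
  finally show ?thesis .
qed

lemma Lp_add:
  assumes F: "F \<in> Lp p" and G: "G \<in> Lp p" and p: "p \<ge> 1"
  shows "(\<lambda>x. F x + G x) \<in> Lp p" "Lnorm p (\<lambda>x. F x + G x) \<le> Lnorm p F + Lnorm p G"
proof -
  note [measurable] = Lp_measurable[OF F] Lp_measurable[OF G]
  \<comment> \<open>Taking s and t strictly above the norms keeps them positive when a norm is 0, as
    the powers with exponent \<open>1 - p\<close> demand; the excess is removed by an epsilon at the
    end.\<close>
  have main: "(\<integral>\<^sup>+x. ennreal (norm (F x + G x) powr p) \<partial>lborel) \<le> ennreal ((s + t) powr p)"
    if st: "s > Lnorm p F" "t > Lnorm p G" for s t
  proof -
    have pos: "s > 0" "t > 0" using st Lnorm_nonneg[of p F] Lnorm_nonneg[of p G] by linarith+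
    define u where "u = (s + t) powr (p - 1) * s powr (1 - p)"
    define v where "v = (s + t) powr (p - 1) * t powr (1 - p)"
    have uv: "u \<ge> 0" "v \<ge> 0" by (auto simp: u_def v_def)
    have "(\<integral>\<^sup>+x. ennreal (norm (F x + G x) powr p) \<partial>lborel)
        \<le> (\<integral>\<^sup>+x. ennreal u * ennreal (norm (F x) powr p) + ennreal v * ennreal (norm (G x) powr p) \<partial>lborel)"
    proof (rule nn_integral_mono)
      fix x
      have "norm (F x + G x) powr p \<le> (norm (F x) + norm (G x)) powr p"
        using p by (intro powr_mono2 norm_triangle_ineq) auto
      also have "\<dots> \<le> u * norm (F x) powr p + v * norm (G x) powr p"
        using powr_weighted_add_le[of "norm (F x)" "norm (G x)" s t p] pos p
        by (simp add: u_def v_def algebra_simps)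
      finally show "ennreal (norm (F x + G x) powr p)
          \<le> ennreal u * ennreal (norm (F x) powr p) + ennreal v * ennreal (norm (G x) powr p)"
        using uv by (simp flip: ennreal_mult ennreal_plus)
    qed
    also have "\<dots> = ennreal u * ennreal (Lnorm p F powr p) + ennreal v * ennreal (Lnorm p G powr p)"
      using F G p by (simp add: nn_integral_add nn_integral_cmult nn_integral_Lp)
    also have "\<dots> = ennreal (u * Lnorm p F powr p + v * Lnorm p G powr p)"
      using uv by (simp add: ennreal_mult ennreal_plus)
    also have "\<dots> \<le> ennreal (u * s powr p + v * t powr p)"
      using uv st p by (intro ennreal_leI add_mono mult_left_mono powr_mono2) auto
    also have "u * s powr p + v * t powr p = (s + t) powr (p - 1) * (s + t)"
      using pos by (simp add: u_def v_def mult.assoc powr_add[symmetric] distrib_left)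
    also have "\<dots> = (s + t) powr p" using pos by (simp add: powr_diff)
    finally show ?thesis .
  qed
  have m: "(\<lambda>x. F x + G x) \<in> borel_measurable borel" by simp
  show "(\<lambda>x. F x + G x) \<in> Lp p"
    by (rule Lnorm_leI(1)[OF m p _ main[of "Lnorm p F + 1" "Lnorm p G + 1"]])
       (auto intro!: add_nonneg_nonneg)
  show "Lnorm p (\<lambda>x. F x + G x) \<le> Lnorm p F + Lnorm p G"
  proof (rule field_le_epsilon)
    fix e :: real assume "e > 0"
    then show "Lnorm p (\<lambda>x. F x + G x) \<le> Lnorm p F + Lnorm p G + e"
      using Lnorm_leI(2)[OF m p _ main[of "Lnorm p F + e/2" "Lnorm p G + e/2"]]
      by (simp add: add_nonneg_nonneg field_simps)
  qed
qed

lemma Lp_cmult: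
  assumes F: "F \<in> Lp p" and p: "p \<ge> 1"
  shows "(\<lambda>x. c * F x) \<in> Lp p" "Lnorm p (\<lambda>x. c * F x) = norm c * Lnorm p F"
proof -
  note [measurable] = Lp_measurable[OF F]
  show "(\<lambda>x. c * F x) \<in> Lp p"
    using F by (auto simp: Lp_def norm_mult powr_mult)
  show "Lnorm p (\<lambda>x. c * F x) = norm c * Lnorm p F"
    using p by (auto simp: Lnorm_def norm_mult powr_mult powr_powr)
qed

lemma Lp_uminus:
  assumes "F \<in> Lp p" "p \<ge> 1"
  shows "(\<lambda>x. - F x) \<in> Lp p" "Lnorm p (\<lambda>x. - F x) = Lnorm p F"
  using Lp_cmult[OF assms, of "-1"] by auto

lemma Lp_diff:
  assumes F: "F \<in> Lp p" and G: "G \<in> Lp p" and p: "p \<ge> 1"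
  shows "(\<lambda>x. F x - G x) \<in> Lp p" "Lnorm p (\<lambda>x. F x - G x) \<le> Lnorm p F + Lnorm p G"
  using Lp_add[OF F Lp_uminus(1)[OF G p] p] Lp_uminus[OF G p] by auto

lemma Lnorm_diff_ge:
  assumes F: "F \<in> Lp p" and G: "G \<in> Lp p" and p: "p \<ge> 1"
  shows "\<bar>Lnorm p F - Lnorm p G\<bar> \<le> Lnorm p (\<lambda>x. F x - G x)"
proof -
  have "Lnorm p F \<le> Lnorm p (\<lambda>x. F x - G x) + Lnorm p G"
    using Lp_add(2)[OF Lp_diff(1)[OF F G p] G p] by simp
  moreover have "Lnorm p G \<le> Lnorm p (\<lambda>x. F x - G x) + Lnorm p F"
    using Lp_diff(2)[OF F Lp_diff(1)[OF F G p] p] by simp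
  ultimately show ?thesis by linarith
qed

lemma Lp_zero: "p \<ge> 1 \<Longrightarrow> (\<lambda>x. 0) \<in> Lp p" "p \<ge> 1 \<Longrightarrow> Lnorm p (\<lambda>x. 0) = 0"
  by (auto simp: Lp_def Lnorm_def)

lemma Lp_sum:
  assumes "\<And>i. i \<in> I \<Longrightarrow> F i \<in> Lp p" "p \<ge> 1"
  shows "(\<lambda>x. \<Sum>i\<in>I. F i x) \<in> Lp p"
  using assms(1)
proof (induction I rule: infinite_finite_induct)
  case (insert i I)
  then show ?case using Lp_add(1)[of "F i" p "\<lambda>x. \<Sum>i\<in>I. F i x"] assms(2) by auto
qed (use Lp_zero assms in auto)

lemma Lnorm_eq_0_iff:
  assumes F: "F \<in> Lp p" and p: "p \<ge> 1"
  shows "Lnorm p F = 0 \<longleftrightarrow> (AE x in lborel. F x = 0)"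
proof -
  have "Lnorm p F = 0 \<longleftrightarrow> (LINT x|lborel. norm (F x) powr p) = 0"
    using p by (auto simp: Lnorm_def)
  also have "\<dots> \<longleftrightarrow> (AE x in lborel. norm (F x) powr p = 0)"
    by (rule integral_nonneg_eq_0_iff_AE[OF Lp_integrable[OF F]]) auto
  finally show ?thesis by simp
qed

section \<open>Inequalities of Jensen, Minkowski (integral form) and Young\<close>

text \<open>Jensen's inequality for the measure with density \<open>norm (k y)\<close>, whose mass
  is \<open>L1 k\<close> instead of 1; hence the factor \<open>L1 k powr (p - 1)\<close>. The
  tangent is taken at the mean \<open>S / L1 k\<close>. Integrability of the product comes from
  \<open>x \<le> 1 + x powr p\<close>.\<close>

lemma weighted_powr_mean:
  fixes k g :: "real \<Rightarrow> complex"
  assumes k: "integrable lborel k" and [measurable]: "g \<in> borel_measurable borel"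
    and i: "integrable lborel (\<lambda>y. norm (k y) * norm (g y) powr p)" and p: "p \<ge> 1"
  shows "integrable lborel (\<lambda>y. k y * g y)"
    "norm (LINT y|lborel. k y * g y) powr p \<le> L1 k powr (p - 1) * (LINT y|lborel. norm (k y) * norm (g y) powr p)"
proof -
  have [measurable]: "k \<in> borel_measurable borel" using k by auto
  have b: "norm (g y) \<le> 1 + norm (g y) powr p" for y
  proof (cases "norm (g y) \<le> 1")
    case False
    then have "norm (g y) powr 1 \<le> norm (g y) powr p" using p by (intro powr_mono) auto
    then show ?thesis by (simp add: powr_one_gt_zero_iff)
  qed (simp add: add_increasing2)
  have "integrable lborel (\<lambda>y. norm (k y) + norm (k y) * norm (g y) powr p)"
    using k i by auto
  then show int: "integrable lborel (\<lambda>y. k y * g y)"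
  proof (rule Bochner_Integration.integrable_bound)
    show "AE y in lborel. norm (k y * g y) \<le> norm (norm (k y) + norm (k y) * norm (g y) powr p)"
    proof (rule AE_I2)
      fix y
      have "norm (k y) * norm (g y) \<le> norm (k y) * (1 + norm (g y) powr p)"
        by (rule mult_left_mono[OF b norm_ge_zero])
      then show "norm (k y * g y) \<le> norm (norm (k y) + norm (k y) * norm (g y) powr p)"
        by (simp add: norm_mult distrib_left)
    qed
  qed simp
  define S where "S = (LINT y|lborel. norm (k y) * norm (g y))"
  have iS: "integrable lborel (\<lambda>y. norm (k y) * norm (g y))"
    using integrable_norm[OF int] by (simp add: norm_mult)
  have le: "norm (LINT y|lborel. k y * g y) \<le> S"
    unfolding S_def using integral_norm_bound[of lborel "\<lambda>y. k y * g y"] by (simp add: norm_mult)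
  have S0: "S \<ge> 0" by (simp add: S_def)
  have "S powr p \<le> L1 k powr (p - 1) * (LINT y|lborel. norm (k y) * norm (g y) powr p)"
  proof (cases "S = 0")
    case True then show ?thesis using p by (auto intro!: mult_nonneg_nonneg)
  next
    case False
    have K: "L1 k > 0"
    proof (rule ccontr)
      assume "\<not> L1 k > 0"
      then have "L1 k = 0" using L1_nonneg[of k] by linarith
      then have "AE y in lborel. norm (k y) = 0"
        unfolding L1_def using k by (subst (asm) integral_nonneg_eq_0_iff_AE) auto
      then have "S = 0" unfolding S_def by (intro integral_eq_zero_AE) auto
      with False show False by simp
    qed
    define m where "m = S / L1 k"
    have m: "m > 0" using K False S0 by (simp add: m_def)
    have "(LINT y|lborel. (m powr p - p * m powr (p - 1) * m) * norm (k y) + p * m powr (p - 1) * (norm (k y) * norm (g y)))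
        \<le> (LINT y|lborel. norm (k y) * norm (g y) powr p)"
    proof (rule integral_mono)
      fix y
      have "norm (k y) * (m powr p + p * m powr (p - 1) * (norm (g y) - m)) \<le> norm (k y) * norm (g y) powr p"
        using powr_above_tangent[of "norm (g y)" m p] m p by (intro mult_left_mono) auto
      then show "(m powr p - p * m powr (p - 1) * m) * norm (k y) + p * m powr (p - 1) * (norm (k y) * norm (g y))
          \<le> norm (k y) * norm (g y) powr p" by (simp add: algebra_simps)
    qed (use k i iS in auto)
    also have "(LINT y|lborel. (m powr p - p * m powr (p - 1) * m) * norm (k y) + p * m powr (p - 1) * (norm (k y) * norm (g y)))
       = (m powr p - p * m powr (p - 1) * m) * L1 k + p * m powr (p - 1) * S"
      using k iS by (subst Bochner_Integration.integral_add) (auto simp: L1_def S_def)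
    also have "\<dots> = m powr p * L1 k" using K by (simp add: m_def field_simps)
    finally have *: "m powr p * L1 k \<le> (LINT y|lborel. norm (k y) * norm (g y) powr p)" .
    have "S powr p = L1 k powr (p - 1) * (m powr p * L1 k)"
      using K S0 by (simp add: m_def powr_divide powr_diff)
    also have "\<dots> \<le> L1 k powr (p - 1) * (LINT y|lborel. norm (k y) * norm (g y) powr p)"
      using * by (intro mult_left_mono) auto
    finally show ?thesis .
  qed
  moreover have "norm (LINT y|lborel. k y * g y) powr p \<le> S powr p"
    using le p by (intro powr_mono2) auto
  ultimately show "norm (LINT y|lborel. k y * g y) powr p \<le> L1 k powr (p - 1) * (LINT y|lborel. norm (k y) * norm (g y) powr p)"
    by linarith
qed

lemma nn_integral_shift:
  fixes f :: "real \<Rightarrow> ennreal"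
  assumes "f \<in> borel_measurable borel"
  shows "(\<integral>\<^sup>+x. f (x + t) \<partial>lborel) = (\<integral>\<^sup>+x. f x \<partial>lborel)" "(\<integral>\<^sup>+x. f (t + x) \<partial>lborel) = (\<integral>\<^sup>+x. f x \<partial>lborel)"
  using nn_integral_real_affine[OF assms, of 1 t] by (auto simp: add.commute)

lemma AE_shift:
  assumes "AE x in lborel. P x" "Measurable.pred borel P"
  shows "AE x in lborel. P (t + (x::real))"
proof -
  have "AE x in distr lborel borel ((+) t). P x"
    unfolding lborel_distr_plus by (rule assms(1))
  then show ?thesis by (subst (asm) AE_distr_iff) (use assms(2) in auto)
qed

text \<open>Jensen's inequality in y for almost every x, then Tonelli. \<open>D\<close> depends on
  both variables so that the estimate covers the translates \<open>F (x + y)\<close> in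
  \<open>cor_Lp\<close> as well as the modulated differences of indicators in
  \<open>approximate_eigenvector\<close>.\<close>

lemma minkowski_integral:
  fixes k :: "real \<Rightarrow> complex" and D :: "real \<Rightarrow> real \<Rightarrow> complex"
  assumes k: "integrable lborel k" and D: "case_prod D \<in> borel_measurable (borel \<Otimes>\<^sub>M borel)"
    and fin: "(\<integral>\<^sup>+y. ennreal (norm (k y)) * (\<integral>\<^sup>+x. ennreal (norm (D x y) powr p) \<partial>lborel) \<partial>lborel) \<le> ennreal C"
    and p: "p \<ge> 1"
  shows "AE x in lborel. integrable lborel (\<lambda>y. k y * D x y)"
    "(\<lambda>x. LINT y|lborel. k y * D x y) \<in> borel_measurable borel"
    "(\<integral>\<^sup>+x. ennreal (norm (LINT y|lborel. k y * D x y) powr p) \<partial>lborel) \<le> ennreal (L1 k powr (p - 1) * C)"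
proof -
  have [measurable]: "k \<in> borel_measurable borel" using k by auto
  have D'[measurable]: "(\<lambda>x. D (f x) (g x)) \<in> borel_measurable M"
    if "f \<in> borel_measurable M" "g \<in> borel_measurable M" for f g and M :: "'z measure"
    using measurable_compose[OF measurable_Pair[OF that] D] by simp
  show meas[measurable]: "(\<lambda>x. LINT y|lborel. k y * D x y) \<in> borel_measurable borel"
    by measurable
  have "(\<integral>\<^sup>+y. ennreal (norm (k y)) * (\<integral>\<^sup>+x. ennreal (norm (D x y) powr p) \<partial>lborel) \<partial>lborel)
      = (\<integral>\<^sup>+y. \<integral>\<^sup>+x. ennreal (norm (k y) * norm (D x y) powr p) \<partial>lborel \<partial>lborel)"
    by (subst nn_integral_cmult[symmetric]) (auto simp: ennreal_mult)
  also have "\<dots> = (\<integral>\<^sup>+x. \<integral>\<^sup>+y. ennreal (norm (k y) * norm (D x y) powr p) \<partial>lborel \<partial>lborel)"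
    by (rule lborel_pair.Fubini') measurable
  finally have F: "(\<integral>\<^sup>+x. \<integral>\<^sup>+y. ennreal (norm (k y) * norm (D x y) powr p) \<partial>lborel \<partial>lborel) \<le> ennreal C"
    using fin by simp
  then have "AE x in lborel. (\<integral>\<^sup>+y. ennreal (norm (k y) * norm (D x y) powr p) \<partial>lborel) \<noteq> \<infinity>"
    by (intro nn_integral_noteq_infinite) (auto simp: top_unique)
  then have AEi: "AE x in lborel. integrable lborel (\<lambda>y. norm (k y) * norm (D x y) powr p)"
    by eventually_elim (auto simp: integrable_iff_bounded less_top)
  then show "AE x in lborel. integrable lborel (\<lambda>y. k y * D x y)"
    by eventually_elim (rule weighted_powr_mean(1)[OF k _ _ p], auto)
  have "(\<integral>\<^sup>+x. ennreal (norm (LINT y|lborel. k y * D x y) powr p) \<partial>lborel)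
     \<le> (\<integral>\<^sup>+x. ennreal (L1 k powr (p - 1)) * (\<integral>\<^sup>+y. ennreal (norm (k y) * norm (D x y) powr p) \<partial>lborel) \<partial>lborel)"
  proof (rule nn_integral_mono_AE, use AEi in eventually_elim)
    fix x assume elim: "integrable lborel (\<lambda>y. norm (k y) * norm (D x y) powr p)"
    have "norm (LINT y|lborel. k y * D x y) powr p \<le> L1 k powr (p - 1) * (LINT y|lborel. norm (k y) * norm (D x y) powr p)"
      by (rule weighted_powr_mean(2)[OF k _ elim p]) auto
    then have "ennreal (norm (LINT y|lborel. k y * D x y) powr p) \<le> ennreal (L1 k powr (p - 1) * (LINT y|lborel. norm (k y) * norm (D x y) powr p))"
      by (rule ennreal_leI)
    also have "\<dots> = ennreal (L1 k powr (p - 1)) * (\<integral>\<^sup>+y. ennreal (norm (k y) * norm (D x y) powr p) \<partial>lborel)"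
      by (subst nn_integral_eq_integral[OF elim]) (auto simp: ennreal_mult)
    finally show "ennreal (norm (LINT y|lborel. k y * D x y) powr p)
      \<le> ennreal (L1 k powr (p - 1)) * (\<integral>\<^sup>+y. ennreal (norm (k y) * norm (D x y) powr p) \<partial>lborel)" .
  qed
  also have "\<dots> = ennreal (L1 k powr (p - 1)) * (\<integral>\<^sup>+x. \<integral>\<^sup>+y. ennreal (norm (k y) * norm (D x y) powr p) \<partial>lborel \<partial>lborel)"
    by (rule nn_integral_cmult) measurable
  also have "\<dots> \<le> ennreal (L1 k powr (p - 1)) * ennreal C"
    using F by (rule mult_left_mono) simp
  finally show "(\<integral>\<^sup>+x. ennreal (norm (LINT y|lborel. k y * D x y) powr p) \<partial>lborel) \<le> ennreal (L1 k powr (p - 1) * C)"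
    by (simp add: ennreal_mult')
qed

text \<open>Young's inequality: by translation invariance the inner integral over x does not depend
  on y, so the weight \<open>norm (k y)\<close> integrates to \<open>L1 k\<close>.\<close>

lemma cor_Lp:
  assumes k: "integrable lborel k" and F: "F \<in> Lp p" and p: "p \<ge> 1"
  shows "AE x in lborel. integrable lborel (\<lambda>y. k y * F (x + y))"
    "cor k F \<in> Lp p" "Lnorm p (cor k F) \<le> L1 k * Lnorm p F"
proof -
  have [measurable]: "k \<in> borel_measurable borel" using k by auto
  note [measurable] = Lp_measurable[OF F]
  have eq: "(\<integral>\<^sup>+y. ennreal (norm (k y)) * (\<integral>\<^sup>+x. ennreal (norm (F (x + y)) powr p) \<partial>lborel) \<partial>lborel) 
     = ennreal (L1 k * Lnorm p F powr p)"
  proof -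
    have "(\<integral>\<^sup>+x. ennreal (norm (F (x + y)) powr p) \<partial>lborel) = ennreal (Lnorm p F powr p)" for y
      using nn_integral_shift(1)[of "\<lambda>x. ennreal (norm (F x) powr p)" y] nn_integral_Lp[OF F p] by simp
    moreover have "(\<integral>\<^sup>+y. ennreal (norm (k y)) \<partial>lborel) = ennreal (L1 k)"
      unfolding L1_def using k by (intro nn_integral_eq_integral) auto
    ultimately show ?thesis by (simp add: nn_integral_multc ennreal_mult)
  qed
  have D: "case_prod (\<lambda>x y. F (x + y)) \<in> borel_measurable (borel \<Otimes>\<^sub>M borel)" by measurable
  note * = minkowski_integral[OF k D eq_refl[OF eq] p]
  show "AE x in lborel. integrable lborel (\<lambda>y. k y * F (x + y))" by (rule *(1))
  have m: "cor k F \<in> borel_measurable borel" using *(2) by (simp add: cor_def[abs_def])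
  have "L1 k powr (p - 1) * (L1 k * Lnorm p F powr p) = (L1 k * Lnorm p F) powr p"
    by (cases "L1 k = 0") (auto simp: powr_mult powr_diff)
  with *(3) have "(\<integral>\<^sup>+x. ennreal (norm (cor k F x) powr p) \<partial>lborel) \<le> ennreal ((L1 k * Lnorm p F) powr p)"
    by (simp add: cor_def)
  note ** = Lnorm_leI[OF m p _ this]
  show "cor k F \<in> Lp p" "Lnorm p (cor k F) \<le> L1 k * Lnorm p F" by (rule **; simp)+
qed

text \<open>A shift of a null set is null, so for each x the two integrands agree almost everywhere.
  The conclusion therefore holds at every x, which later allows replacing the argument of
  \<open>cor\<close> inside almost-everywhere statements.\<close>

lemma cor_AE_cong:
  assumes "AE x in lborel. F x = G x" and [measurable]: "k \<in> borel_measurable borel" 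
    "F \<in> borel_measurable borel" "G \<in> borel_measurable borel"
  shows "cor k F x = cor k G x"
proof -
  have "AE y in lborel. F (x + y) = G (x + y)"
    by (rule AE_shift[OF assms(1)]) measurable
  then show ?thesis unfolding cor_def by (intro integral_cong_AE) auto
qed

lemma cor_add:
  assumes "integrable lborel k" "F \<in> Lp p" "G \<in> Lp p" "p \<ge> 1"
  shows "AE x in lborel. cor k (\<lambda>x. F x + G x) x = cor k F x + cor k G x"
  using cor_Lp(1)[OF assms(1,2,4)] cor_Lp(1)[OF assms(1,3,4)]
  by eventually_elim (simp add: cor_def distrib_left)

lemma cor_diff:
  assumes "integrable lborel k" "F \<in> Lp p" "G \<in> Lp p" "p \<ge> 1"
  shows "AE x in lborel. cor k (\<lambda>x. F x - G x) x = cor k F x - cor k G x"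
  using cor_Lp(1)[OF assms(1,2,4)] cor_Lp(1)[OF assms(1,3,4)]
  by eventually_elim (simp add: cor_def right_diff_distrib)

lemma cor_cmult: "cor k (\<lambda>x. c * F x) x = c * cor k F x"
  unfolding cor_def by (subst integral_mult_right_zero[symmetric]) (simp add: algebra_simps)

lemma cor_kernel_cmult: "cor (\<lambda>x. c * k x) F x = c * cor k F x"
  unfolding cor_def by (subst integral_mult_right_zero[symmetric]) (simp add: algebra_simps)

lemma cor_kernel_diff:
  assumes "integrable lborel k" "integrable lborel l" "F \<in> Lp p" "p \<ge> 1"
  shows "AE x in lborel. cor (\<lambda>x. k x - l x) F x = cor k F x - cor l F x"
  using cor_Lp(1)[OF assms(1,3,4)] cor_Lp(1)[OF assms(2,3,4)]
  by eventually_elim (simp add: cor_def left_diff_distrib)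

section \<open>Convolution of kernels and composition of correlations\<close>

lemma integrable_shift_iff:
  fixes f :: "real \<Rightarrow> complex"
  shows "integrable lborel (\<lambda>x. f (t + x)) \<longleftrightarrow> integrable lborel f"
  using lborel_integrable_real_affine_iff[of 1 f t] by simp

lemma integral_shift:
  fixes f :: "real \<Rightarrow> complex"
  shows "(LINT x|lborel. f (t + x)) = (LINT x|lborel. f x)"
  using lborel_integral_real_affine[of 1 f t] by simp

lemma conv_commute: "conv k l w = conv l k w"
  unfolding conv_def
  using lborel_integral_real_affine[of "-1" "\<lambda>y. k y * l (w - y)" w] by (simp add: mult.commute)

lemma conv_integrable:
  assumes k: "integrable lborel k" and l: "integrable lborel l"
  shows "integrable lborel (conv k l)"
proof -
  have [measurable]: "k \<in> borel_measurable borel" "l \<in> borel_measurable borel" using k l by auto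
  have "integrable (lborel \<Otimes>\<^sub>M lborel) (\<lambda>(y, w). k y * l (w - y))"
  proof (rule lborel_pair.Fubini_integrable)
    have "(LINT w|lborel. norm (k y * l (w - y))) = norm (k y) * L1 l" for y
      using lborel_integral_real_affine[of 1 "\<lambda>w. norm (l w)" "-y"] by (simp add: L1_def norm_mult)
    then show "integrable lborel (\<lambda>y. LINT w|lborel. norm (case (y, w) of (y, w) \<Rightarrow> k y * l (w - y)))"
      using k by simp
    show "AE y in lborel. integrable lborel (\<lambda>w. case (y, w) of (y, w) \<Rightarrow> k y * l (w - y))"
      using l integrable_shift_iff[of l "- _"] by simp
  qed measurable
  from lborel_pair.integrable_snd[OF this] show ?thesis by (simp add: conv_def[abs_def])
qed

text \<open>Fubini at a fixed x. The absolute integrability that it needs at almost every x is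
  Young's inequality applied to the moduli of k, l and F; \<open>A2\<close> is the resulting
  finiteness of the double correlation.\<close>

lemma cor_cor:
  assumes k: "integrable lborel k" and l: "integrable lborel l" and F: "F \<in> Lp p" and p: "p \<ge> 1"
  shows "AE x in lborel. cor k (cor l F) x = cor (conv k l) F x"
proof -
  have [measurable]: "k \<in> borel_measurable borel" "l \<in> borel_measurable borel" using k l by auto
  note [measurable] = Lp_measurable[OF F]
  define k' where "k' = (\<lambda>x. complex_of_real (norm (k x)))"
  define l' where "l' = (\<lambda>x. complex_of_real (norm (l x)))"
  define F' where "F' = (\<lambda>x. complex_of_real (norm (F x)))"
  have k': "integrable lborel k'" and l': "integrable lborel l'" using k l by (auto simp: k'_def l'_def)
  have F': "F' \<in> Lp p" using F by (auto simp: F'_def Lp_def)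
  define G where "G = cor l' F'"
  have G: "G \<in> Lp p" unfolding G_def by (rule cor_Lp(2)[OF l' F' p])
  have A1: "AE x in lborel. integrable lborel (\<lambda>y. l y * F (x + y))"
    by (rule cor_Lp(1)[OF l F p])
  have A2: "AE x in lborel. integrable lborel (\<lambda>y. k' y * G (x + y))"
    by (rule cor_Lp(1)[OF k' G p])
  show ?thesis using A2
  proof eventually_elim
    case (elim x)
    have "AE y in lborel. integrable lborel (\<lambda>z. l z * F (x + y + z))"
      by (rule AE_shift[OF A1]) measurable
    then have A3: "AE y in lborel. integrable lborel (\<lambda>w. l (w - y) * F (x + w))"
    proof eventually_elim
      case (elim y)
      then show ?case using integrable_shift_iff[of "\<lambda>w. l (w - y) * F (x + w)" y] by (simp add: add.assoc)
    qed
    have I: "integrable (lborel \<Otimes>\<^sub>M lborel) (\<lambda>(y, w). k y * (l (w - y) * F (x + w)))"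
    proof (rule lborel_pair.Fubini_integrable)
      have "(LINT w|lborel. norm (k y * (l (w - y) * F (x + w)))) = norm (k' y * G (x + y))" for y
      proof -
        have "G (x + y) = (LINT z|lborel. complex_of_real (norm (l z) * norm (F (x + y + z))))"
          by (simp add: G_def cor_def l'_def F'_def)
        also have "\<dots> = complex_of_real (LINT z|lborel. norm (l z) * norm (F (x + y + z)))"
          by (rule integral_complex_of_real)
        also have "(LINT z|lborel. norm (l z) * norm (F (x + y + z))) = (LINT w|lborel. norm (l (w - y)) * norm (F (x + w)))"
          using lborel_integral_real_affine[of 1 "\<lambda>w. norm (l (w - y)) * norm (F (x + w))" y] by (simp add: add.assoc)
        finally show ?thesis by (simp add: k'_def norm_mult)
      qed
      then show "integrable lborel (\<lambda>y. LINT w|lborel. norm (case (y, w) of (y, w) \<Rightarrow> k y * (l (w - y) * F (x + w))))"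
        using elim by (simp add: integrable_norm)
      show "AE y in lborel. integrable lborel (\<lambda>w. case (y, w) of (y, w) \<Rightarrow> k y * (l (w - y) * F (x + w)))"
        using A3 by eventually_elim simp
    qed measurable
    have "cor k (cor l F) x = (LINT y|lborel. k y * (LINT w|lborel. l (w - y) * F (x + w)))"
    proof -
      have "(LINT z|lborel. l z * F (x + y + z)) = (LINT w|lborel. l (w - y) * F (x + w))" for y
        using integral_shift[of "\<lambda>w. l (w - y) * F (x + w)" y] by (simp add: add.assoc)
      then show ?thesis by (simp add: cor_def)
    qed
    also have "\<dots> = (LINT y|lborel. LINT w|lborel. k y * (l (w - y) * F (x + w)))"
      by simp
    also have "\<dots> = (LINT w|lborel. LINT y|lborel. k y * (l (w - y) * F (x + w)))"
      using lborel_pair.Fubini_integral[OF I] by simp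
    also have "\<dots> = (LINT w|lborel. (LINT y|lborel. k y * l (w - y)) * F (x + w))"
      by (simp add: mult.assoc[symmetric])
    also have "\<dots> = cor (conv k l) F x" by (simp add: cor_def conv_def)
    finally show ?case .
  qed
qed

lemma cor_commute:
  assumes k: "integrable lborel k" and l: "integrable lborel l" and F: "F \<in> Lp p" and p: "p \<ge> 1"
  shows "AE x in lborel. cor k (cor l F) x = cor l (cor k F) x"
proof -
  have "conv k l = conv l k" by (rule ext, rule conv_commute)
  then show ?thesis using cor_cor[OF assms] cor_cor[OF l k F p] by (auto elim: eventually_elim2)
qed

text \<open>A rapidly Cauchy subsequence converges almost everywhere; Fatou's lemma identifies its limit.\<close>

lemma Lp_complete:
  assumes G: "\<And>n. G n \<in> Lp p" and p: "p \<ge> 1"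
    and Cauchy: "\<And>e. e > 0 \<Longrightarrow> \<exists>N. \<forall>m\<ge>N. \<forall>n\<ge>N. Lnorm p (\<lambda>x. G m x - G n x) < e"
  obtains g where "g \<in> Lp p" "(\<lambda>n. Lnorm p (\<lambda>x. G n x - g x)) \<longlonglongrightarrow> 0"
proof -
  note [measurable] = Lp_measurable[OF G]
  \<comment> \<open>The ratio 1/4 leaves room: after multiplication by \<open>2^k\<close> the k-th
    difference still has norm at most \<open>(1/2)^k\<close>, so almost everywhere the differences
    are eventually below \<open>(1/2)^k\<close> and their series converges absolutely.\<close>
  have "\<forall>k. \<exists>N. \<forall>m\<ge>N. \<forall>n\<ge>N. Lnorm p (\<lambda>x. G m x - G n x) < (1/4)^k"
    using Cauchy by simp
  then obtain N where N: "\<And>k m n. m \<ge> N k \<Longrightarrow> n \<ge> N k \<Longrightarrow> Lnorm p (\<lambda>x. G m x - G n x) < (1/4)^k"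
    by metis
  \<comment> \<open>Summing the thresholds makes \<open>r\<close> nondecreasing and the extra
    \<open>k\<close> makes it tend to infinity, without a recursive choice of indices.\<close>
  define r where "r k = (\<Sum>i\<le>k. N i) + k" for k
  have rN: "r k \<ge> N k" for k unfolding r_def
    by (rule order_trans[OF member_le_sum[of k "{..k}" N]]) auto
  have rk: "r k \<ge> k" for k by (simp add: r_def)
  have rS: "r (Suc k) \<ge> r k" for k by (simp add: r_def)
  define D where "D k x = G (r (Suc k)) x - G (r k) x" for k x
  have D[measurable]: "D k \<in> borel_measurable borel" for k unfolding D_def by measurable
  have DL: "D k \<in> Lp p" for k unfolding D_def by (rule Lp_diff(1)[OF G G p])
  have Dn: "Lnorm p (D k) \<le> (1/4)^k" for k
    unfolding D_def using N[of k "r (Suc k)" "r k"] rN[of k] rS[of k] by simp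
  have b: "(\<integral>\<^sup>+x. ennreal ((2^k * norm (D k x)) powr p) \<partial>lborel) \<le> ennreal ((1/2)^k)" for k
  proof -
    have "(\<integral>\<^sup>+x. ennreal ((2^k * norm (D k x)) powr p) \<partial>lborel) = ennreal ((2^k * Lnorm p (D k)) powr p)"
      using nn_integral_Lp[OF Lp_cmult(1)[OF DL p, of "2^k" k] p] Lp_cmult(2)[OF DL p, of "2^k" k]
      by (simp add: norm_mult norm_power)
    also have "\<dots> \<le> ennreal (((1/2)^k) powr p)"
    proof (intro ennreal_leI powr_mono2)
      have "2^k * Lnorm p (D k) \<le> 2^k * (1/4)^k" using Dn by (intro mult_left_mono) auto
      also have "\<dots> = (1/2 :: real)^k" by (simp flip: power_mult_distrib)
      finally show "2^k * Lnorm p (D k) \<le> (1/2)^k" .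
    qed (use p in auto)
    also have "\<dots> \<le> ennreal (((1/2)^k) powr 1)"
      using p by (intro ennreal_leI powr_mono') (auto simp: power_le_one)
    finally show ?thesis by simp
  qed
  have "(\<integral>\<^sup>+x. (\<Sum>k. ennreal ((2^k * norm (D k x)) powr p)) \<partial>lborel)
      = (\<Sum>k. \<integral>\<^sup>+x. ennreal ((2^k * norm (D k x)) powr p) \<partial>lborel)"
    by (rule nn_integral_suminf) measurable
  also have "\<dots> \<le> (\<Sum>k. ennreal ((1/2)^k))"
    by (intro suminf_le b) auto
  also have "\<dots> < \<infinity>"
    by (subst suminf_ennreal2) (auto simp: summable_geometric)
  finally have "AE x in lborel. (\<Sum>k. ennreal ((2^k * norm (D k x)) powr p)) \<noteq> \<infinity>"
    by (intro nn_integral_noteq_infinite) auto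
  then have conv: "AE x in lborel. convergent (\<lambda>k. G (r k) x)"
  proof eventually_elim
    case (elim x)
    have "summable (\<lambda>k. (2^k * norm (D k x)) powr p)"
      using elim by (intro summable_suminf_not_top) auto
    then have "(\<lambda>k. (2^k * norm (D k x)) powr p) \<longlonglongrightarrow> 0" by (rule summable_LIMSEQ_zero)
    then have "eventually (\<lambda>k. (2^k * norm (D k x)) powr p < 1) sequentially"
      by (rule order_tendstoD) simp
    then have "eventually (\<lambda>k. norm (norm (D k x)) \<le> (1/2)^k) sequentially"
    proof eventually_elim
      case (elim k)
      have "2^k * norm (D k x) \<le> 1"
      proof (rule ccontr)
        assume "\<not> 2^k * norm (D k x) \<le> 1"
        then have "1 powr p \<le> (2^k * norm (D k x)) powr p" using p by (intro powr_mono2) auto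
        with elim show False by simp
      qed
      then show ?case by (simp add: field_simps power_divide)
    qed
    then have "summable (\<lambda>k. norm (D k x))"
      by (rule summable_comparison_test_ev) (simp add: summable_geometric)
    then have "summable (\<lambda>k. D k x)" by (rule summable_norm_cancel)
    then have "convergent (\<lambda>n. \<Sum>k<n. D k x)" by (simp add: summable_iff_convergent)
    also have "(\<lambda>n. \<Sum>k<n. D k x) = (\<lambda>n. G (r n) x - G (r 0) x)"
      unfolding D_def by (rule ext, rule sum_lessThan_telescope)
    finally show ?case using convergent_diff_const_right_iff[of "\<lambda>n. G (r n) x" "G (r 0) x"] by simp
  qed
  define g where "g x = lim (\<lambda>k. G (r k) x)" for x
  have [measurable]: "g \<in> borel_measurable borel" unfolding g_def by measurable
  have main: "(\<lambda>x. G n x - g x) \<in> Lp p \<and> Lnorm p (\<lambda>x. G n x - g x) \<le> e"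
    if e: "e > 0" "\<And>m. m \<ge> M \<Longrightarrow> Lnorm p (\<lambda>x. G n x - G m x) < e" for n e M
  proof -
    have "(\<integral>\<^sup>+x. ennreal (norm (G n x - g x) powr p) \<partial>lborel)
       = (\<integral>\<^sup>+x. liminf (\<lambda>k. ennreal (norm (G n x - G (r k) x) powr p)) \<partial>lborel)"
    proof (rule nn_integral_cong_AE, use conv in eventually_elim)
      fix x assume "convergent (\<lambda>k. G (r k) x)"
      then have "(\<lambda>k. G (r k) x) \<longlonglongrightarrow> g x" by (simp add: convergent_LIMSEQ_iff g_def)
      then have "(\<lambda>k. ennreal (norm (G n x - G (r k) x) powr p)) \<longlonglongrightarrow> ennreal (norm (G n x - g x) powr p)"
        using p by (intro tendsto_ennrealI tendsto_powr2 tendsto_intros) auto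
      then show "ennreal (norm (G n x - g x) powr p) = liminf (\<lambda>k. ennreal (norm (G n x - G (r k) x) powr p))"
        by (intro lim_imp_Liminf[symmetric]) auto
    qed
    also have "\<dots> \<le> liminf (\<lambda>k. \<integral>\<^sup>+x. ennreal (norm (G n x - G (r k) x) powr p) \<partial>lborel)"
      by (rule nn_integral_liminf) measurable
    also have "\<dots> \<le> liminf (\<lambda>k. ennreal (e powr p))"
    proof (rule Liminf_mono, rule eventually_mono[OF eventually_ge_at_top[of M]])
      fix k assume "k \<ge> M"
      then have "Lnorm p (\<lambda>x. G n x - G (r k) x) \<le> e" using e(2)[of "r k"] rk[of k] by simp
      then show "(\<integral>\<^sup>+x. ennreal (norm (G n x - G (r k) x) powr p) \<partial>lborel) \<le> ennreal (e powr p)"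
        using p by (subst nn_integral_Lp[OF Lp_diff(1)[OF G G p] p]) (auto intro!: ennreal_leI powr_mono2)
    qed
    also have "\<dots> = ennreal (e powr p)" by (simp add: Liminf_const)
    finally have *: "(\<integral>\<^sup>+x. ennreal (norm (G n x - g x) powr p) \<partial>lborel) \<le> ennreal (e powr p)" .
    show ?thesis using Lnorm_leI[OF _ p less_imp_le[OF e(1)] *] by simp
  qed
  show ?thesis
  proof
    obtain M where "\<forall>m\<ge>M. \<forall>n\<ge>M. Lnorm p (\<lambda>x. G m x - G n x) < 1" using Cauchy[of 1] by auto
    then have "(\<lambda>x. G M x - g x) \<in> Lp p" using main[of 1 M M] by auto
    from Lp_diff(1)[OF G[of M] this p] show "g \<in> Lp p" by simp
    show "(\<lambda>n. Lnorm p (\<lambda>x. G n x - g x)) \<longlonglongrightarrow> 0"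
    proof (rule LIMSEQ_I)
      fix e :: real assume e: "e > 0"
      obtain M where M: "\<forall>m\<ge>M. \<forall>n\<ge>M. Lnorm p (\<lambda>x. G m x - G n x) < e/2" using Cauchy[of "e/2"] e by auto
      show "\<exists>no. \<forall>n\<ge>no. norm (Lnorm p (\<lambda>x. G n x - g x) - 0) < e"
      proof (intro exI[of _ M] allI impI)
        fix n assume "n \<ge> M"
        then have "Lnorm p (\<lambda>x. G n x - g x) \<le> e/2" using main[of "e/2" M n] M e by auto
        then show "norm (Lnorm p (\<lambda>x. G n x - g x) - 0) < e" using e by simp
      qed
    qed
  qed
qed

section \<open>Fourier transforms of kernels\<close>

text \<open>With this sign, \<open>fourier k \<xi>\<close> is the eigenvalue of \<open>cor k\<close>
  on the character \<open>iexp (- (\<xi> * x))\<close>.\<close>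

definition fourier :: "(real \<Rightarrow> complex) \<Rightarrow> real \<Rightarrow> complex" where
  "fourier k \<xi> = (LINT y|lborel. iexp (- (\<xi> * y)) * k y)"

definition ifourier :: "(real \<Rightarrow> complex) \<Rightarrow> real \<Rightarrow> complex" where
  "ifourier q w = complex_of_real (1 / (2 * pi)) * (LINT \<xi>|lborel. q \<xi> * iexp (\<xi> * w))"

lemma integrable_iexp_mult:
  assumes "integrable lborel k" 
  shows "integrable lborel (\<lambda>y. iexp (a * y) * k y)" "integrable lborel (\<lambda>y. iexp (-(a * y)) * k y)"
    "integrable lborel (\<lambda>y. k y * iexp (a * y))"
proof -
  have [measurable]: "k \<in> borel_measurable borel" using assms by auto
  show "integrable lborel (\<lambda>y. iexp (a * y) * k y)" "integrable lborel (\<lambda>y. iexp (-(a * y)) * k y)"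
    "integrable lborel (\<lambda>y. k y * iexp (a * y))"
    by (rule Bochner_Integration.integrable_bound[OF assms]; simp add: norm_mult norm_exp_i_times)+
qed

lemma norm_fourier_le: "norm (fourier k \<xi>) \<le> L1 k"
  unfolding fourier_def L1_def
  by (rule order_trans[OF integral_norm_bound]) (auto simp: norm_mult norm_exp_i_times)

text \<open>The convolution theorem on the inverse side: integrability of k and q is enough for
  Fubini, whether or not \<open>ifourier q\<close> is integrable. This orientation avoids the
  Fourier inversion theorem, except for the explicit Gaussian.\<close>

lemma conv_ifourier:
  assumes k: "integrable lborel k" and q: "integrable lborel q"
  shows "conv k (ifourier q) w = ifourier (\<lambda>\<xi>. fourier k \<xi> * q \<xi>) w"
proof -
  have [measurable]: "k \<in> borel_measurable borel" "q \<in> borel_measurable borel" using k q by auto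
  have I: "integrable (lborel \<Otimes>\<^sub>M lborel) (\<lambda>(y, \<xi>). k y * (q \<xi> * iexp (\<xi> * (w - y))))"
  proof (rule lborel_pair.Fubini_integrable)
    have "(LINT \<xi>|lborel. norm (k y * (q \<xi> * iexp (\<xi> * (w - y))))) = norm (k y) * L1 q" for y
      by (simp add: norm_mult L1_def del: of_real_mult of_real_diff)
    then show "integrable lborel (\<lambda>y. LINT \<xi>|lborel. norm (case (y, \<xi>) of (y, \<xi>) \<Rightarrow> k y * (q \<xi> * iexp (\<xi> * (w - y)))))"
      using k by simp
    have "integrable lborel (\<lambda>\<xi>. q \<xi> * iexp (\<xi> * (w - y)))" for y
      using integrable_iexp_mult(3)[OF q, of "w - y"] by (simp add: mult.commute)
    then show "AE y in lborel. integrable lborel (\<lambda>\<xi>. case (y, \<xi>) of (y, \<xi>) \<Rightarrow> k y * (q \<xi> * iexp (\<xi> * (w - y))))"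
      by (intro AE_I2) simp
  qed measurable
  have "conv k (ifourier q) w = complex_of_real (1 / (2 * pi)) * (LINT y|lborel. LINT \<xi>|lborel. k y * (q \<xi> * iexp (\<xi> * (w - y))))"
    unfolding conv_def ifourier_def
    by (subst integral_mult_right_zero[symmetric]) (simp add: mult.left_commute del: of_real_mult of_real_diff)
  also have "(LINT y|lborel. LINT \<xi>|lborel. k y * (q \<xi> * iexp (\<xi> * (w - y)))) 
      = (LINT \<xi>|lborel. LINT y|lborel. k y * (q \<xi> * iexp (\<xi> * (w - y))))"
    using lborel_pair.Fubini_integral[OF I] by simp
  also have "\<dots> = (LINT \<xi>|lborel. fourier k \<xi> * q \<xi> * iexp (\<xi> * w))"
  proof -
    have "(LINT y|lborel. k y * (q \<xi> * iexp (\<xi> * (w - y)))) = fourier k \<xi> * q \<xi> * iexp (\<xi> * w)" for \<xi>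
    proof -
      have "(LINT y|lborel. k y * (q \<xi> * iexp (\<xi> * (w - y)))) = (LINT y|lborel. (iexp (- (\<xi> * y)) * k y) * (q \<xi> * iexp (\<xi> * w)))"
        by (rule Bochner_Integration.integral_cong) (auto simp: right_diff_distrib exp_diff exp_minus field_simps)
      also have "\<dots> = fourier k \<xi> * (q \<xi> * iexp (\<xi> * w))" unfolding fourier_def by simp
      finally show ?thesis by simp
    qed
    then show ?thesis by simp
  qed
  finally show ?thesis unfolding ifourier_def[of "\<lambda>\<xi>. fourier k \<xi> * q \<xi>"] .
qed

lemma ifourier_diff:
  assumes "integrable lborel q" "integrable lborel r"
  shows "ifourier (\<lambda>\<xi>. q \<xi> - r \<xi>) w = ifourier q w - ifourier r w"
  unfolding ifourier_def
  using integrable_iexp_mult(3)[OF assms(1), of w] integrable_iexp_mult(3)[OF assms(2), of w]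
  by (simp add: left_diff_distrib right_diff_distrib mult.commute)

lemma ifourier_cmult: "ifourier (\<lambda>\<xi>. c * q \<xi>) w = c * ifourier q w"
  unfolding ifourier_def by (simp add: mult.assoc mult.left_commute)

section \<open>Gaussian multipliers and integrability of inverse transforms\<close>

definition gauss_mult :: "real \<Rightarrow> real \<Rightarrow> real" where
  "gauss_mult \<epsilon> \<xi> = exp (- ((\<epsilon> * \<xi>)\<^sup>2 / 2))"

text \<open>A rescaling of the characteristic function of the standard normal distribution. It
  identifies the mollifier in \<open>resolvent_kernel\<close> as a genuine probability
  density.\<close>

lemma ifourier_gauss:
  assumes "\<epsilon> > 0"
  shows "ifourier (\<lambda>\<xi>. gauss_mult \<epsilon> \<xi>) w = normal_density 0 \<epsilon> w"
proof -
  define t where "t = w / \<epsilon>"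
  have 1: "(LINT x|lborel. std_normal_density x *\<^sub>R iexp (t * x)) = complex_of_real (exp (- (t^2) / 2))"
    using char_std_normal_distribution
    by (simp add: fun_eq_iff char_def integral_density normal_density_nonneg)
  have "(LINT \<xi>|lborel. gauss_mult \<epsilon> \<xi> * iexp (\<xi> * w)) = (1/\<epsilon>) *\<^sub>R (LINT x|lborel. gauss_mult \<epsilon> (x / \<epsilon>) * iexp ((x / \<epsilon>) * w))"
    using lborel_integral_real_affine[of "1/\<epsilon>" "\<lambda>\<xi>. gauss_mult \<epsilon> \<xi> * iexp (\<xi> * w)" 0] assms by simp
  also have "(LINT x|lborel. gauss_mult \<epsilon> (x / \<epsilon>) * iexp ((x / \<epsilon>) * w)) = (LINT x|lborel. sqrt (2 * pi) * (std_normal_density x *\<^sub>R iexp (t * x)))"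
    using assms by (intro Bochner_Integration.integral_cong refl)
       (simp add: gauss_mult_def std_normal_density_def t_def scaleR_conv_of_real mult.commute)
  also have "\<dots> = sqrt (2 * pi) * complex_of_real (exp (- (t^2) / 2))"
    by (simp only: integral_mult_right_zero 1)
  finally have "ifourier (\<lambda>\<xi>. gauss_mult \<epsilon> \<xi>) w = complex_of_real (1 / (2 * pi) * ((1/\<epsilon>) * (sqrt (2 * pi) * exp (- (t^2) / 2))))"
    by (simp add: ifourier_def scaleR_conv_of_real)
  also have "1 / (2 * pi) * ((1/\<epsilon>) * (sqrt (2 * pi) * exp (- (t^2) / 2))) = normal_density 0 \<epsilon> w"
  proof -
    have "sqrt (2 * pi * \<epsilon>\<^sup>2) = sqrt (2 * pi) * \<epsilon>" using assms by (simp add: real_sqrt_mult)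
    moreover have "2 * pi = sqrt (2 * pi) * sqrt (2 * pi)" by simp
    ultimately show ?thesis
      unfolding normal_density_def t_def using assms by (simp add: field_simps power_divide)
  qed
  finally show ?thesis .
qed

lemma integrable_inverse_one_plus_square: "integrable lborel (\<lambda>x::real. C / (1 + x\<^sup>2))"
  using integrable_inverse_1_plus_square
  by (auto simp: set_integrable_def einterval_def divide_inverse intro!: integrable_mult_right)

lemma integrable_of_inverse_square_bound:
  fixes q :: "real \<Rightarrow> complex"
  assumes "q \<in> borel_measurable borel" "\<And>x. norm (q x) \<le> C / (1 + x\<^sup>2)"
  shows "integrable lborel q"
proof (rule Bochner_Integration.integrable_bound[OF integrable_inverse_one_plus_square[of C]])
  show "AE x in lborel. norm (q x) \<le> norm (C / (1 + x\<^sup>2))"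
    using order_trans[OF assms(2) abs_ge_self] by (intro AE_I2) (simp only: real_norm_def)
qed (use assms in simp)

lemma integral_deriv_eq_0:
  fixes q q' :: "real \<Rightarrow> complex"
  assumes "\<And>x. (q has_vector_derivative q' x) (at x)" "\<And>x. isCont q' x" "integrable lborel q'"
    "(q \<longlongrightarrow> 0) at_top" "(q \<longlongrightarrow> 0) at_bot"
  shows "(LINT x|lborel. q' x) = 0"
proof -
  have "(LBINT x=-\<infinity>..\<infinity>. q' x) = 0 - 0"
  proof (rule interval_integral_FTC_integrable)
    show "set_integrable lborel (einterval (- \<infinity>) \<infinity>) q'"
      using assms(3) by (simp add: set_integrable_def einterval_def)
    show "((q \<circ> real_of_ereal) \<longlongrightarrow> 0) (at_right (- \<infinity>))"
      using assms(5) by (simp add: ereal_tendsto_simps)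
    show "((q \<circ> real_of_ereal) \<longlongrightarrow> 0) (at_left \<infinity>)"
      using assms(4) by (simp add: ereal_tendsto_simps)
  qed (use assms in auto)
  then show ?thesis by (simp add: interval_lebesgue_integral_def set_lebesgue_integral_def einterval_def)
qed

lemma tendsto_zero_of_inverse_square_bound:
  fixes q :: "real \<Rightarrow> complex"
  assumes "\<And>x. norm (q x) \<le> C / (1 + x\<^sup>2)"
  shows "(q \<longlongrightarrow> 0) at_top" "(q \<longlongrightarrow> 0) at_bot"
proof -
  have "((\<lambda>x. C / (1 + x\<^sup>2)) \<longlongrightarrow> 0) at_top" "((\<lambda>x. C / (1 + x\<^sup>2)) \<longlongrightarrow> 0) at_bot" by real_asymp+
  then show "(q \<longlongrightarrow> 0) at_top" "(q \<longlongrightarrow> 0) at_bot"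
    by (auto intro: Lim_null_comparison[rotated] eventuallyI assms)
qed

lemma has_vector_derivative_iexp_mult: "((\<lambda>x. iexp (x * w)) has_vector_derivative \<i> * w * iexp (x * w)) (at x)"
  by (auto intro!: derivative_eq_intros has_vector_derivative_real_field simp: algebra_simps)

lemma ifourier_parts:
  assumes q: "\<And>x. (q has_vector_derivative q1 x) (at x)" and c: "\<And>x. isCont q1 x"
    and b: "\<And>x. norm (q x) \<le> C / (1 + x\<^sup>2)" "\<And>x. norm (q1 x) \<le> C / (1 + x\<^sup>2)"
  shows "ifourier q1 w = - (\<i> * w) * ifourier q w"
proof -
  have cq: "isCont q x" for x using q by (rule has_vector_derivative_continuous)
  have [measurable]: "q \<in> borel_measurable borel" "q1 \<in> borel_measurable borel"
    using cq c by (auto intro!: borel_measurable_continuous_onI continuous_at_imp_continuous_on)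
  have "integrable lborel q" by (rule integrable_of_inverse_square_bound[OF _ b(1)]) simp
  moreover have "integrable lborel q1" by (rule integrable_of_inverse_square_bound[OF _ b(2)]) simp
  ultimately have i: "integrable lborel (\<lambda>x. q x * iexp (w * x))" "integrable lborel (\<lambda>x. q1 x * iexp (w * x))"
    by (blast intro: integrable_iexp_mult(3))+
  have i': "integrable lborel (\<lambda>x. q1 x * iexp (x * w))" "integrable lborel (\<lambda>x. q x * iexp (x * w))"
    using i by (simp_all add: mult.commute)
  have n: "norm (q x * iexp (x * w)) \<le> C / (1 + x\<^sup>2)" for x
    using b(1)[of x] by (simp add: norm_mult del: of_real_mult)
  have "(LINT x|lborel. q1 x * iexp (x * w) + (\<i> * w) * (q x * iexp (x * w))) = 0"
  proof (rule integral_deriv_eq_0[OF _ _ _ tendsto_zero_of_inverse_square_bound[OF n]])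
    show "((\<lambda>x. q x * iexp (x * w)) has_vector_derivative q1 x * iexp (x * w) + (\<i> * w) * (q x * iexp (x * w))) (at x)" for x
      using has_vector_derivative_mult[OF q has_vector_derivative_iexp_mult, of w x] by (simp add: algebra_simps)
    show "isCont (\<lambda>x. q1 x * iexp (x * w) + (\<i> * w) * (q x * iexp (x * w))) x" for x
      using c cq by (intro continuous_intros) auto
    show "integrable lborel (\<lambda>x. q1 x * iexp (x * w) + (\<i> * w) * (q x * iexp (x * w)))"
      using i' by auto
  qed
  then have "(LINT x|lborel. q1 x * iexp (x * w)) = - (\<i> * w) * (LINT x|lborel. q x * iexp (x * w))"
    using i' by (subst (asm) Bochner_Integration.integral_add) (auto simp: add_eq_0_iff)
  then show ?thesis by (simp add: ifourier_def mult.assoc mult.left_commute)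
qed

text \<open>Two integrations by parts give \<open>ifourier q2 w = - w^2 * ifourier q w\<close>.
  Adding the uniform bounds for both transforms yields inverse-square decay in w.\<close>

lemma ifourier_integrable:
  assumes q: "\<And>x. (q has_vector_derivative q1 x) (at x)" "\<And>x. (q1 has_vector_derivative q2 x) (at x)" 
    and c: "\<And>x. isCont q2 x"
    and b: "\<And>x. norm (q x) \<le> C / (1 + x\<^sup>2)" "\<And>x. norm (q1 x) \<le> C / (1 + x\<^sup>2)" "\<And>x. norm (q2 x) \<le> C / (1 + x\<^sup>2)"
  shows "integrable lborel (ifourier q)"
proof -
  have cq1: "isCont q1 x" for x using q(2) by (rule has_vector_derivative_continuous)
  have cq: "isCont q x" for x using q(1) by (rule has_vector_derivative_continuous)
  have [measurable]: "q \<in> borel_measurable borel"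
    using cq by (auto intro!: borel_measurable_continuous_onI continuous_at_imp_continuous_on)
  have [measurable]: "ifourier q \<in> borel_measurable borel" unfolding ifourier_def by measurable
  define I where "I = (LINT x|lborel. C / (1 + x\<^sup>2))"
  have bd: "norm (ifourier r w) \<le> 1 / (2 * pi) * I" if "\<And>x. norm (r x) \<le> C / (1 + x\<^sup>2)" for r w
  proof -
    have "norm (LINT \<xi>|lborel. r \<xi> * iexp (\<xi> * w)) \<le> I" unfolding I_def
      using that order_trans[OF norm_ge_zero that]
      by (intro order_trans[OF integral_norm_bound] integral_mono'[OF integrable_inverse_one_plus_square])
         (auto simp: norm_mult simp del: of_real_mult)
    then have "1 / (2 * pi) * norm (LINT \<xi>|lborel. r \<xi> * iexp (\<xi> * w)) \<le> 1 / (2 * pi) * I"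
      by (intro mult_left_mono) auto
    then show ?thesis unfolding ifourier_def norm_mult norm_of_real by simp
  qed
  have "ifourier q2 w = - (\<i> * w) * (- (\<i> * w) * ifourier q w)" for w
    using ifourier_parts[OF q(2) c b(2,3)] ifourier_parts[OF q(1) cq1 b(1,2)] by simp
  then have eq: "ifourier q2 w = - complex_of_real (w\<^sup>2) * ifourier q w" for w
    by (simp add: power2_eq_square algebra_simps)
  have "norm (ifourier q w) \<le> (1 / pi * I) / (1 + w\<^sup>2)" for w
  proof -
    have "(1 + w\<^sup>2) * norm (ifourier q w) = norm (ifourier q w) + norm (ifourier q2 w)"
      by (simp add: eq norm_mult norm_power distrib_right)
    also have "\<dots> \<le> 1 / (2 * pi) * I + 1 / (2 * pi) * I"
      by (intro add_mono bd b)
    finally show ?thesis by (simp add: field_simps add_pos_nonneg)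
  qed
  then show ?thesis by (rule integrable_of_inverse_square_bound[rotated]) simp
qed

text \<open>The factor \<open>1 + \<xi>^2\<close> stands for the polynomial weights in the first two
  derivatives of the Gaussian. The bound is the square of \<open>1 + x \<le> exp x\<close>.\<close>

lemma gauss_mult_bound:
  assumes "\<epsilon> > 0"
  obtains C where "\<And>\<xi>. (1 + \<xi>\<^sup>2) * gauss_mult \<epsilon> \<xi> \<le> C / (1 + \<xi>\<^sup>2)"
proof
  \<comment> \<open>The largest constant with both m \<le> 1 and m \<le> \<epsilon>^2 / 4, so that
    \<open>m * (1 + \<xi>^2)\<close> is at most \<open>1 + u / 2\<close>.\<close>
  define m where "m = min 1 (\<epsilon>\<^sup>2 / 4)"
  have m: "m > 0" using assms by (simp add: m_def)
  fix \<xi> :: real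
  define u where "u = (\<epsilon> * \<xi>)\<^sup>2 / 2"
  have "m * (1 + \<xi>\<^sup>2) \<le> 1 + \<epsilon>\<^sup>2 / 4 * \<xi>\<^sup>2"
    unfolding distrib_left by (intro add_mono mult_right_mono) (auto simp: m_def)
  also have "\<dots> = 1 + u / 2" by (simp add: u_def power_mult_distrib)
  also have "\<dots> \<le> exp (u / 2)" by (rule exp_ge_add_one_self)
  finally have "(m * (1 + \<xi>\<^sup>2))\<^sup>2 \<le> (exp (u / 2))\<^sup>2" using m by (intro power_mono) auto
  also have "\<dots> = exp u" by (simp flip: exp_double)
  finally have 1: "m\<^sup>2 * (1 + \<xi>\<^sup>2)\<^sup>2 \<le> exp u" by (simp add: power_mult_distrib)
  have g: "gauss_mult \<epsilon> \<xi> = 1 / exp u" by (simp add: gauss_mult_def u_def exp_minus field_simps)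
  have p: "1 + \<xi>\<^sup>2 > 0" by (simp add: add_pos_nonneg)
  show "(1 + \<xi>\<^sup>2) * gauss_mult \<epsilon> \<xi> \<le> (1 / m\<^sup>2) / (1 + \<xi>\<^sup>2)"
  proof -
    have "P * (1 / e) \<le> (1 / m\<^sup>2) / P" if "m\<^sup>2 * P\<^sup>2 \<le> e" "P > 0" "e > 0" for P e :: real
      using that m by (simp add: field_simps power2_eq_square)
    from this[OF 1 p] show ?thesis unfolding g by simp
  qed
qed

lemma gauss_mult_nonneg [simp]: "gauss_mult \<epsilon> \<xi> \<ge> 0"
  by (simp add: gauss_mult_def)

lemma has_vector_derivative_gauss_mult:
  "((\<lambda>\<xi>. complex_of_real (gauss_mult \<epsilon> \<xi>)) has_vector_derivative complex_of_real (- (\<epsilon>\<^sup>2 * \<xi> * gauss_mult \<epsilon> \<xi>))) (at \<xi>)"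
proof (rule has_vector_derivative_of_real)
  show "(gauss_mult \<epsilon> has_field_derivative - (\<epsilon>\<^sup>2 * \<xi> * gauss_mult \<epsilon> \<xi>)) (at \<xi>)"
    unfolding gauss_mult_def
    by (auto intro!: derivative_eq_intros simp: power_mult_distrib power2_eq_square)
qed

lemma iexp_linear_approx: "cmod (iexp x - 1 - \<i> * x) \<le> x\<^sup>2 / 2"
  using iexp_approx1[of x 1] by (simp add: numeral_2_eq_2 algebra_simps)

text \<open>The second-order remainder of the exponential is bounded by \<open>h^2 * y^2\<close>, so
  the second moment of k controls the difference quotient with an explicit error
  \<open>\<bar>h\<bar> * M\<close>, and no limit is taken under the integral.\<close>

lemma has_vector_derivative_fourier:
  assumes k: "integrable lborel k" "integrable lborel (\<lambda>y. y * k y)" "integrable lborel (\<lambda>y. complex_of_real y ^ 2 * k y)"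
  shows "(fourier k has_vector_derivative fourier (\<lambda>y. - \<i> * y * k y) \<xi>) (at \<xi>)"
proof -
  have [measurable]: "k \<in> borel_measurable borel" using k by auto
  define M where "M = (LINT y|lborel. norm (complex_of_real y ^ 2 * k y))"
  have k1: "integrable lborel (\<lambda>y. - \<i> * y * k y)"
    using integrable_mult_right[OF k(2), of "-\<i>"] by (simp add: mult.assoc)
  have est: "norm (fourier k (\<xi> + h) - fourier k \<xi> - h *\<^sub>R fourier (\<lambda>y. - \<i> * y * k y) \<xi>) \<le> h\<^sup>2 * M" for h
  proof -
    have "fourier k (\<xi> + h) - fourier k \<xi> - h *\<^sub>R fourier (\<lambda>y. - \<i> * y * k y) \<xi>
       = (LINT y|lborel. iexp (-((\<xi> + h) * y)) * k y - iexp (-(\<xi> * y)) * k y - h *\<^sub>R (iexp (-(\<xi> * y)) * (- \<i> * y * k y)))"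
      unfolding fourier_def
      using integrable_iexp_mult(2)[OF k(1)] integrable_iexp_mult(2)[OF k1]
      by (simp add: Bochner_Integration.integral_diff del: of_real_mult of_real_add of_real_minus scaleR_conv_of_real)
    also have "\<dots> = (LINT y|lborel. iexp (-(\<xi> * y)) * (k y * (iexp (-(h * y)) - 1 - \<i> * of_real (-(h * y)))))"
    proof (intro Bochner_Integration.integral_cong refl)
      fix y
      have "iexp (-((\<xi> + h) * y)) = iexp (-(\<xi> * y)) * iexp (-(h * y))"
        by (simp add: exp_add[symmetric] algebra_simps)
      then show "iexp (-((\<xi> + h) * y)) * k y - iexp (-(\<xi> * y)) * k y - h *\<^sub>R (iexp (-(\<xi> * y)) * (- \<i> * y * k y))
        = iexp (-(\<xi> * y)) * (k y * (iexp (-(h * y)) - 1 - \<i> * of_real (-(h * y))))"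
        by (simp add: scaleR_conv_of_real algebra_simps)
    qed
    also have "norm \<dots> \<le> (LINT y|lborel. norm (iexp (-(\<xi> * y)) * (k y * (iexp (-(h * y)) - 1 - \<i> * of_real (-(h * y))))))"
      by (rule integral_norm_bound)
    also have "\<dots> \<le> (LINT y|lborel. h\<^sup>2 * norm (complex_of_real y ^ 2 * k y))"
    proof (rule integral_mono')
      show "integrable lborel (\<lambda>y. h\<^sup>2 * norm (complex_of_real y ^ 2 * k y))" using integrable_norm[OF k(3)] by (rule integrable_mult_right)
      fix y
      have "norm (iexp (-(\<xi> * y)) * (k y * (iexp (-(h * y)) - 1 - \<i> * of_real (-(h * y)))))
         = norm (k y) * norm (iexp (-(h * y)) - 1 - \<i> * of_real (-(h * y)))"
        by (simp only: norm_mult norm_exp_i_times mult_1)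
      also have "\<dots> \<le> norm (k y) * ((-(h * y))\<^sup>2 / 2)"
        by (intro mult_left_mono iexp_linear_approx) auto
      also have "\<dots> \<le> norm (k y) * (h\<^sup>2 * y\<^sup>2)"
        by (intro mult_left_mono) (auto simp: power_mult_distrib)
      also have "\<dots> = h\<^sup>2 * norm (complex_of_real y ^ 2 * k y)" by (simp add: norm_mult norm_power)
      finally show "norm (iexp (-(\<xi> * y)) * (k y * (iexp (-(h * y)) - 1 - \<i> * of_real (-(h * y))))) \<le> h\<^sup>2 * norm (complex_of_real y ^ 2 * k y)" .
    qed auto
    also have "\<dots> = h\<^sup>2 * M" by (simp add: M_def)
    finally show ?thesis .
  qed
  show ?thesis
    unfolding has_vector_derivative_def has_derivative_at
  proof (intro conjI bounded_linear_scaleR_left)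
    show "(\<lambda>h. norm (fourier k (\<xi> + h) - fourier k \<xi> - h *\<^sub>R fourier (\<lambda>y. - \<i> * y * k y) \<xi>) / norm h) \<midarrow>0\<rightarrow> 0"
    proof (rule Lim_null_comparison)
      show "\<forall>\<^sub>F h in at 0. norm (norm (fourier k (\<xi> + h) - fourier k \<xi> - h *\<^sub>R fourier (\<lambda>y. - \<i> * y * k y) \<xi>) / norm h) \<le> \<bar>h\<bar> * M"
        unfolding eventually_at_filter
      proof (rule eventuallyI, intro impI)
        fix h :: real assume "h \<noteq> 0"
        then show "norm (norm (fourier k (\<xi> + h) - fourier k \<xi> - h *\<^sub>R fourier (\<lambda>y. - \<i> * y * k y) \<xi>) / norm h) \<le> \<bar>h\<bar> * M"
          using est[of h] by (simp add: divide_le_eq power2_eq_square mult.assoc mult.commute mult.left_commute abs_mult[symmetric])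
      qed
      show "((\<lambda>h. \<bar>h\<bar> * M) \<longlongrightarrow> 0) (at 0)" by (auto intro!: tendsto_eq_intros)
    qed
  qed
qed

section \<open>Nonnegative kernels with all moments: translation, Riemann-Lebesgue,
  mollification\<close>

text \<open>It is the transform that is smooth, because of the moments. The kernel itself may jump
  or blow up at 0, as beta kernels do, so continuity is asked for elsewhere only. Nonnegativity
  feeds Scheffe's argument.\<close>

locale smooth_kernel =
  fixes \<kappa> :: "real \<Rightarrow> real"
  assumes nonneg: "\<And>y. \<kappa> y \<ge> 0"
    and moments: "\<And>j::nat. integrable lborel (\<lambda>y. y ^ j * \<kappa> y)"
    and cont: "\<And>y. y \<noteq> 0 \<Longrightarrow> isCont \<kappa> y"
begin

abbreviation k :: "real \<Rightarrow> complex" where "k y \<equiv> complex_of_real (\<kappa> y)"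

lemma integrable_real: "integrable lborel \<kappa>"
  using moments[of 0] by simp

lemma measurable_kernel [measurable]: "\<kappa> \<in> borel_measurable borel"
  using integrable_real by auto

lemma integrable_kernel: "integrable lborel k"
  using integrable_real by simp

lemma integrable_moment: "integrable lborel (\<lambda>y. complex_of_real y ^ j * k y)"
proof -
  have "integrable lborel (\<lambda>y. complex_of_real (y ^ j * \<kappa> y))" using moments by (subst complex_of_real_integrable_eq)
  then show ?thesis by simp
qed

text \<open>Scheffe's argument: writing |a - b| = 2 max 0 (a - b) - (a - b), the second term integrates to 0.\<close>

lemma translation_continuous:
  assumes "h \<longlonglongrightarrow> 0"
  shows "(\<lambda>n. LINT w|lborel. norm (\<kappa> w - \<kappa> (w - h n))) \<longlonglongrightarrow> 0"
proof -
  have i: "integrable lborel (\<lambda>w. \<kappa> (w - t))" and e: "(LINT w|lborel. \<kappa> (w - t)) = (LINT w|lborel. \<kappa> w)" for t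
    using lborel_integrable_real_affine[OF integrable_real, of 1 "-t"] lborel_integral_real_affine[of 1 \<kappa> "-t"] by auto
  have im: "integrable lborel (\<lambda>w. max 0 (\<kappa> w - \<kappa> (w - t)))" for t
    by (rule Bochner_Integration.integrable_bound[OF integrable_real]) (use nonneg in auto)
  have eq: "(LINT w|lborel. norm (\<kappa> w - \<kappa> (w - t))) = 2 * (LINT w|lborel. max 0 (\<kappa> w - \<kappa> (w - t)))" for t
  proof -
    have "(LINT w|lborel. norm (\<kappa> w - \<kappa> (w - t))) = (LINT w|lborel. 2 * max 0 (\<kappa> w - \<kappa> (w - t)) - (\<kappa> w - \<kappa> (w - t)))"
      by (intro Bochner_Integration.integral_cong refl) (auto simp: max_def)
    also have "\<dots> = 2 * (LINT w|lborel. max 0 (\<kappa> w - \<kappa> (w - t)))"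
      using im i integrable_real e by (subst Bochner_Integration.integral_diff) (auto simp: Bochner_Integration.integral_diff)
    finally show ?thesis .
  qed
  have "(\<lambda>n. LINT w|lborel. max 0 (\<kappa> w - \<kappa> (w - h n))) \<longlonglongrightarrow> integral\<^sup>L lborel (\<lambda>w::real. 0::real)"
  proof (rule integral_dominated_convergence)
    show "integrable lborel \<kappa>" by (rule integrable_real)
    have "AE w in lborel. w \<noteq> (0::real)" by (rule AE_lborel_singleton)
    then show "AE w in lborel. (\<lambda>n. max 0 (\<kappa> w - \<kappa> (w - h n))) \<longlonglongrightarrow> 0"
    proof eventually_elim
      case (elim w)
      have "(\<lambda>n. w - h n) \<longlonglongrightarrow> w - 0" using assms by (intro tendsto_intros)
      then have "(\<lambda>n. \<kappa> (w - h n)) \<longlonglongrightarrow> \<kappa> w" using cont[OF elim] by (intro isCont_tendsto_compose[of w \<kappa>]) auto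
      then have "(\<lambda>n. max 0 (\<kappa> w - \<kappa> (w - h n))) \<longlonglongrightarrow> max 0 (\<kappa> w - \<kappa> w)" by (intro tendsto_intros)
      then show ?case by simp
    qed
    show "AE w in lborel. norm (max 0 (\<kappa> w - \<kappa> (w - h n))) \<le> \<kappa> w" for n using nonneg by auto
  qed auto
  then show ?thesis unfolding eq by (auto intro: tendsto_mult_right_zero)
qed

text \<open>Riemann-Lebesgue: translating by \<open>pi / \<xi>\<close> flips the sign of the
  character, so twice the transform is the transform of k minus a translate, which is small in L^1
  by \<open>translation_continuous\<close>. Consequently every point outside the closure is
  nonzero.\<close>

lemma zero_in_closure_range_fourier: "0 \<in> closure (range (fourier k))"
proof -
  have lim: "(\<lambda>n. LINT w|lborel. norm (\<kappa> w - \<kappa> (w - pi / real (Suc n)))) \<longlonglongrightarrow> 0"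
    by (rule translation_continuous) real_asymp
  have le: "norm (fourier k (real (Suc n))) \<le> (LINT w|lborel. norm (\<kappa> w - \<kappa> (w - pi / real (Suc n))))" for n
  proof -
    define \<xi> where "\<xi> = real (Suc n)"
    have \<xi>: "\<xi> > 0" by (simp add: \<xi>_def)
    have i: "integrable lborel (\<lambda>w. k (w - pi / \<xi>))"
      using integrable_kernel integrable_shift_iff[of k "- (pi/\<xi>)"] by (simp only: uminus_add_conv_diff)
    have "fourier k \<xi> = (LINT y|lborel. iexp (-(\<xi> * (y - pi / \<xi>))) * k (y - pi / \<xi>))"
      unfolding fourier_def using integral_shift[of "\<lambda>y. iexp (-(\<xi> * y)) * k y" "- (pi/\<xi>)"]
      by (simp only: uminus_add_conv_diff)
    also have "\<dots> = (LINT y|lborel. - (iexp (-(\<xi> * y)) * k (y - pi / \<xi>)))"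
    proof (intro Bochner_Integration.integral_cong refl)
      fix y
      have "\<i> * complex_of_real (-(\<xi> * (y - pi / \<xi>))) = \<i> * complex_of_real (-(\<xi> * y)) + \<i> * complex_of_real pi"
        using \<xi> by (simp add: algebra_simps)
      then have "iexp (-(\<xi> * (y - pi / \<xi>))) = - iexp (-(\<xi> * y))"
        by (simp only: exp_add exp_pi_i') simp
      then show "iexp (-(\<xi> * (y - pi / \<xi>))) * k (y - pi / \<xi>) = - (iexp (-(\<xi> * y)) * k (y - pi / \<xi>))"
        by simp
    qed
    finally have 1: "fourier k \<xi> = - (LINT y|lborel. iexp (-(\<xi> * y)) * k (y - pi / \<xi>))" by simp
    have "2 * fourier k \<xi> = (LINT y|lborel. iexp (-(\<xi> * y)) * k y) - (LINT y|lborel. iexp (-(\<xi> * y)) * k (y - pi / \<xi>))"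
    proof -
      have "2 * z = z - X" if "z = - X" for z X :: complex using that by simp
      from this[OF 1] show ?thesis unfolding fourier_def .
    qed
    also have "\<dots> = (LINT y|lborel. iexp (-(\<xi> * y)) * k y - iexp (-(\<xi> * y)) * k (y - pi / \<xi>))"
      by (rule Bochner_Integration.integral_diff[symmetric, OF integrable_iexp_mult(2)[OF integrable_kernel] integrable_iexp_mult(2)[OF i]])
    also have "norm \<dots> \<le> (LINT y|lborel. norm (iexp (-(\<xi> * y)) * k y - iexp (-(\<xi> * y)) * k (y - pi / \<xi>)))"
      by (rule integral_norm_bound)
    also have "\<dots> = (LINT y|lborel. norm (\<kappa> y - \<kappa> (y - pi / \<xi>)))"
    proof (intro Bochner_Integration.integral_cong refl)
      fix y
      have "norm (iexp (-(\<xi> * y)) * k y - iexp (-(\<xi> * y)) * k (y - pi / \<xi>)) = norm (k y - k (y - pi / \<xi>))"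
        by (simp only: right_diff_distrib[symmetric] norm_mult norm_exp_i_times mult_1)
      then show "norm (iexp (-(\<xi> * y)) * k y - iexp (-(\<xi> * y)) * k (y - pi / \<xi>)) = norm (\<kappa> y - \<kappa> (y - pi / \<xi>))"
        by (simp only: of_real_diff[symmetric] norm_of_real real_norm_def)
    qed
    finally have "2 * norm (fourier k \<xi>) \<le> (LINT y|lborel. norm (\<kappa> y - \<kappa> (y - pi / \<xi>)))" by (simp add: norm_mult)
    then show ?thesis using norm_ge_zero[of "fourier k \<xi>"] unfolding \<xi>_def by linarith
  qed
  have "(\<lambda>n. fourier k (real (Suc n))) \<longlonglongrightarrow> 0"
    by (rule Lim_null_comparison[OF always_eventually[OF allI[OF le]] lim])
  then show ?thesis
    unfolding closure_sequential by (intro exI[of _ "\<lambda>n. fourier k (real (Suc n))"]) auto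
qed

text \<open>The error is at most a Gaussian average of \<open>\<omega> (\<epsilon> n * s)\<close>,
  where \<omega> is the L^1 modulus of translation. It tends to 0 for each s and never exceeds twice
  the mass of the kernel, so dominated convergence applies.\<close>

lemma L1_mollify_tendsto:
  "(\<lambda>n. L1 (\<lambda>w. k w - conv k (\<lambda>w. complex_of_real (normal_density 0 (1 / real (Suc n)) w)) w)) \<longlonglongrightarrow> 0"
proof -
  define \<omega> where "\<omega> t = (LINT w|lborel. norm (\<kappa> w - \<kappa> (w - t)))" for t
  define \<epsilon> where "\<epsilon> n = 1 / real (Suc n)" for n
  have \<epsilon>: "\<epsilon> n > 0" for n by (simp add: \<epsilon>_def)
  have \<omega>_meas[measurable]: "\<omega> \<in> borel_measurable borel" unfolding \<omega>_def by measurable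
  have i: "integrable lborel (\<lambda>w. \<kappa> (w - t))" and e: "(LINT w|lborel. \<kappa> (w - t)) = (LINT w|lborel. \<kappa> w)" for t
    using lborel_integrable_real_affine[OF integrable_real, of 1 "-t"] lborel_integral_real_affine[of 1 \<kappa> "-t"] by auto
  have \<omega>0: "\<omega> t \<ge> 0" for t by (simp add: \<omega>_def)
  have \<omega>le: "\<omega> t \<le> 2 * (LINT w|lborel. \<kappa> w)" for t
  proof -
    have "\<omega> t \<le> (LINT w|lborel. \<kappa> w + \<kappa> (w - t))"
      unfolding \<omega>_def using i integrable_real nonneg by (intro integral_mono) (auto simp: abs_le_iff add_increasing algebra_simps)
    then show ?thesis using i integrable_real e by simp
  qed
  have lim: "(\<lambda>n. LINT s|lborel. std_normal_density s * \<omega> (\<epsilon> n * s)) \<longlonglongrightarrow> integral\<^sup>L lborel (\<lambda>w::real. 0::real)"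
  proof (rule integral_dominated_convergence)
    show "integrable lborel (\<lambda>s. std_normal_density s * (2 * (LINT w|lborel. \<kappa> w)))" by simp
    show "AE s in lborel. (\<lambda>n. std_normal_density s * \<omega> (\<epsilon> n * s)) \<longlonglongrightarrow> 0"
    proof (rule AE_I2)
      fix s
      have "(\<lambda>n. \<omega> (\<epsilon> n * s)) \<longlonglongrightarrow> 0" unfolding \<omega>_def \<epsilon>_def by (rule translation_continuous) real_asymp
      then show "(\<lambda>n. std_normal_density s * \<omega> (\<epsilon> n * s)) \<longlonglongrightarrow> 0" by (rule tendsto_mult_right_zero)
    qed
    show "AE s in lborel. norm (std_normal_density s * \<omega> (\<epsilon> n * s)) \<le> std_normal_density s * (2 * (LINT w|lborel. \<kappa> w))" for n
      using \<omega>0 \<omega>le by (auto simp: abs_mult intro!: mult_left_mono)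
  qed measurable
  have le: "L1 (\<lambda>w. k w - conv k (\<lambda>w. complex_of_real (normal_density 0 (\<epsilon> n) w)) w) \<le> (LINT s|lborel. std_normal_density s * \<omega> (\<epsilon> n * s))" for n
  proof -
    have I: "integrable (lborel \<Otimes>\<^sub>M lborel) (\<lambda>(s, w). std_normal_density s * (\<kappa> w - \<kappa> (w - \<epsilon> n * s)))"
    proof (rule lborel_pair.Fubini_integrable)
      have "(LINT w|lborel. norm (std_normal_density s * (\<kappa> w - \<kappa> (w - \<epsilon> n * s)))) = std_normal_density s * \<omega> (\<epsilon> n * s)" for s
        by (simp add: \<omega>_def abs_mult)
      moreover have "integrable lborel (\<lambda>s. std_normal_density s * \<omega> (\<epsilon> n * s))"
      proof (rule Bochner_Integration.integrable_bound[where f = "\<lambda>s. std_normal_density s * (2 * (LINT w|lborel. \<kappa> w))"])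
        show "AE s in lborel. norm (std_normal_density s * \<omega> (\<epsilon> n * s)) \<le> norm (std_normal_density s * (2 * (LINT w|lborel. \<kappa> w)))"
        proof (rule AE_I2)
          fix s
          have "norm (std_normal_density s * \<omega> (\<epsilon> n * s)) = std_normal_density s * \<omega> (\<epsilon> n * s)" using \<omega>0 by simp
          also have "\<dots> \<le> std_normal_density s * (2 * (LINT w|lborel. \<kappa> w))" by (intro mult_left_mono \<omega>le) simp
          also have "\<dots> \<le> norm \<dots>" unfolding real_norm_def by (rule abs_ge_self)
          finally show "norm (std_normal_density s * \<omega> (\<epsilon> n * s)) \<le> norm (std_normal_density s * (2 * (LINT w|lborel. \<kappa> w)))" .
        qed
      qed auto
      ultimately show "integrable lborel (\<lambda>s. LINT w|lborel. norm (case (s, w) of (s, w) \<Rightarrow> std_normal_density s * (\<kappa> w - \<kappa> (w - \<epsilon> n * s))))"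
        by simp
      show "AE s in lborel. integrable lborel (\<lambda>w. case (s, w) of (s, w) \<Rightarrow> std_normal_density s * (\<kappa> w - \<kappa> (w - \<epsilon> n * s)))"
        using i integrable_real by auto
    qed measurable
    have I': "integrable (lborel \<Otimes>\<^sub>M lborel) (\<lambda>(w, s). std_normal_density s * (\<kappa> w - \<kappa> (w - \<epsilon> n * s)))"
      using lborel_pair.integrable_product_swap[OF I] by (simp add: case_prod_beta')
    have eq: "AE w in lborel. k w - conv k (\<lambda>w. complex_of_real (normal_density 0 (\<epsilon> n) w)) w 
       = complex_of_real (LINT s|lborel. std_normal_density s * (\<kappa> w - \<kappa> (w - \<epsilon> n * s)))"
      using lborel_pair.AE_integrable_fst[OF I]
      using lborel_pair.AE_integrable_fst[OF I']
    proof eventually_elim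
      case (elim w)
      then have a: "integrable lborel (\<lambda>s. std_normal_density s * (\<kappa> w - \<kappa> (w - \<epsilon> n * s)))" by simp
      have b: "integrable lborel (\<lambda>s. std_normal_density s * \<kappa> w)" by simp
      from Bochner_Integration.integrable_diff[OF b a] have c: "integrable lborel (\<lambda>s. std_normal_density s * \<kappa> (w - \<epsilon> n * s))"
        by (simp add: algebra_simps)
      have "conv k (\<lambda>w. complex_of_real (normal_density 0 (\<epsilon> n) w)) w = (LINT s|lborel. complex_of_real (normal_density 0 (\<epsilon> n) s * \<kappa> (w - s)))"
        by (subst conv_commute) (simp add: conv_def)
      also have "\<dots> = complex_of_real (LINT s|lborel. normal_density 0 (\<epsilon> n) s * \<kappa> (w - s))"
        by (rule integral_complex_of_real)
      also have "(LINT s|lborel. normal_density 0 (\<epsilon> n) s * \<kappa> (w - s)) = (LINT s|lborel. \<epsilon> n * (normal_density 0 (\<epsilon> n) (\<epsilon> n * s) * \<kappa> (w - \<epsilon> n * s)))"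
        using lborel_integral_real_affine[of "\<epsilon> n" "\<lambda>s. normal_density 0 (\<epsilon> n) s * \<kappa> (w - s)" 0] \<epsilon>[of n] by simp
      also have "\<dots> = (LINT s|lborel. std_normal_density s * \<kappa> (w - \<epsilon> n * s))"
        using \<epsilon>[of n] by (intro Bochner_Integration.integral_cong refl)
          (simp add: normal_density_def real_sqrt_mult power_mult_distrib)
      finally have d: "conv k (\<lambda>w. complex_of_real (normal_density 0 (\<epsilon> n) w)) w = complex_of_real (LINT s|lborel. std_normal_density s * \<kappa> (w - \<epsilon> n * s))" .
      have "(LINT s|lborel. std_normal_density s * (\<kappa> w - \<kappa> (w - \<epsilon> n * s))) = \<kappa> w - (LINT s|lborel. std_normal_density s * \<kappa> (w - \<epsilon> n * s))"
        unfolding right_diff_distrib using b c by (subst Bochner_Integration.integral_diff) auto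
      then show ?case using d by simp
    qed
    have cm: "conv k (\<lambda>w. complex_of_real (normal_density 0 (\<epsilon> n) w)) \<in> borel_measurable borel"
      using conv_integrable[OF integrable_kernel, of "\<lambda>w. complex_of_real (normal_density 0 (\<epsilon> n) w)"] \<epsilon>[of n] by auto
    have "L1 (\<lambda>w. k w - conv k (\<lambda>w. complex_of_real (normal_density 0 (\<epsilon> n) w)) w)
       = (LINT w|lborel. norm (complex_of_real (LINT s|lborel. std_normal_density s * (\<kappa> w - \<kappa> (w - \<epsilon> n * s)))))"
      unfolding L1_def using eq cm by (intro integral_cong_AE) (auto elim!: eventually_mono)
    also have "\<dots> = (LINT w|lborel. norm (LINT s|lborel. std_normal_density s * (\<kappa> w - \<kappa> (w - \<epsilon> n * s))))"
      by (simp add: norm_of_real)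
    also have "\<dots> \<le> (LINT w|lborel. LINT s|lborel. norm (std_normal_density s * (\<kappa> w - \<kappa> (w - \<epsilon> n * s))))"
    proof (rule integral_mono')
      show "integrable lborel (\<lambda>w. LINT s|lborel. norm (std_normal_density s * (\<kappa> w - \<kappa> (w - \<epsilon> n * s))))"
        by (rule lborel_pair.integrable_fst) (use integrable_norm[OF I'] in \<open>simp add: case_prod_beta'\<close>)
    qed (auto intro: integral_norm_bound)
    also have "\<dots> = (LINT s|lborel. LINT w|lborel. norm (std_normal_density s * (\<kappa> w - \<kappa> (w - \<epsilon> n * s))))"
      using lborel_pair.Fubini_integral[of "\<lambda>s w. norm (std_normal_density s * (\<kappa> w - \<kappa> (w - \<epsilon> n * s)))"] integrable_norm[OF I] by (simp add: case_prod_beta')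
    also have "\<dots> = (LINT s|lborel. std_normal_density s * \<omega> (\<epsilon> n * s))"
      by (simp add: \<omega>_def abs_mult)
    finally show ?thesis .
  qed
  show ?thesis
    using tendsto_sandwich[OF _ _ tendsto_const lim[simplified], of "\<lambda>n. L1 (\<lambda>w. k w - conv k (\<lambda>w. complex_of_real (normal_density 0 (\<epsilon> n) w)) w)"] le
    by (simp add: \<epsilon>_def)
qed

end

section \<open>The spectrum of a correlation operator\<close>

context smooth_kernel
begin

text \<open>The work lies in bounding q and its first two derivatives. The factor \<open>R\<close>
  and its derivatives are bounded, by the distance \<delta> and by the moments of the kernel; all
  decay is supplied by the Gaussian factor \<open>E\<close>. Then \<open>ifourier_integrable\<close>
  applies.\<close>

lemma resolvent_kernel:
  assumes \<delta>: "\<delta> > 0" "\<And>\<xi>. \<delta> \<le> norm (\<mu> - fourier k \<xi>)" and \<epsilon>: "\<epsilon> > 0"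
  obtains h where "integrable lborel h" 
    "\<And>w. \<mu> * h w - conv k h w = conv k (\<lambda>w. complex_of_real (normal_density 0 \<epsilon> w)) w"
proof
  define \<phi>1 where "\<phi>1 = fourier (\<lambda>y. - \<i> * y * k y)"
  define \<phi>2 where "\<phi>2 = fourier (\<lambda>y. - \<i> * y * (- \<i> * y * k y))"
  \<comment> \<open>The third derivative serves the continuity of the second one, hence of
    \<open>q2\<close>, which \<open>ifourier_integrable\<close> requires.\<close>
  define \<phi>3 where "\<phi>3 = fourier (\<lambda>y. - \<i> * y * (- \<i> * y * (- \<i> * y * k y)))"
  have m: "integrable lborel (\<lambda>y. c * (complex_of_real y ^ j * k y))" for c j
    using integrable_moment by (intro integrable_mult_right)
  have d0: "(fourier k has_vector_derivative \<phi>1 \<xi>) (at \<xi>)" for \<xi>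
    unfolding \<phi>1_def using m[of 1 0] m[of 1 1] m[of 1 2]
    by (intro has_vector_derivative_fourier) (auto simp: power2_eq_square mult_ac)
  have d1: "(\<phi>1 has_vector_derivative \<phi>2 \<xi>) (at \<xi>)" for \<xi>
    unfolding \<phi>1_def \<phi>2_def using m[of "-\<i>" 1] m[of "-\<i>" 2] m[of "-\<i>" 3]
    by (intro has_vector_derivative_fourier) (auto simp: power2_eq_square power3_eq_cube mult_ac)
  have d2: "(\<phi>2 has_vector_derivative \<phi>3 \<xi>) (at \<xi>)" for \<xi>
    unfolding \<phi>2_def \<phi>3_def using m[of "-1" 2] m[of "-1" 3] m[of "-1" 4]
    by (intro has_vector_derivative_fourier) (auto simp: power2_eq_square power3_eq_cube power4_eq_xxxx mult_ac)
  have c\<phi>: "isCont (fourier k) \<xi>" "isCont \<phi>1 \<xi>" "isCont \<phi>2 \<xi>" for \<xi>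
    using d0 d1 d2 by (auto intro: has_vector_derivative_continuous)
  define K where "K = 1 + L1 (\<lambda>y. - \<i> * y * k y) + L1 (\<lambda>y. - \<i> * y * (- \<i> * y * k y))"
  have K: "K \<ge> 1" unfolding K_def by (simp add: add_nonneg_nonneg)
  have b1: "norm (\<phi>1 \<xi>) \<le> K" for \<xi>
    unfolding K_def \<phi>1_def by (rule order_trans[OF norm_fourier_le]) auto
  have b2: "norm (\<phi>2 \<xi>) \<le> K" for \<xi>
    unfolding K_def \<phi>2_def by (rule order_trans[OF norm_fourier_le]) auto
  define R where "R \<xi> = inverse (\<mu> - fourier k \<xi>)" for \<xi>
  have nz: "\<mu> - fourier k \<xi> \<noteq> 0" for \<xi> using \<delta>(1) \<delta>(2)[of \<xi>] by auto
  have dR: "(R has_vector_derivative \<phi>1 \<xi> * R \<xi> ^ 2) (at \<xi>)" for \<xi>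
  proof -
    have "((\<lambda>\<xi>. \<mu> - fourier k \<xi>) has_vector_derivative - \<phi>1 \<xi>) (at \<xi>)"
      using d0[of \<xi>] by (auto intro!: derivative_eq_intros)
    moreover have "(inverse has_field_derivative - (inverse (\<mu> - fourier k \<xi>) ^ 2)) (at (\<mu> - fourier k \<xi>))"
      using DERIV_inverse[OF nz[of \<xi>]] by (simp add: numeral_2_eq_2)
    ultimately have "(inverse \<circ> (\<lambda>\<xi>. \<mu> - fourier k \<xi>) has_vector_derivative (- \<phi>1 \<xi>) * (- (inverse (\<mu> - fourier k \<xi>) ^ 2))) (at \<xi>)"
      by (rule field_vector_diff_chain_at)
    then show ?thesis by (simp add: R_def[abs_def] o_def)
  qed
  define D where "D = 1 / \<delta> + 1"
  have D: "D \<ge> 1" using \<delta>(1) by (simp add: D_def)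
  have bR: "norm (R \<xi>) \<le> D" for \<xi>
  proof -
    have "norm (R \<xi>) \<le> 1 / \<delta>"
      unfolding R_def using \<delta>(1) \<delta>(2)[of \<xi>] by (auto simp: norm_inverse intro!: le_imp_inverse_le simp flip: inverse_eq_divide)
    then show ?thesis by (simp add: D_def)
  qed
  define R1 where "R1 \<xi> = \<phi>1 \<xi> * R \<xi> ^ 2" for \<xi>
  define R2 where "R2 \<xi> = \<phi>2 \<xi> * R \<xi> ^ 2 + \<phi>1 \<xi> * (2 * R \<xi> * R1 \<xi>)" for \<xi>
  have dR1: "(R1 has_vector_derivative R2 \<xi>) (at \<xi>)" for \<xi>
    unfolding R1_def[abs_def] R2_def
    using has_vector_derivative_mult[OF d1[of \<xi>] has_vector_derivative_mult[OF dR[of \<xi>] dR[of \<xi>]]]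
    by (simp add: power2_eq_square algebra_simps)
  have bR1: "norm (R1 \<xi>) \<le> K * D^2" for \<xi>
    unfolding R1_def norm_mult norm_power using b1 bR K by (intro mult_mono power_mono) auto
  have bR2: "norm (R2 \<xi>) \<le> K * D^2 + K * (2 * D * (K * D^2))" for \<xi>
  proof -
    have "norm (R2 \<xi>) \<le> norm (\<phi>2 \<xi>) * norm (R \<xi>) ^ 2 + norm (\<phi>1 \<xi>) * (2 * norm (R \<xi>) * norm (R1 \<xi>))"
      unfolding R2_def by (rule order_trans[OF norm_triangle_ineq]) (simp add: norm_mult norm_power)
    also have "\<dots> \<le> K * D^2 + K * (2 * D * (K * D^2))"
      using b1 b2 bR bR1 K D by (intro add_mono mult_mono power_mono mult_nonneg_nonneg) auto
    finally show ?thesis .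
  qed
  define E where "E \<xi> = complex_of_real (gauss_mult \<epsilon> \<xi>)" for \<xi>
  define E1 where "E1 \<xi> = - complex_of_real (\<epsilon>\<^sup>2 * \<xi>) * E \<xi>" for \<xi>
  define E2 where "E2 \<xi> = - complex_of_real (\<epsilon>\<^sup>2) * E \<xi> - complex_of_real (\<epsilon>\<^sup>2 * \<xi>) * E1 \<xi>" for \<xi>
  have dE: "(E has_vector_derivative E1 \<xi>) (at \<xi>)" for \<xi>
    using has_vector_derivative_gauss_mult[of \<epsilon> \<xi>] by (simp add: E_def[abs_def] E1_def)
  have dl: "((\<lambda>\<xi>. - complex_of_real (\<epsilon>\<^sup>2 * \<xi>)) has_vector_derivative - complex_of_real (\<epsilon>\<^sup>2)) (at \<xi>)" for \<xi>
    by (auto intro!: derivative_eq_intros has_vector_derivative_real_field)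
  have dE1: "(E1 has_vector_derivative E2 \<xi>) (at \<xi>)" for \<xi>
    using has_vector_derivative_mult[OF dl dE, of \<xi>] by (simp add: E1_def[abs_def] E2_def)
  \<comment> \<open>One majorant for the Gaussian and its first two derivatives: 1,
    \<open>\<epsilon>\<^sup>2\<close> and \<open>\<epsilon>\<^sup>2 * \<epsilon>\<^sup>2\<close> are
    the coefficients produced by differentiation, and \<open>1 + \<xi>\<^sup>2\<close> dominates 1,
    \<open>\<bar>\<xi>\<bar>\<close> and \<open>\<xi>\<^sup>2\<close>.\<close>
  define P where "P \<xi> = (1 + \<epsilon>\<^sup>2 + \<epsilon>\<^sup>2 * \<epsilon>\<^sup>2) * ((1 + \<xi>\<^sup>2) * gauss_mult \<epsilon> \<xi>)" for \<xi>
  have PE: "norm (E \<xi>) \<le> P \<xi>" "norm (E1 \<xi>) \<le> P \<xi>" "norm (E2 \<xi>) \<le> P \<xi>" for \<xi>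
  proof -
    have g: "gauss_mult \<epsilon> \<xi> \<ge> 0" by simp
    have abs: "\<bar>\<xi>\<bar> \<le> 1 + \<xi>\<^sup>2"
      using zero_le_power2[of "\<bar>\<xi>\<bar> - 1"] abs_ge_zero[of \<xi>] unfolding power2_diff power2_abs by simp
    have nE: "norm (E \<xi>) = gauss_mult \<epsilon> \<xi>" by (simp add: E_def)
    have nE1: "norm (E1 \<xi>) = \<epsilon>\<^sup>2 * \<bar>\<xi>\<bar> * gauss_mult \<epsilon> \<xi>" by (simp add: E1_def norm_mult norm_power nE abs_mult)
    have P: "P \<xi> = ((1 + \<epsilon>\<^sup>2 + \<epsilon>\<^sup>2 * \<epsilon>\<^sup>2) * (1 + \<xi>\<^sup>2)) * gauss_mult \<epsilon> \<xi>" by (simp add: P_def)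
    have "1 * gauss_mult \<epsilon> \<xi> \<le> P \<xi>" unfolding P
    proof (intro mult_right_mono g)
      have "1 * 1 \<le> (1 + \<epsilon>\<^sup>2 + \<epsilon>\<^sup>2 * \<epsilon>\<^sup>2) * (1 + \<xi>\<^sup>2)" by (intro mult_mono) auto
      then show "1 \<le> (1 + \<epsilon>\<^sup>2 + \<epsilon>\<^sup>2 * \<epsilon>\<^sup>2) * (1 + \<xi>\<^sup>2)" by simp
    qed
    then show "norm (E \<xi>) \<le> P \<xi>" by (simp add: nE)
    have "(\<epsilon>\<^sup>2 * \<bar>\<xi>\<bar>) * gauss_mult \<epsilon> \<xi> \<le> P \<xi>" unfolding P
      using abs by (intro mult_right_mono mult_mono g) (auto simp: add_increasing)
    then show "norm (E1 \<xi>) \<le> P \<xi>" by (simp add: nE1)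
    have "norm (E2 \<xi>) \<le> \<epsilon>\<^sup>2 * gauss_mult \<epsilon> \<xi> + \<epsilon>\<^sup>2 * \<bar>\<xi>\<bar> * (\<epsilon>\<^sup>2 * \<bar>\<xi>\<bar> * gauss_mult \<epsilon> \<xi>)"
      unfolding E2_def by (rule order_trans[OF norm_triangle_ineq4]) (simp add: norm_mult norm_power nE nE1 abs_mult)
    also have "\<dots> = (\<epsilon>\<^sup>2 * 1 + \<epsilon>\<^sup>2 * \<epsilon>\<^sup>2 * \<xi>\<^sup>2) * gauss_mult \<epsilon> \<xi>"
      by (simp add: algebra_simps power2_eq_square abs_mult_self_eq)
    also have "\<dots> \<le> P \<xi>" unfolding P
      by (intro mult_right_mono g) (auto simp: algebra_simps add_nonneg_nonneg)
    finally show "norm (E2 \<xi>) \<le> P \<xi>" .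
  qed
  have P0: "P \<xi> \<ge> 0" for \<xi> using PE(1)[of \<xi>] norm_ge_zero order_trans by blast
  \<comment> \<open>This is \<open>fourier k \<xi> * E \<xi> * R \<xi>\<close>, rewritten by means
    of \<open>fourier k \<xi> * R \<xi> = \<mu> * R \<xi> - 1\<close> so that only \<open>E\<close>
    and \<open>R\<close> have to be differentiated.\<close>
  define q where "q \<xi> = \<mu> * (E \<xi> * R \<xi>) - E \<xi>" for \<xi>
  define q1 where "q1 \<xi> = \<mu> * (E \<xi> * R1 \<xi> + E1 \<xi> * R \<xi>) - E1 \<xi>" for \<xi>
  define q2 where "q2 \<xi> = \<mu> * ((E \<xi> * R2 \<xi> + E1 \<xi> * R1 \<xi>) + (E1 \<xi> * R1 \<xi> + E2 \<xi> * R \<xi>)) - E2 \<xi>" for \<xi>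
  have dR': "(R has_vector_derivative R1 \<xi>) (at \<xi>)" for \<xi> using dR by (simp add: R1_def)
  have dq: "(q has_vector_derivative q1 \<xi>) (at \<xi>)" for \<xi>
    unfolding q_def[abs_def] q1_def using dE dR'
    by (intro has_vector_derivative_diff has_vector_derivative_mult_right has_vector_derivative_mult)
  have dq1: "(q1 has_vector_derivative q2 \<xi>) (at \<xi>)" for \<xi>
    unfolding q1_def[abs_def] q2_def using dE dE1 dR' dR1
    by (intro has_vector_derivative_diff has_vector_derivative_mult_right has_vector_derivative_mult has_vector_derivative_add)
  have cE: "isCont E \<xi>" "isCont E1 \<xi>" "isCont R \<xi>" "isCont R1 \<xi>" for \<xi>
    by (rule has_vector_derivative_continuous[OF dE] has_vector_derivative_continuous[OF dE1]
        has_vector_derivative_continuous[OF dR] has_vector_derivative_continuous[OF dR1])+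
  have cq2: "isCont q2 \<xi>" for \<xi>
    unfolding q2_def[abs_def] R2_def[abs_def] E2_def[abs_def] using cE c\<phi>
    by (intro continuous_intros) auto
  define B where "B = K * D^2 + K * (2 * D * (K * D^2)) + D"
  have KD: "0 \<le> K" "0 \<le> D" "0 \<le> K * D^2" "0 \<le> K * (2 * D * (K * D^2))" using K D by auto
  have bB: "norm (R \<xi>) \<le> B" "norm (R1 \<xi>) \<le> B" "norm (R2 \<xi>) \<le> B" for \<xi>
    using bR[of \<xi>] bR1[of \<xi>] bR2[of \<xi>] KD unfolding B_def by linarith+
  have B0: "B \<ge> 0" using bB(1)[of 0] norm_ge_zero order_trans by blast
  \<comment> \<open>The 4 counts the products in \<open>q2\<close>, which has the most among
    \<open>q\<close>, \<open>q1\<close> and \<open>q2\<close>.\<close>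
  define A where "A = norm \<mu> * (4 * B) + 1"
  have PB: "norm (x * y) \<le> P \<xi> * B" if "norm x \<le> P \<xi>" "norm y \<le> B" for x y :: complex and \<xi>
    unfolding norm_mult using that P0 by (intro mult_mono) auto
  have main: "norm (\<mu> * z - e) \<le> A * P \<xi>" if "norm z \<le> 4 * (P \<xi> * B)" "norm e \<le> P \<xi>" for z e \<xi>
  proof -
    have "norm (\<mu> * z - e) \<le> norm \<mu> * norm z + norm e" 
      by (rule order_trans[OF norm_triangle_ineq4]) (simp add: norm_mult)
    also have "\<dots> \<le> norm \<mu> * (4 * (P \<xi> * B)) + P \<xi>" using that by (intro add_mono mult_left_mono) auto
    finally show ?thesis by (simp add: A_def algebra_simps)
  qed
  have PB0: "P \<xi> * B \<ge> 0" for \<xi> using P0 B0 by simp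
  have bq: "norm (q \<xi>) \<le> A * P \<xi>" for \<xi>
    unfolding q_def using PB[OF PE(1) bB(1), of \<xi> \<xi>] PB0[of \<xi>] by (intro main PE) linarith
  have bq1: "norm (q1 \<xi>) \<le> A * P \<xi>" for \<xi>
    unfolding q1_def using PB[OF PE(1) bB(2), of \<xi> \<xi>] PB[OF PE(2) bB(1), of \<xi> \<xi>] PB0[of \<xi>] 
    by (intro main PE order_trans[OF norm_triangle_ineq]) linarith
  have bq2: "norm (q2 \<xi>) \<le> A * P \<xi>" for \<xi>
  proof -
    have "norm ((E \<xi> * R2 \<xi> + E1 \<xi> * R1 \<xi>) + (E1 \<xi> * R1 \<xi> + E2 \<xi> * R \<xi>))
      \<le> (norm (E \<xi> * R2 \<xi>) + norm (E1 \<xi> * R1 \<xi>)) + (norm (E1 \<xi> * R1 \<xi>) + norm (E2 \<xi> * R \<xi>))"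
      by (rule order_trans[OF norm_triangle_ineq add_mono[OF norm_triangle_ineq norm_triangle_ineq]])
    then show ?thesis unfolding q2_def
      using PB[OF PE(1) bB(3), of \<xi> \<xi>] PB[OF PE(2) bB(2), of \<xi> \<xi>] PB[OF PE(3) bB(1), of \<xi> \<xi>] 
      by (intro main PE) linarith
  qed
  obtain C where C: "\<And>\<xi>. (1 + \<xi>\<^sup>2) * gauss_mult \<epsilon> \<xi> \<le> C / (1 + \<xi>\<^sup>2)" using gauss_mult_bound[OF \<epsilon>] by blast
  define C' where "C' = A * ((1 + \<epsilon>\<^sup>2 + \<epsilon>\<^sup>2 * \<epsilon>\<^sup>2) * C)"
  have A0: "A \<ge> 0" using B0 by (simp add: A_def)
  have AP: "A * P \<xi> \<le> C' / (1 + \<xi>\<^sup>2)" for \<xi>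
  proof -
    have "A * P \<xi> \<le> A * ((1 + \<epsilon>\<^sup>2 + \<epsilon>\<^sup>2 * \<epsilon>\<^sup>2) * (C / (1 + \<xi>\<^sup>2)))"
      unfolding P_def using A0 C[of \<xi>] by (intro mult_left_mono) auto
    then show ?thesis by (simp add: C'_def)
  qed
  have Eb: "norm (E \<xi>) \<le> ((1 + \<epsilon>\<^sup>2 + \<epsilon>\<^sup>2 * \<epsilon>\<^sup>2) * C) / (1 + \<xi>\<^sup>2)" for \<xi>
  proof -
    have "P \<xi> \<le> ((1 + \<epsilon>\<^sup>2 + \<epsilon>\<^sup>2 * \<epsilon>\<^sup>2) * (C / (1 + \<xi>\<^sup>2)))"
      unfolding P_def using C[of \<xi>] by (intro mult_left_mono) auto
    then show ?thesis using PE(1)[of \<xi>] by simp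
  qed
  note bounds = order_trans[OF bq AP] order_trans[OF bq1 AP] order_trans[OF bq2 AP]
  show hi: "integrable lborel (ifourier q)"
    by (rule ifourier_integrable[OF dq dq1 cq2 bounds])
  have cq: "isCont q \<xi>" for \<xi> using dq by (rule has_vector_derivative_continuous)
  have cont_meas: "f \<in> borel_measurable borel" if "\<And>x. isCont f x" for f :: "real \<Rightarrow> complex"
    using that by (auto intro!: borel_measurable_continuous_onI continuous_at_imp_continuous_on)
  have qi: "integrable lborel q" by (rule integrable_of_inverse_square_bound[OF cont_meas[OF cq] bounds(1)])
  have Ei: "integrable lborel E" by (rule integrable_of_inverse_square_bound[OF cont_meas[OF cE(1)] Eb])
  have fqi: "integrable lborel (\<lambda>\<xi>. fourier k \<xi> * q \<xi>)"
  proof (rule Bochner_Integration.integrable_bound[where f = "\<lambda>\<xi>. L1 k * norm (q \<xi>)"])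
    show "AE \<xi> in lborel. norm (fourier k \<xi> * q \<xi>) \<le> norm (L1 k * norm (q \<xi>))"
      by (intro AE_I2) (simp add: norm_mult mult_right_mono norm_fourier_le)
  qed (use qi cont_meas[OF c\<phi>(1)] in auto)
  fix w
  have "\<mu> * ifourier q w - conv k (ifourier q) w = ifourier (\<lambda>\<xi>. \<mu> * q \<xi> - fourier k \<xi> * q \<xi>) w"
    using qi fqi by (subst ifourier_diff) (auto simp: ifourier_cmult conv_ifourier[OF integrable_kernel qi])
  also have "(\<lambda>\<xi>. \<mu> * q \<xi> - fourier k \<xi> * q \<xi>) = (\<lambda>\<xi>. fourier k \<xi> * E \<xi>)"
  proof
    fix \<xi>
    have "(\<mu> - fourier k \<xi>) * R \<xi> = 1" using nz by (simp add: R_def)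
    then have "(\<mu> - fourier k \<xi>) * (\<mu> * (E \<xi> * R \<xi>)) = \<mu> * E \<xi>" by (metis mult.left_commute mult.right_neutral)
    then show "\<mu> * q \<xi> - fourier k \<xi> * q \<xi> = fourier k \<xi> * E \<xi>" by (simp add: q_def algebra_simps)
  qed
  also have "ifourier (\<lambda>\<xi>. fourier k \<xi> * E \<xi>) w = conv k (ifourier E) w"
    by (rule conv_ifourier[OF integrable_kernel Ei, symmetric])
  also have "ifourier E = (\<lambda>w. complex_of_real (normal_density 0 \<epsilon> w))"
    unfolding E_def[abs_def] by (rule ext, rule ifourier_gauss[OF \<epsilon>])
  finally show "\<mu> * ifourier q w - conv k (ifourier q) w = conv k (\<lambda>w. complex_of_real (normal_density 0 \<epsilon> w)) w" .
qed

end

section \<open>Neumann series and the resolvent set\<close>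

lemma Lnorm_sum_le:
  assumes "\<And>i. i \<in> I \<Longrightarrow> F i \<in> Lp p" "p \<ge> 1"
  shows "Lnorm p (\<lambda>x. \<Sum>i\<in>I. F i x) \<le> (\<Sum>i\<in>I. Lnorm p (F i))"
  using assms(1)
proof (induction I rule: infinite_finite_induct)
  case (insert i I)
  then show ?case
    using Lp_add(2)[of "F i" p "\<lambda>x. \<Sum>i\<in>I. F i x"] Lp_sum[of I F p] assms(2) by auto
qed (use Lp_zero assms in auto)

lemma cor_sum:
  assumes "integrable lborel k" "\<And>i. i \<in> I \<Longrightarrow> F i \<in> Lp p" "p \<ge> 1" "finite I"
  shows "AE x in lborel. cor k (\<lambda>x. \<Sum>i\<in>I. F i x) x = (\<Sum>i\<in>I. cor k (F i) x)"
  using assms(4,2)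
proof (induction I rule: finite_induct)
  case (insert i I)
  have "AE x in lborel. cor k (\<lambda>x. F i x + (\<Sum>i\<in>I. F i x)) x = cor k (F i) x + cor k (\<lambda>x. \<Sum>i\<in>I. F i x) x"
    by (rule cor_add[OF assms(1) _ _ assms(3)]) (use insert Lp_sum[of I F p] assms in auto)
  moreover have "AE x in lborel. cor k (\<lambda>x. \<Sum>i\<in>I. F i x) x = (\<Sum>i\<in>I. cor k (F i) x)"
    using insert by auto
  ultimately show ?case
  proof eventually_elim
    case (elim x)
    have "(\<lambda>x. \<Sum>i\<in>insert i I. F i x) = (\<lambda>x. F i x + (\<Sum>i\<in>I. F i x))" using insert by auto
    then show ?case using elim insert by simp
  qed
qed (auto simp: cor_def)

text \<open>With ratio \<open>\<rho> = L1 u / norm \<mu>\<close> below 1 the partial sums are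
  Cauchy. They satisfy \<open>\<mu> * F (Suc n) - cor u (F n) = G\<close>, the equation with an
  index shift, and boundedness of \<open>cor u\<close> makes the defect \<open>Z\<close> of the
  limit vanish in norm, hence almost everywhere.\<close>

lemma neumann_series:
  assumes u: "integrable lborel u" "L1 u < norm \<mu>" and G: "G \<in> Lp p" and p: "p \<ge> 1"
  obtains F where "F \<in> Lp p" "AE x in lborel. \<mu> * F x - cor u F x = G x"
proof -
  have nz: "\<mu> \<noteq> 0" using order_le_less_trans[OF L1_nonneg u(2)] by auto
  define \<rho> where "\<rho> = L1 u / norm \<mu>"
  have \<rho>: "0 \<le> \<rho>" "\<rho> < 1" using u(2) nz by (auto simp: \<rho>_def)
  define T where "T = rec_nat (\<lambda>x. inverse \<mu> * G x) (\<lambda>_ F x. inverse \<mu> * cor u F x)"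
  have T0: "T 0 = (\<lambda>x. inverse \<mu> * G x)" and TS: "T (Suc n) = (\<lambda>x. inverse \<mu> * cor u (T n) x)" for n
    by (auto simp: T_def)
  have TL: "T n \<in> Lp p" for n
    by (induction n) (auto simp: T0 TS intro!: Lp_cmult(1) G p cor_Lp(2) u)
  define C where "C = Lnorm p (T 0)"
  have Tn: "Lnorm p (T n) \<le> C * \<rho> ^ n" for n
  proof (induction n)
    case (Suc n)
    have "Lnorm p (T (Suc n)) = norm (inverse \<mu>) * Lnorm p (cor u (T n))"
      unfolding TS by (rule Lp_cmult(2)[OF cor_Lp(2)[OF u(1) TL p] p])
    also have "\<dots> \<le> norm (inverse \<mu>) * (L1 u * Lnorm p (T n))"
      by (intro mult_left_mono cor_Lp(3)[OF u(1) TL p]) auto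
    also have "\<dots> = \<rho> * Lnorm p (T n)" by (simp add: \<rho>_def norm_inverse divide_inverse)
    also have "\<dots> \<le> \<rho> * (C * \<rho> ^ n)" using Suc \<rho> by (intro mult_left_mono) auto
    finally show ?case by (simp add: mult_ac)
  qed (simp add: C_def)
  define F where "F n x = (\<Sum>i<n. T i x)" for n x
  have FL: "F n \<in> Lp p" for n unfolding F_def by (rule Lp_sum[OF TL p])
  have "summable (\<lambda>i. C * \<rho> ^ i)" using \<rho> by (intro summable_mult summable_geometric) auto
  then have Cau: "\<exists>N. \<forall>m\<ge>N. \<forall>n. norm (\<Sum>i\<in>{m..<n}. C * \<rho> ^ i) < e" if "e > 0" for e
    using that by (subst (asm) summable_Cauchy) blast
  have diff: "Lnorm p (\<lambda>x. F n x - F m x) \<le> (\<Sum>i\<in>{m..<n}. C * \<rho> ^ i)" if "m \<le> n" for m n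
  proof -
    have "F n x - F m x = (\<Sum>i\<in>{m..<n}. T i x)" for x
      unfolding F_def using that by (metis sum_diff_nat_ivl atLeast0LessThan le0)
    then have "Lnorm p (\<lambda>x. F n x - F m x) \<le> (\<Sum>i\<in>{m..<n}. Lnorm p (T i))"
      using Lnorm_sum_le[of "{m..<n}" T p] TL p by simp
    also have "\<dots> \<le> (\<Sum>i\<in>{m..<n}. C * \<rho> ^ i)" by (intro sum_mono Tn)
    finally show ?thesis .
  qed
  have sym: "Lnorm p (\<lambda>x. F m x - F n x) = Lnorm p (\<lambda>x. F n x - F m x)" for m n
    using Lp_uminus(2)[OF Lp_diff(1)[OF FL[of m] FL[of n] p] p] by simp
  have "\<exists>N. \<forall>m\<ge>N. \<forall>n\<ge>N. Lnorm p (\<lambda>x. F m x - F n x) < e" if e: "e > 0" for e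
  proof -
    obtain N where N: "\<And>m n. m \<ge> N \<Longrightarrow> norm (\<Sum>i\<in>{m..<n}. C * \<rho> ^ i) < e" using Cau[OF e] by blast
    have "Lnorm p (\<lambda>x. F m x - F n x) < e" if "m \<ge> N" "n \<ge> N" for m n
    proof (cases "m \<le> n")
      case True
      have "(\<Sum>i\<in>{m..<n}. C * \<rho> ^ i) < e" using N[OF that(1), of n] by (simp add: abs_less_iff)
      then show ?thesis using diff[OF True] sym[of m n] by linarith
    next
      case False
      have "(\<Sum>i\<in>{n..<m}. C * \<rho> ^ i) < e" using N[OF that(2), of m] by (simp add: abs_less_iff)
      then show ?thesis using diff[of n m] False by linarith
    qed
    then show ?thesis by blast
  qed
  from Lp_complete[OF FL p this] obtain H where H: "H \<in> Lp p" and lim: "(\<lambda>n. Lnorm p (\<lambda>x. F n x - H x)) \<longlonglongrightarrow> 0"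
    by blast
  have rec: "AE x in lborel. \<mu> * F (Suc n) x - cor u (F n) x = G x" for n
  proof -
    have "AE x in lborel. cor u (F n) x = (\<Sum>i<n. cor u (T i) x)"
      unfolding F_def by (rule cor_sum[OF u(1) TL p]) auto
    then show ?thesis
    proof eventually_elim
      case (elim x)
      have "\<mu> * F (Suc n) x = G x + (\<Sum>i<n. cor u (T i) x)"
      proof -
        have c: "\<mu> * (inverse \<mu> * z) = z" for z using nz by simp
        show ?thesis unfolding F_def sum.lessThan_Suc_shift T0 TS distrib_left sum_distrib_left by (simp only: c)
      qed
      then show ?case using elim by simp
    qed
  qed
  define Z where "Z x = (\<mu> * H x - cor u H x) - G x" for x
  have ZL: "Z \<in> Lp p" unfolding Z_def by (intro Lp_diff(1) Lp_cmult(1) cor_Lp(2) u H G p)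
  have "Lnorm p Z \<le> norm \<mu> * Lnorm p (\<lambda>x. F (Suc n) x - H x) + L1 u * Lnorm p (\<lambda>x. F n x - H x)" for n
  proof -
    define A where "A x = \<mu> * (F (Suc n) x - H x)" for x
    define B where "B = cor u (\<lambda>x. F n x - H x)"
    have AL: "A \<in> Lp p" unfolding A_def by (intro Lp_cmult(1) Lp_diff(1) FL H p)
    have BL: "B \<in> Lp p" unfolding B_def by (intro cor_Lp(2) Lp_diff(1) FL H p u)
    have "AE x in lborel. B x - A x = Z x"
      using rec[of n] cor_diff[OF u(1) FL[of n] H p]
      by eventually_elim (simp add: A_def B_def Z_def algebra_simps)
    then have "Lnorm p Z = Lnorm p (\<lambda>x. B x - A x)"
      using ZL by (intro Lp_AE_cong(2)[OF Lp_diff(1)[OF BL AL p]]) auto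
    also have "\<dots> \<le> Lnorm p B + Lnorm p A" by (rule Lp_diff(2)[OF BL AL p])
    also have "Lnorm p A = norm \<mu> * Lnorm p (\<lambda>x. F (Suc n) x - H x)"
      unfolding A_def by (intro Lp_cmult(2) Lp_diff(1) FL H p)
    also have "Lnorm p B \<le> L1 u * Lnorm p (\<lambda>x. F n x - H x)"
      unfolding B_def by (intro cor_Lp(3) Lp_diff(1) FL H p u)
    finally show ?thesis by simp
  qed
  moreover have "(\<lambda>n. norm \<mu> * Lnorm p (\<lambda>x. F (Suc n) x - H x) + L1 u * Lnorm p (\<lambda>x. F n x - H x)) \<longlonglongrightarrow> norm \<mu> * 0 + L1 u * 0"
    by (intro tendsto_intros lim LIMSEQ_Suc[OF lim])
  ultimately have "Lnorm p Z \<le> 0" by (intro LIMSEQ_le_const[of _ 0]) auto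
  then have "AE x in lborel. Z x = 0" using Lnorm_eq_0_iff[OF ZL p] Lnorm_nonneg[of p Z] by linarith
  then have "AE x in lborel. \<mu> * H x - cor u H x = G x" by eventually_elim (simp add: Z_def)
  with H show ?thesis by (rule that)
qed

context smooth_kernel
begin

text \<open>The factorization is used from both sides. Applying \<open>1 + cor h\<close> before
  \<open>\<mu> - cor k\<close> turns the Neumann solution \<open>H\<close> into the preimage
  \<open>H + cor h H\<close>. Applying it afterwards, which is the same because correlations
  commute, turns the lower bound for \<open>\<mu> - cor u\<close> into one for
  \<open>\<mu> - cor k\<close>, with constant
  \<open>(1 + L1 h) / (norm \<mu> - L1 u)\<close>.\<close>

lemma resolvent_exists:
  assumes notin: "\<mu> \<notin> closure (range (fourier k))" and p: "p \<ge> 1"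
  shows "\<forall>G\<in>Lp p. \<exists>F\<in>Lp p. AE x in lborel. \<mu> * F x - cor k F x = G x"
    and "\<exists>M. \<forall>F\<in>Lp p. Lnorm p F \<le> M * Lnorm p (\<lambda>x. \<mu> * F x - cor k F x)"
proof -
  have nz: "\<mu> \<noteq> 0" using notin zero_in_closure_range_fourier by auto
  obtain \<delta> where \<delta>: "\<delta> > 0" "\<And>z. z \<in> range (fourier k) \<Longrightarrow> \<delta> \<le> dist z \<mu>"
    using notin unfolding closure_approachable by (auto simp: not_less)
  have \<delta>': "\<delta> \<le> norm (\<mu> - fourier k \<xi>)" for \<xi>
    using \<delta>(2)[of "fourier k \<xi>"] by (simp add: dist_norm norm_minus_commute)
  have "eventually (\<lambda>n. L1 (\<lambda>w. k w - conv k (\<lambda>w. complex_of_real (normal_density 0 (1 / real (Suc n)) w)) w) < norm \<mu>) sequentially"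
    using order_tendstoD(2)[OF L1_mollify_tendsto, of "norm \<mu>"] nz by simp
  then obtain n where n: "L1 (\<lambda>w. k w - conv k (\<lambda>w. complex_of_real (normal_density 0 (1 / real (Suc n)) w)) w) < norm \<mu>"
    by (auto simp: eventually_sequentially)
  define g where "g = conv k (\<lambda>w. complex_of_real (normal_density 0 (1 / real (Suc n)) w))"
  define u where "u w = k w - g w" for w
  have gi: "integrable lborel g" unfolding g_def by (rule conv_integrable[OF integrable_kernel]) simp
  have ui: "integrable lborel u" unfolding u_def using integrable_kernel gi by simp
  have uL: "L1 u < norm \<mu>" using n unfolding u_def[abs_def] g_def .
  obtain h where hi: "integrable lborel h" and h: "\<And>w. \<mu> * h w - conv k h w = g w"
    using resolvent_kernel[OF \<delta>(1) \<delta>', of "1 / real (Suc n)"] unfolding g_def by auto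
  have comp: "AE x in lborel. \<mu> * cor h F x - cor k (cor h F) x = cor g F x" if F: "F \<in> Lp p" for F
  proof -
    have geq: "(\<lambda>w. \<mu> * h w - conv k h w) = g" using h by auto
    have "AE x in lborel. cor (\<lambda>w. \<mu> * h w - conv k h w) F x = cor (\<lambda>w. \<mu> * h w) F x - cor (conv k h) F x"
      by (rule cor_kernel_diff[OF _ conv_integrable[OF integrable_kernel hi] F p]) (use hi in simp)
    then show ?thesis
      using cor_cor[OF integrable_kernel hi F p] unfolding geq cor_kernel_cmult by eventually_elim simp
  qed
  have udiff: "AE x in lborel. cor u F x = cor k F x - cor g F x" if F: "F \<in> Lp p" for F
    unfolding u_def by (rule cor_kernel_diff[OF integrable_kernel gi F p])
  show "\<forall>G\<in>Lp p. \<exists>F\<in>Lp p. AE x in lborel. \<mu> * F x - cor k F x = G x"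
  proof
    fix G assume G: "G \<in> Lp p"
    obtain H where H: "H \<in> Lp p" and e: "AE x in lborel. \<mu> * H x - cor u H x = G x"
      using neumann_series[OF ui uL G p] by blast
    have hH: "cor h H \<in> Lp p" by (rule cor_Lp(2)[OF hi H p])
    show "\<exists>F\<in>Lp p. AE x in lborel. \<mu> * F x - cor k F x = G x"
    proof (intro bexI[of _ "\<lambda>x. H x + cor h H x"] Lp_add(1)[OF H hH p])
      show "AE x in lborel. \<mu> * (H x + cor h H x) - cor k (\<lambda>x. H x + cor h H x) x = G x"
        using e udiff[OF H] comp[OF H] cor_add[OF integrable_kernel H hH p]
        by eventually_elim (simp add: algebra_simps)
    qed
  qed
  have "Lnorm p F \<le> ((1 + L1 h) / (norm \<mu> - L1 u)) * Lnorm p (\<lambda>x. \<mu> * F x - cor k F x)" if F: "F \<in> Lp p" for F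
  proof -
    define Z where "Z x = \<mu> * F x - cor k F x" for x
    have kF: "cor k F \<in> Lp p" and \<mu>F: "(\<lambda>x. \<mu> * F x) \<in> Lp p" and uF: "cor u F \<in> Lp p" and hF: "cor h F \<in> Lp p"
      by (rule cor_Lp(2)[OF integrable_kernel F p] Lp_cmult(1)[OF F p] cor_Lp(2)[OF ui F p] cor_Lp(2)[OF hi F p])+
    have ZL: "Z \<in> Lp p" unfolding Z_def by (rule Lp_diff(1)[OF \<mu>F kF p])
    have hZ: "cor h Z \<in> Lp p" by (rule cor_Lp(2)[OF hi ZL p])
    have "AE x in lborel. Z x + cor h Z x = \<mu> * F x - cor u F x"
      using udiff[OF F] comp[OF F] cor_commute[OF integrable_kernel hi F p] cor_diff[OF hi \<mu>F kF p]
    proof eventually_elim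
      case (elim x)
      have "cor h Z x = \<mu> * cor h F x - cor h (cor k F) x" using elim(4) by (simp add: Z_def[abs_def] cor_cmult)
      then show ?case using elim by (simp add: Z_def algebra_simps)
    qed
    then have "Lnorm p (\<lambda>x. \<mu> * F x - cor u F x) = Lnorm p (\<lambda>x. Z x + cor h Z x)"
      by (rule Lp_AE_cong(2)[OF Lp_add(1)[OF ZL hZ p] Lp_measurable[OF Lp_diff(1)[OF \<mu>F uF p]]])
    also have "\<dots> \<le> Lnorm p Z + Lnorm p (cor h Z)" by (rule Lp_add(2)[OF ZL hZ p])
    also have "\<dots> \<le> Lnorm p Z + L1 h * Lnorm p Z" using cor_Lp(3)[OF hi ZL p] by simp
    finally have 1: "Lnorm p (\<lambda>x. \<mu> * F x - cor u F x) \<le> (1 + L1 h) * Lnorm p Z" by (simp add: distrib_right)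
    have "norm \<mu> * Lnorm p F - L1 u * Lnorm p F \<le> Lnorm p (\<lambda>x. \<mu> * F x) - Lnorm p (cor u F)"
      using Lp_cmult(2)[OF F p, of \<mu>] cor_Lp(3)[OF ui F p] by simp
    also have "\<dots> \<le> Lnorm p (\<lambda>x. \<mu> * F x - cor u F x)" using Lnorm_diff_ge[OF \<mu>F uF p] by linarith
    finally have "(norm \<mu> - L1 u) * Lnorm p F \<le> (1 + L1 h) * Lnorm p Z" using 1 by (simp add: left_diff_distrib)
    then show ?thesis using uL unfolding Z_def by (simp add: field_simps)
  qed
  then show "\<exists>M. \<forall>F\<in>Lp p. Lnorm p F \<le> M * Lnorm p (\<lambda>x. \<mu> * F x - cor k F x)" by blast
qed

section \<open>Approximate eigenvectors\<close>

text \<open>An interval and its translate differ within two intervals of length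
  \<open>\<bar>y\<bar>\<close>, \<open>A\<close> and \<open>B\<close>, one at each end. There the
  difference has modulus at most 1, so the bound is the same for every p and, above all, for every
  length l.\<close>

lemma nn_integral_interval_shift:
  assumes "0 \<le> l" "p \<ge> 1"
  shows "(\<integral>\<^sup>+x. ennreal (norm (indicator {0..l} (x + y) - indicator {0..l} x :: complex) powr p) \<partial>lborel) \<le> ennreal (2 * \<bar>y\<bar>)"
proof -
  define A where "A = (if y \<ge> 0 then {l - y..l} else {0..-y})"
  define B where "B = (if y \<ge> 0 then {-y..0} else {l..l-y})"
  have "(\<integral>\<^sup>+x. ennreal (norm (indicator {0..l} (x + y) - indicator {0..l} x :: complex) powr p) \<partial>lborel)
     \<le> (\<integral>\<^sup>+x. indicator A x + indicator B x \<partial>lborel)"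
  proof (rule nn_integral_mono)
    fix x
    show "ennreal (norm (indicator {0..l} (x + y) - indicator {0..l} x :: complex) powr p) \<le> indicator A x + indicator B x"
    proof (cases "x + y \<in> {0..l} \<longleftrightarrow> x \<in> {0..l}")
      case True
      then have "indicator {0..l} (x + y) = (indicator {0..l} x :: complex)" by (simp add: indicator_def)
      then show ?thesis by simp
    next
      case False
      then have "x \<in> A \<union> B" by (auto simp: A_def B_def)
      moreover have "norm (indicator {0..l} (x + y) - indicator {0..l} x :: complex) = 1" using False by (auto simp: indicator_def)
      ultimately show ?thesis by (auto simp: indicator_def)
    qed
  qed
  also have "\<dots> = emeasure lborel A + emeasure lborel B"
    by (subst nn_integral_add) (auto simp: A_def B_def)
  also have "\<dots> = ennreal (2 * \<bar>y\<bar>)"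
    by (auto simp: A_def B_def simp flip: ennreal_plus)
  finally show ?thesis .
qed

text \<open>Only the two ends of the interval cause a defect, so the first absolute moment of the
  kernel bounds it uniformly in the length \<open>l\<close>, whereas the norm of the truncated
  character grows without bound.\<close>

lemma approximate_eigenvector:
  assumes p: "p \<ge> 1"
  shows "\<exists>C\<ge>0. \<forall>l>0. \<exists>F\<in>Lp p. Lnorm p F = l powr (1/p) \<and> Lnorm p (\<lambda>x. fourier k \<xi> * F x - cor k F x) \<le> C"
proof -
  define C0 where "C0 = L1 k powr (p - 1) * (2 * (LINT y|lborel. \<bar>y\<bar> * \<kappa> y))"
  have i1: "integrable lborel (\<lambda>y. \<bar>y\<bar> * \<kappa> y)"
    using integrable_norm[OF moments[of 1]] nonneg by (simp add: abs_mult)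
  have C0: "C0 \<ge> 0" unfolding C0_def using nonneg by (auto intro!: mult_nonneg_nonneg)
  show ?thesis
  proof (intro exI[of _ "C0 powr (1/p)"] conjI allI impI)
    show "C0 powr (1/p) \<ge> 0" by simp
    fix l :: real assume l: "l > 0"
    define F where "F x = iexp (- (\<xi> * x)) * indicator {0..l} x" for x
    have [measurable]: "F \<in> borel_measurable borel" unfolding F_def by measurable
    have nF: "norm (F x) powr p = indicator {0..l} x" for x
      using p by (auto simp: F_def norm_mult indicator_def norm_exp_i_times simp del: of_real_minus of_real_mult)
    have FL: "F \<in> Lp p" using l by (auto simp: Lp_def nF)
    have Fn: "Lnorm p F = l powr (1/p)" using l by (simp add: Lnorm_def nF)
    \<comment> \<open>Chosen so that \<open>k y * D x y\<close> equals
      \<open>k y * F (x + y)\<close> minus \<open>iexp (- (\<xi> * y)) * k y * F x\<close>: the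
      character is multiplicative, hence only the cutoff changes.\<close>
    define D where "D x y = iexp (- (\<xi> * (x + y))) * (indicator {0..l} (x + y) - indicator {0..l} x)" for x y
    have D: "case_prod D \<in> borel_measurable (borel \<Otimes>\<^sub>M borel)" unfolding D_def by measurable
    have "(\<integral>\<^sup>+y. ennreal (norm (k y)) * (\<integral>\<^sup>+x. ennreal (norm (D x y) powr p) \<partial>lborel) \<partial>lborel)
        \<le> (\<integral>\<^sup>+y. ennreal (norm (k y)) * ennreal (2 * \<bar>y\<bar>) \<partial>lborel)"
    proof (intro nn_integral_mono mult_left_mono)
      fix y
      have "norm (D x y) = norm (indicator {0..l} (x + y) - indicator {0..l} x :: complex)" for x
        unfolding D_def norm_mult norm_exp_i_times by simp
      then show "(\<integral>\<^sup>+x. ennreal (norm (D x y) powr p) \<partial>lborel) \<le> ennreal (2 * \<bar>y\<bar>)"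
        using nn_integral_interval_shift[of l p y] l p by simp
    qed simp
    also have "\<dots> = (\<integral>\<^sup>+y. ennreal (2 * (\<bar>y\<bar> * \<kappa> y)) \<partial>lborel)"
      using nonneg by (intro nn_integral_cong) (simp add: ennreal_mult[symmetric] mult_ac)
    also have "\<dots> = ennreal (LINT y|lborel. 2 * (\<bar>y\<bar> * \<kappa> y))"
      using i1 nonneg by (intro nn_integral_eq_integral) auto
    finally have "(\<integral>\<^sup>+y. ennreal (norm (k y)) * (\<integral>\<^sup>+x. ennreal (norm (D x y) powr p) \<partial>lborel) \<partial>lborel)
        \<le> ennreal (2 * (LINT y|lborel. \<bar>y\<bar> * \<kappa> y))" by simp
    note mi = minkowski_integral[OF integrable_kernel D this p]
    have eq: "cor k F x - fourier k \<xi> * F x = (LINT y|lborel. k y * D x y)" if "integrable lborel (\<lambda>y. k y * F (x + y))" for x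
    proof -
      have "integrable lborel (\<lambda>y. iexp (- (\<xi> * y)) * k y * F x)"
        using integrable_iexp_mult(2)[OF integrable_kernel] by (rule integrable_mult_left)
      from Bochner_Integration.integral_diff[OF that this]
      have "cor k F x - fourier k \<xi> * F x = (LINT y|lborel. k y * F (x + y) - iexp (- (\<xi> * y)) * k y * F x)"
        by (simp add: cor_def fourier_def)
      also have "\<dots> = (LINT y|lborel. k y * D x y)"
      proof (intro Bochner_Integration.integral_cong refl)
        fix y
        have "iexp (-(\<xi> * (x + y))) = iexp (-(\<xi> * y)) * iexp (-(\<xi> * x))"
          by (simp add: exp_add[symmetric] algebra_simps)
        then show "k y * F (x + y) - iexp (- (\<xi> * y)) * k y * F x = k y * D x y"
          by (simp add: F_def D_def algebra_simps)
      qed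
      finally show ?thesis .
    qed
    have AEeq: "AE x in lborel. fourier k \<xi> * F x - cor k F x = - (LINT y|lborel. k y * D x y)"
      using cor_Lp(1)[OF integrable_kernel FL p] by eventually_elim (use eq in \<open>simp add: algebra_simps\<close>)
    have "Lnorm p (\<lambda>x. LINT y|lborel. k y * D x y) \<le> C0 powr (1/p)" "(\<lambda>x. LINT y|lborel. k y * D x y) \<in> Lp p"
      using Lnorm_leI[OF mi(2) p, of "C0 powr (1/p)"] mi(3) C0 p by (auto simp: powr_powr C0_def)
    then have "(\<lambda>x. - (LINT y|lborel. k y * D x y)) \<in> Lp p" "Lnorm p (\<lambda>x. - (LINT y|lborel. k y * D x y)) \<le> C0 powr (1/p)"
      using Lp_uminus[of "\<lambda>x. LINT y|lborel. k y * D x y" p] p by auto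
    moreover have "Lnorm p (\<lambda>x. - (LINT y|lborel. k y * D x y)) = Lnorm p (\<lambda>x. fourier k \<xi> * F x - cor k F x)"
      using AEeq Lp_measurable[OF calculation(1)]
      by (intro Lp_AE_cong(2)[OF Lp_diff(1)[OF Lp_cmult(1)[OF FL p] cor_Lp(2)[OF integrable_kernel FL p] p]])
    ultimately show "\<exists>F\<in>Lp p. Lnorm p F = l powr (1/p) \<and> Lnorm p (\<lambda>x. fourier k \<xi> * F x - cor k F x) \<le> C0 powr (1/p)"
      using FL Fn by (intro bexI[of _ F]) auto
  qed
qed

lemma not_bounded_below:
  assumes in_cl: "\<mu> \<in> closure (range (fourier k))" and p: "p \<ge> 1"
  shows "\<not> (\<exists>M. \<forall>F\<in>Lp p. Lnorm p F \<le> M * Lnorm p (\<lambda>x. \<mu> * F x - cor k F x))"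
proof
  assume "\<exists>M. \<forall>F\<in>Lp p. Lnorm p F \<le> M * Lnorm p (\<lambda>x. \<mu> * F x - cor k F x)"
  then obtain M0 where M0: "\<And>F. F \<in> Lp p \<Longrightarrow> Lnorm p F \<le> M0 * Lnorm p (\<lambda>x. \<mu> * F x - cor k F x)" by blast
  define M where "M = max M0 1"
  have M: "M \<ge> 1" "\<And>F. F \<in> Lp p \<Longrightarrow> Lnorm p F \<le> M * Lnorm p (\<lambda>x. \<mu> * F x - cor k F x)"
    by (auto simp: M_def intro!: order_trans[OF M0] mult_right_mono)
  \<comment> \<open>At this distance, replacing \<mu> by a value of the transform costs, after
    multiplication by M, at most half of \<open>Lnorm p F\<close>, which is absorbed on the
    left.\<close>
  have "1 / (2 * M) > 0" using M(1) by simp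
  then obtain z where "z \<in> range (fourier k)" "dist z \<mu> < 1 / (2 * M)"
    using in_cl unfolding closure_approachable by blast
  then obtain \<xi> where \<xi>: "norm (\<mu> - fourier k \<xi>) < 1 / (2 * M)" by (auto simp: dist_norm norm_minus_commute)
  obtain C where C: "C \<ge> 0" "\<forall>l>0. \<exists>F\<in>Lp p. Lnorm p F = l powr (1/p) \<and> Lnorm p (\<lambda>x. fourier k \<xi> * F x - cor k F x) \<le> C"
    using approximate_eigenvector[OF p, of \<xi>] by (elim exE conjE) (rule that)
  have bound: "l powr (1/p) \<le> 2 * M * C" if l: "l > 0" for l
  proof -
    obtain F where F: "F \<in> Lp p" and Fn: "Lnorm p F = l powr (1/p)" 
      and Fc: "Lnorm p (\<lambda>x. fourier k \<xi> * F x - cor k F x) \<le> C" using C(2) l by auto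
    have kF: "cor k F \<in> Lp p" by (rule cor_Lp(2)[OF integrable_kernel F p])
    have L: "(\<lambda>x. fourier k \<xi> * F x - cor k F x) \<in> Lp p" by (rule Lp_diff(1)[OF Lp_cmult(1)[OF F p] kF p])
    have "Lnorm p (\<lambda>x. \<mu> * F x - cor k F x) = Lnorm p (\<lambda>x. (fourier k \<xi> * F x - cor k F x) + (\<mu> - fourier k \<xi>) * F x)"
      by (simp add: algebra_simps)
    also have "\<dots> \<le> Lnorm p (\<lambda>x. fourier k \<xi> * F x - cor k F x) + norm (\<mu> - fourier k \<xi>) * Lnorm p F"
      unfolding Lp_cmult(2)[OF F p, symmetric] by (rule Lp_add(2)[OF L Lp_cmult(1)[OF F p] p])
    also have "\<dots> \<le> C + 1 / (2 * M) * Lnorm p F"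
      using Fc \<xi> by (intro add_mono mult_right_mono) auto
    finally have "Lnorm p F \<le> M * (C + 1 / (2 * M) * Lnorm p F)"
      using M(1) by (intro order_trans[OF M(2)[OF F]] mult_left_mono) auto
    also have "\<dots> = M * C + Lnorm p F / 2" using M(1) by (simp add: field_simps)
    finally show ?thesis using Fn by simp
  qed
  \<comment> \<open>The length \<open>l = B powr p\<close> produces norm \<open>B\<close>, one more
    than \<open>bound\<close> allows.\<close>
  define B where "B = 2 * M * C + 1"
  have B: "B > 0" using M C by (simp add: B_def add_nonneg_pos)
  have "(B powr p) powr (1/p) \<le> 2 * M * C" using B by (intro bound) simp
  moreover have "(B powr p) powr (1/p) = B" using B p by (simp add: powr_powr)
  ultimately show False by (simp add: B_def)
qed

theorem spectrum_cor:
  assumes "p \<ge> 1"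
  shows "(\<forall>G\<in>Lp p. \<exists>F\<in>Lp p. AE x in lborel. \<mu> * F x - cor k F x = G x) \<and>
      (\<exists>M. \<forall>F\<in>Lp p. Lnorm p F \<le> M * Lnorm p (\<lambda>x. \<mu> * F x - cor k F x)) \<longleftrightarrow> \<mu> \<notin> closure (range (fourier k))"
proof (cases "\<mu> \<in> closure (range (fourier k))")
  case True
  then show ?thesis using not_bounded_below[OF True assms] by simp
next
  case False
  then show ?thesis using resolvent_exists[OF False assms] by simp
qed

end

section \<open>Passage from the half-line to the line\<close>

text \<open>The substitution rule for compact intervals is applied to [-n-1, n+1], and monotone
  convergence exhausts the line and the half-line simultaneously.\<close>

lemma nn_integral_exp_subst:
  fixes f :: "real \<Rightarrow> ennreal"
  assumes [measurable]: "f \<in> borel_measurable borel"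
  shows "(\<integral>\<^sup>+s. f s * indicator {0<..} s \<partial>lborel) = (\<integral>\<^sup>+x. ennreal (exp x) * f (exp x) \<partial>lborel)"
proof -
  have sub: "(\<integral>\<^sup>+s. f s * indicator {exp (- real (Suc n))..exp (real (Suc n))} s \<partial>lborel)
      = (\<integral>\<^sup>+x. f (exp x) * ennreal (exp x) * indicator {- real (Suc n)..real (Suc n)} x \<partial>lborel)" for n
    by (rule nn_integral_substitution_aux) (auto intro!: derivative_eq_intros continuous_intros)
  have sup1: "(SUP n. f s * indicator {exp (- real (Suc n))..exp (real (Suc n))} s) = f s * indicator {0<..} s" for s
  proof (cases "s > 0")
    case True
    define N where "N = nat \<lceil>\<bar>ln s\<bar>\<rceil>"
    have "s \<in> {exp (- real (Suc N))..exp (real (Suc N))}"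
    proof -
      have "\<bar>ln s\<bar> \<le> real (Suc N)" unfolding N_def by linarith
      then have "- real (Suc N) \<le> ln s" "ln s \<le> real (Suc N)" by linarith+
      then show ?thesis using True by (metis atLeastAtMost_iff exp_le_cancel_iff exp_ln)
    qed
    then have "f s * indicator {0<..} s \<le> (SUP n. f s * indicator {exp (- real (Suc n))..exp (real (Suc n))} s)"
      using True by (intro SUP_upper2[of N]) auto
    moreover have "(SUP n. f s * indicator {exp (- real (Suc n))..exp (real (Suc n))} s) \<le> f s * indicator {0<..} s"
      using True by (intro SUP_least) (auto simp: indicator_def)
    ultimately show ?thesis by (rule antisym[rotated])
  next
    case False
    then have "s \<notin> {exp (- real (Suc n))..exp (real (Suc n))}" for n
      by (meson atLeastAtMost_iff exp_gt_zero not_less order_trans)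
    then show ?thesis using False by simp
  qed
  have sup2: "(SUP n. g x * indicator {- real (Suc n)..real (Suc n)} x) = g x" for x and g :: "real \<Rightarrow> ennreal"
  proof -
    define N where "N = nat \<lceil>\<bar>x\<bar>\<rceil>"
    have "\<bar>x\<bar> \<le> real (Suc N)" unfolding N_def by linarith
    then have "x \<in> {- real (Suc N)..real (Suc N)}" by auto
    then have "g x \<le> (SUP n. g x * indicator {- real (Suc n)..real (Suc n)} x)"
      by (intro SUP_upper2[of N]) auto
    moreover have "(SUP n. g x * indicator {- real (Suc n)..real (Suc n)} x) \<le> g x"
      by (intro SUP_least) (auto simp: indicator_def)
    ultimately show ?thesis by (rule antisym[rotated])
  qed
  have inc: "{exp (- real (Suc m))..exp (real (Suc m))} \<subseteq> {exp (- real (Suc n))..exp (real (Suc n))}"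
    "{- real (Suc m)..real (Suc m)} \<subseteq> {- real (Suc n)..real (Suc n)}" if "m \<le> n" for m n
    using that by auto
  have im: "indicator A x \<le> (indicator B x :: ennreal)" if "A \<subseteq> B" for A B and x :: real
    using that by (auto simp: indicator_def)
  have "(\<integral>\<^sup>+s. f s * indicator {0<..} s \<partial>lborel) = (\<integral>\<^sup>+s. (SUP n. f s * indicator {exp (- real (Suc n))..exp (real (Suc n))} s) \<partial>lborel)"
    by (simp only: sup1)
  also have "\<dots> = (SUP n. \<integral>\<^sup>+s. f s * indicator {exp (- real (Suc n))..exp (real (Suc n))} s \<partial>lborel)"
    by (rule nn_integral_monotone_convergence_SUP)
       (unfold incseq_def le_fun_def, (intro allI impI mult_left_mono im inc; simp), measurable)
  also have "\<dots> = (SUP n. \<integral>\<^sup>+x. f (exp x) * ennreal (exp x) * indicator {- real (Suc n)..real (Suc n)} x \<partial>lborel)"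
    by (simp only: sub)
  also have "\<dots> = (\<integral>\<^sup>+x. (SUP n. f (exp x) * ennreal (exp x) * indicator {- real (Suc n)..real (Suc n)} x) \<partial>lborel)"
    by (rule nn_integral_monotone_convergence_SUP[symmetric])
       (unfold incseq_def le_fun_def, (intro allI impI mult_left_mono im inc; simp), measurable)
  also have "\<dots> = (\<integral>\<^sup>+x. ennreal (exp x) * f (exp x) \<partial>lborel)"
    using sup2[of "\<lambda>x. f (exp x) * ennreal (exp x)"] by (simp only: mult.commute)
  finally show ?thesis .
qed

text \<open>Stated as an image of measures, the change of variables passes at once to integrals, to
  integrability and to almost-everywhere statements.\<close>

lemma distr_exp: "distr (density lborel (\<lambda>x. ennreal (exp x))) borel exp = density lborel (indicator {0::real<..})"
proof (rule measure_eqI)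
  fix A :: "real set" assume "A \<in> sets (distr (density lborel (\<lambda>x. ennreal (exp x))) borel exp)"
  then have [measurable]: "A \<in> sets borel" by simp
  have [measurable]: "exp -` A \<in> sets borel" using measurable_sets[of exp borel borel A] by simp
  have "emeasure (distr (density lborel (\<lambda>x. ennreal (exp x))) borel exp) A = (\<integral>\<^sup>+x. ennreal (exp x) * indicator A (exp x) \<partial>lborel)"
    by (subst emeasure_distr) (auto simp: emeasure_density split: split_indicator intro!: nn_integral_cong)
  also have "\<dots> = (\<integral>\<^sup>+s. indicator A s * indicator {0<..} s \<partial>lborel)"
    by (rule nn_integral_exp_subst[symmetric]) simp
  also have "\<dots> = emeasure (density lborel (indicator {0<..})) A"
    by (subst emeasure_density) (auto simp: mult.commute)
  finally show "emeasure (distr (density lborel (\<lambda>x. ennreal (exp x))) borel exp) A = emeasure (density lborel (indicator {0<..})) A" .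
qed simp

lemma
  fixes f :: "real \<Rightarrow> 'b :: {banach, second_countable_topology}"
  assumes f: "set_borel_measurable lborel {0<..} f"
  shows set_integral_exp_subst: "(LINT s:{0<..}|lborel. f s) = (LINT x|lborel. exp x *\<^sub>R f (exp x))"
    and set_integrable_exp_subst: "set_integrable lborel {0<..} f \<longleftrightarrow> integrable lborel (\<lambda>x. exp x *\<^sub>R f (exp x))"
proof -
  define g where "g s = indicator {0<..} s *\<^sub>R f s" for s
  have g[measurable]: "g \<in> borel_measurable borel" using f by (simp add: set_borel_measurable_def g_def[abs_def])
  have "(LINT s:{0<..}|lborel. f s) = (LINT s|lborel. indicator {0<..} s *\<^sub>R g s)"
    unfolding set_lebesgue_integral_def by (intro Bochner_Integration.integral_cong) (auto simp: g_def indicator_def)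
  also have "\<dots> = (LINT s|density lborel (indicator {0<..}). g s)"
    using integral_density[of g lborel "indicator {0<..}"] by (simp add: ennreal_indicator)
  also have "\<dots> = (LINT x|density lborel (\<lambda>x. ennreal (exp x)). g (exp x))"
    unfolding distr_exp[symmetric] by (rule integral_distr) auto
  also have "\<dots> = (LINT x|lborel. exp x *\<^sub>R g (exp x))"
    by (subst integral_density) auto
  finally show "(LINT s:{0<..}|lborel. f s) = (LINT x|lborel. exp x *\<^sub>R f (exp x))" by (simp add: g_def)
  have "set_integrable lborel {0<..} f \<longleftrightarrow> integrable lborel (\<lambda>s. indicator {0<..} s *\<^sub>R g s)"
    unfolding set_integrable_def by (intro Bochner_Integration.integrable_cong) (auto simp: g_def indicator_def)
  also have "\<dots> \<longleftrightarrow> integrable (density lborel (indicator {0<..})) g"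
    using integrable_density[of g lborel "indicator {0<..}"] by (simp add: ennreal_indicator)
  also have "\<dots> \<longleftrightarrow> integrable (density lborel (\<lambda>x. ennreal (exp x))) (\<lambda>x. g (exp x))"
    unfolding distr_exp[symmetric] by (rule integrable_distr_eq) auto
  also have "\<dots> \<longleftrightarrow> integrable lborel (\<lambda>x. exp x *\<^sub>R g (exp x))"
    by (subst integrable_density) auto
  finally show "set_integrable lborel {0<..} f \<longleftrightarrow> integrable lborel (\<lambda>x. exp x *\<^sub>R f (exp x))" by (simp add: g_def)
qed

lemma AE_exp_subst:
  assumes P: "Measurable.pred borel (\<lambda>s::real. s > 0 \<longrightarrow> P s)"
  shows "(AE s in lborel. s > 0 \<longrightarrow> P s) \<longleftrightarrow> (AE x in lborel. P (exp x))"
proof -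
  define Q where "Q s = (s > 0 \<longrightarrow> P s)" for s
  have Q[measurable]: "Measurable.pred borel Q" using P by (simp add: Q_def[abs_def])
  have "(AE s in lborel. s > 0 \<longrightarrow> P s) \<longleftrightarrow> (AE s in density lborel (indicator {0<..}). Q s)"
    by (subst AE_density) (auto simp: Q_def indicator_def)
  also have "\<dots> \<longleftrightarrow> (AE x in density lborel (\<lambda>x. ennreal (exp x)). Q (exp x))"
    unfolding distr_exp[symmetric] by (subst AE_distr_iff) auto
  also have "\<dots> \<longleftrightarrow> (AE x in lborel. P (exp x))"
    by (subst AE_density) (auto simp: Q_def)
  finally show ?thesis .
qed

text \<open>The weight \<open>exp (x / p)\<close> makes the substitution isometric on \<open>L\<^sup>p\<close>; dilations become translations.\<close>

definition to_line :: "real \<Rightarrow> (real \<Rightarrow> complex) \<Rightarrow> real \<Rightarrow> complex" where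
  "to_line p f x = complex_of_real (exp (x / p)) * f (exp x)"

definition from_line :: "real \<Rightarrow> (real \<Rightarrow> complex) \<Rightarrow> real \<Rightarrow> complex" where
  "from_line p F t = complex_of_real (exp (- (ln t / p))) * F (ln t)"

lemma to_from_line [simp]: "to_line p (from_line p F) x = F x"
  by (simp add: to_line_def from_line_def mult.assoc[symmetric] flip: of_real_mult exp_add)

lemma from_to_line: "t > 0 \<Longrightarrow> from_line p (to_line p f) t = f t"
  by (simp add: to_line_def from_line_def mult.assoc[symmetric] flip: of_real_mult exp_add)

lemma measurable_to_line:
  assumes "set_borel_measurable lborel {0<..} f"
  shows "to_line p f \<in> borel_measurable borel"
proof -
  have [measurable]: "(\<lambda>s. indicator {0<..} s *\<^sub>R f s) \<in> borel_measurable borel"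
    using assms by (simp add: set_borel_measurable_def)
  have "(\<lambda>x. indicator {0<..} (exp x) *\<^sub>R f (exp x)) \<in> borel_measurable borel" by measurable
  then have [measurable]: "(\<lambda>x. f (exp x)) \<in> borel_measurable borel" by simp
  show ?thesis unfolding to_line_def by measurable
qed

lemma measurable_from_line:
  assumes [measurable]: "F \<in> borel_measurable borel"
  shows "set_borel_measurable lborel {0<..} (from_line p F)"
  unfolding set_borel_measurable_def from_line_def by measurable

lemma to_line_Lp:
  assumes "set_borel_measurable lborel {0<..} f" "p \<ge> 1"
  shows "f \<in> Lp_plus p \<longleftrightarrow> to_line p f \<in> Lp p" "Lp_norm p f = Lnorm p (to_line p f)"
proof -
  have m: "set_borel_measurable lborel {0<..} (\<lambda>t. norm (f t) powr p)"
  proof -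
    have [measurable]: "(\<lambda>s. indicator {0<..} s *\<^sub>R f s) \<in> borel_measurable borel"
      using assms by (simp add: set_borel_measurable_def)
    have "(\<lambda>s. norm (indicator {0<..} s *\<^sub>R f s) powr p) \<in> borel_measurable borel" by measurable
    also have "(\<lambda>s. norm (indicator {0<..} s *\<^sub>R f s) powr p) = (\<lambda>s. indicator {0<..} s *\<^sub>R norm (f s) powr p)"
      using assms(2) by (auto simp: indicator_def)
    finally show ?thesis by (simp add: set_borel_measurable_def)
  qed
  have eq: "exp x * norm (f (exp x)) powr p = norm (to_line p f x) powr p" for x
    using assms(2) by (simp add: to_line_def norm_mult powr_mult exp_powr_real)
  show "f \<in> Lp_plus p \<longleftrightarrow> to_line p f \<in> Lp p"
    using assms set_integrable_exp_subst[OF m] measurable_to_line[OF assms(1)] by (simp add: Lp_plus_def Lp_def eq)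
  show "Lp_norm p f = Lnorm p (to_line p f)"
    using set_integral_exp_subst[OF m] by (simp add: Lp_norm_def Lnorm_def eq)
qed

lemma Lp_plus_measurable: "f \<in> Lp_plus p \<Longrightarrow> set_borel_measurable lborel {0<..} f"
  by (simp add: Lp_plus_def)

lemma from_line_Lp:
  assumes "F \<in> Lp p" "p \<ge> 1"
  shows "from_line p F \<in> Lp_plus p"
proof -
  have "to_line p (from_line p F) = F" by (rule ext) simp
  then show ?thesis using to_line_Lp(1)[OF measurable_from_line[OF Lp_measurable[OF assms(1)]] assms(2), of p] assms by simp
qed

lemma ae_eq_iff_to_line:
  assumes "set_borel_measurable lborel {0<..} f" "set_borel_measurable lborel {0<..} g"
  shows "ae_eq f g \<longleftrightarrow> (AE x in lborel. to_line p f x = to_line p g x)"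
proof -
  have [measurable]: "(\<lambda>s. indicator {0<..} s *\<^sub>R f s) \<in> borel_measurable borel" "(\<lambda>s. indicator {0<..} s *\<^sub>R g s) \<in> borel_measurable borel"
    using assms by (simp_all add: set_borel_measurable_def)
  have "(\<lambda>s. s > 0 \<longrightarrow> f s = g s) = (\<lambda>s. indicator {0<..} s *\<^sub>R f s = indicator {0<..} s *\<^sub>R g s)"
    by (auto simp: indicator_def)
  moreover have "Measurable.pred borel (\<lambda>s. indicator {0<..} s *\<^sub>R f s = indicator {0<..} s *\<^sub>R g s)" by measurable
  ultimately have m: "Measurable.pred borel (\<lambda>s. s > 0 \<longrightarrow> f s = g s)" by (simp only:)
  show ?thesis unfolding ae_eq_def AE_exp_subst[OF m] by (simp add: to_line_def)
qed

section \<open>Beta kernels\<close>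

text \<open>Under \<open>v = exp (- y)\<close> this becomes the Beta integrand
  \<open>v powr (c - 1) * (1 - v) powr (a - 1)\<close>. Here \<open>a\<close> is the order of a
  fractional integral and \<open>c\<close> the exponential rate; \<open>c = 0\<close>, though not
  integrable, serves as the weight of a Laplace transform.\<close>

definition beta_kernel :: "real \<Rightarrow> real \<Rightarrow> real \<Rightarrow> real" where
  "beta_kernel a c y = (if 0 < y then (1 - exp (- y)) powr (a - 1) * exp (- (c * y)) else 0)"

lemma beta_kernel_nonneg [simp]: "beta_kernel a c y \<ge> 0"
  by (simp add: beta_kernel_def)

lemma beta_kernel_measurable [measurable]: "beta_kernel a c \<in> borel_measurable borel"
  unfolding beta_kernel_def by measurable

lemma nn_integral_Beta:
  assumes "a > 0" "b > (0::real)"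
  shows "(\<integral>\<^sup>+t. ennreal (t powr (a - 1) * (1 - t) powr (b - 1)) * indicator {0..1} t \<partial>lborel) = ennreal (Beta a b)"
proof -
  have "(\<integral>\<^sup>+t. ennreal (indicator {0..1} t * (t powr (a - 1) * (1 - t) powr (b - 1))) \<partial>lborel) = ennreal (Beta a b)"
    using nn_integral_has_integral_lebesgue[OF _ has_integral_Beta_real[OF assms]] by simp
  then show ?thesis by (simp add: ennreal_mult' mult.commute ennreal_indicator)
qed

lemma nn_integral_beta_kernel:
  assumes "a > 0" "c > 0"
  shows "(\<integral>\<^sup>+y. ennreal (beta_kernel a c y) \<partial>lborel) = ennreal (Beta a c)"
proof -
  define f where "f t = ennreal (t powr (c - 1) * (1 - t) powr (a - 1)) * indicator {0..1} t" for t :: real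
  have [measurable]: "f \<in> borel_measurable borel" unfolding f_def by measurable
  have "ennreal (Beta a c) = (\<integral>\<^sup>+t. f t \<partial>lborel)"
    unfolding f_def using nn_integral_Beta[OF assms(2,1)] by (simp add: Beta_commute)
  also have "\<dots> = (\<integral>\<^sup>+t. f t * indicator {0<..} t \<partial>lborel)"
    by (intro nn_integral_cong) (auto simp: f_def indicator_def)
  also have "\<dots> = (\<integral>\<^sup>+x. ennreal (exp x) * f (exp x) \<partial>lborel)"
    by (rule nn_integral_exp_subst) measurable
  also have "\<dots> = (\<integral>\<^sup>+x. ennreal (exp (-x)) * f (exp (-x)) \<partial>lborel)"
    using nn_integral_real_affine[of "\<lambda>x. ennreal (exp x) * f (exp x)" "-1" 0] by simp
  also have "\<dots> = (\<integral>\<^sup>+y. ennreal (beta_kernel a c y) \<partial>lborel)"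
  proof (intro nn_integral_cong)
    fix y :: real
    consider "y > 0" | "y = 0" | "y < 0" by linarith
    then show "ennreal (exp (-y)) * f (exp (-y)) = ennreal (beta_kernel a c y)"
    proof cases
      case 1
      have "exp (-y) * (exp (-y) powr (c - 1) * (1 - exp (-y)) powr (a - 1)) = beta_kernel a c y"
        using 1 by (simp add: beta_kernel_def exp_powr_real mult.assoc[symmetric] exp_add[symmetric] algebra_simps)
      then show ?thesis using 1 by (simp add: f_def ennreal_mult'[symmetric])
    qed (auto simp: f_def beta_kernel_def)
  qed
  finally show ?thesis by simp
qed

lemma integrable_beta_kernel:
  assumes "a > 0" "c > 0"
  shows "integrable lborel (beta_kernel a c)" "(LINT y|lborel. beta_kernel a c y) = Beta a c"
proof -
  have "Beta a c \<ge> 0" using assms by (simp add: Beta_def)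
  then have "has_bochner_integral lborel (beta_kernel a c) (Beta a c)"
    using nn_integral_beta_kernel[OF assms] by (intro has_bochner_integral_nn_integral) auto
  then show "integrable lborel (beta_kernel a c)" "(LINT y|lborel. beta_kernel a c y) = Beta a c"
    by (auto simp: has_bochner_integral_iff)
qed

lemma power_le_exp:
  fixes y c :: real
  assumes "c > 0"
  obtains C where "\<And>y. y \<ge> 0 \<Longrightarrow> y ^ j \<le> C * exp (c * y)" "C \<ge> 0"
proof (cases "j = 0")
  case True
  then show ?thesis using that[of 1] assms by simp
next
  case False
  \<comment> \<open>With this scale the j-th power of \<open>exp (y / d)\<close> is exactly
    \<open>exp (c * y)\<close>; the constant \<open>d ^ j\<close> then comes from
    \<open>y / d \<le> exp (y / d)\<close>.\<close>
  define d where "d = real j / c"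
  have d: "d > 0" using assms False by (simp add: d_def)
  show ?thesis
  proof (rule that[of "d ^ j"])
    fix y :: real assume y: "y \<ge> 0"
    have "y / d \<le> exp (y / d)" using exp_ge_add_one_self[of "y / d"] by linarith
    then have "(y / d) ^ j \<le> exp (y / d) ^ j" using y d by (intro power_mono) auto
    also have "\<dots> = exp (c * y)" using False assms by (simp add: exp_of_nat_mult[symmetric] d_def)
    finally show "y ^ j \<le> d ^ j * exp (c * y)" using d by (simp add: power_divide field_simps)
  qed (use d in auto)
qed

lemma beta_kernel_times_exp: "exp (d * y) * beta_kernel a c y = beta_kernel a (c - d) y"
  by (auto simp: beta_kernel_def left_diff_distrib exp_diff exp_minus field_simps)

lemma integrable_beta_kernel_moment:
  assumes "a > 0" "c > 0"
  shows "integrable lborel (\<lambda>y. y ^ j * beta_kernel a c y)"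
proof -
  \<comment> \<open>Half of the rate pays for the power of y, the other half keeps the kernel
    integrable.\<close>
  obtain C where C: "\<And>y. y \<ge> 0 \<Longrightarrow> y ^ j \<le> C * exp ((c/2) * y)" "C \<ge> 0"
    using power_le_exp[of "c/2" j] assms by auto
  show ?thesis
  proof (rule Bochner_Integration.integrable_bound)
    show "integrable lborel (\<lambda>y. C * beta_kernel a (c/2) y)" using integrable_beta_kernel(1)[of a "c/2"] assms by simp
    show "AE y in lborel. norm (y ^ j * beta_kernel a c y) \<le> norm (C * beta_kernel a (c/2) y)"
    proof (rule AE_I2)
      fix y :: real
      show "norm (y ^ j * beta_kernel a c y) \<le> norm (C * beta_kernel a (c/2) y)"
      proof (cases "y > 0")
        case True
        have "y ^ j * beta_kernel a c y \<le> (C * exp ((c/2) * y)) * beta_kernel a c y"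
          using C(1)[of y] True by (intro mult_right_mono) auto
        also have "\<dots> = C * beta_kernel a (c/2) y" 
          unfolding mult.assoc beta_kernel_times_exp by simp
        finally show ?thesis using True C(2) by simp
      qed (simp add: beta_kernel_def)
    qed
  qed measurable
qed

lemma isCont_beta_kernel:
  assumes "y \<noteq> 0"
  shows "isCont (beta_kernel a c) y"
proof (cases "y > 0")
  case True
  have "isCont (\<lambda>y. (1 - exp (- y)) powr (a - 1) * exp (- (c * y))) y"
    using True by (intro continuous_intros) auto
  moreover have "eventually (\<lambda>z. z > 0) (nhds y)"
    using True by (intro eventually_nhds_in_open[of "{0<..}", simplified]) auto
  then have "eventually (\<lambda>z. beta_kernel a c z = (1 - exp (- z)) powr (a - 1) * exp (- (c * z))) (nhds y)"
    by eventually_elim (simp add: beta_kernel_def)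
  ultimately show ?thesis by (subst isCont_cong)
next
  case False
  then have "eventually (\<lambda>z. z < 0) (nhds y)"
    using assms by (intro eventually_nhds_in_open[of "{..<0}", simplified]) auto
  then have "eventually (\<lambda>z. beta_kernel a c z = 0) (nhds y)"
    by eventually_elim (simp add: beta_kernel_def)
  then show ?thesis by (subst isCont_cong) auto
qed

lemma smooth_kernel_beta:
  assumes "a > 0" "c > 0" "b \<ge> 0"
  shows "smooth_kernel (\<lambda>y. b * beta_kernel a c y)"
proof
  show "integrable lborel (\<lambda>y. y ^ j * (b * beta_kernel a c y))" for j
    using integrable_mult_right[OF integrable_beta_kernel_moment[OF assms(1,2), of j], of b] by (simp add: mult_ac)
  show "isCont (\<lambda>y. b * beta_kernel a c y) y" if "y \<noteq> 0" for y
    using isCont_beta_kernel[OF that] by (intro continuous_intros)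
qed (use assms in auto)

section \<open>Laplace transform of the beta kernel\<close>

lemma integrable_laplace_beta_kernel:
  assumes "a > 0" "Re z > 0"
  shows "integrable lborel (\<lambda>y. complex_of_real y ^ j * (exp (- (z * of_real y)) * of_real (beta_kernel a 0 y)))"
proof (rule Bochner_Integration.integrable_bound[OF integrable_beta_kernel_moment[OF assms, of j]])
  show "AE y in lborel. norm (complex_of_real y ^ j * (exp (- (z * of_real y)) * of_real (beta_kernel a 0 y))) \<le> norm (y ^ j * beta_kernel a (Re z) y)"
  proof (rule AE_I2)
    fix y
    have "beta_kernel a (Re z) y = exp (- Re z * y) * beta_kernel a 0 y" unfolding beta_kernel_times_exp by simp
    then show "norm (complex_of_real y ^ j * (exp (- (z * of_real y)) * of_real (beta_kernel a 0 y))) \<le> norm (y ^ j * beta_kernel a (Re z) y)"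
      by (simp add: norm_mult norm_power abs_mult flip: power_abs)
  qed
qed measurable

lemma has_field_derivative_laplace_beta_kernel:
  assumes a: "a > 0" and z: "Re z > 0"
  shows "((\<lambda>z. LINT y|lborel. exp (- (z * of_real y)) * of_real (beta_kernel a 0 y)) has_field_derivative
    (LINT y|lborel. - (of_real y * (exp (- (z * of_real y)) * of_real (beta_kernel a 0 y))))) (at z)"
proof -
  define w where "w y = complex_of_real (beta_kernel a 0 y)" for y
  define L where "L z = (LINT y|lborel. exp (- (z * of_real y)) * w y)" for z
  define D where "D = (LINT y|lborel. - (of_real y * (exp (- (z * of_real y)) * w y)))"
  \<comment> \<open>An increment with \<open>norm h < r\<close> costs at most
    \<open>exp (r * y)\<close> in the Taylor remainder, which leaves the rate
    \<open>Re z - r = r\<close>, where the second moment is still finite.\<close>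
  define r where "r = Re z / 2"
  have r: "r > 0" using z by (simp add: r_def)
  define M where "M = (LINT y|lborel. y^2 * beta_kernel a r y)"
  have iL: "integrable lborel (\<lambda>y. exp (- (u * of_real y)) * w y)" if "Re u > 0" for u
    using integrable_laplace_beta_kernel[OF a that, of 0] by (simp add: w_def)
  have iD: "integrable lborel (\<lambda>y. - (of_real y * (exp (- (z * of_real y)) * w y)))"
    using integrable_laplace_beta_kernel[OF a z, of 1] by (simp add: w_def)
  have est: "norm ((L (z + h) - L z) / h - D) \<le> norm h * M" if h: "h \<noteq> 0" "norm h < r" for h
  proof -
    have "\<bar>Re h\<bar> < r" using h(2) abs_Re_le_cmod[of h] by linarith
    then have Re: "Re (z + h) > 0" by (simp add: r_def)
    have eq: "L (z + h) - L z - h * D = (LINT y|lborel. exp (- ((z + h) * of_real y)) * w y - exp (- (z * of_real y)) * w y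
        - h * (- (of_real y * (exp (- (z * of_real y)) * w y))))"
    proof -
      have 3: "(LINT y|lborel. h * (- (of_real y * (exp (- (z * of_real y)) * w y)))) = h * D"
        unfolding D_def by (rule integral_mult_right_zero)
      show ?thesis
        unfolding Bochner_Integration.integral_diff[OF Bochner_Integration.integrable_diff[OF iL[OF Re] iL[OF z]] integrable_mult_right[OF iD]]
          Bochner_Integration.integral_diff[OF iL[OF Re] iL[OF z]] 3 L_def ..
    qed
    have "norm (L (z + h) - L z - h * D) \<le> (LINT y|lborel. norm (exp (- ((z + h) * of_real y)) * w y - exp (- (z * of_real y)) * w y
        - h * (- (of_real y * (exp (- (z * of_real y)) * w y)))))"
      unfolding eq by (rule integral_norm_bound)
    also have "\<dots> \<le> (LINT y|lborel. (norm h)\<^sup>2 * (y^2 * beta_kernel a r y))"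
    proof (rule integral_mono')
      show "integrable lborel (\<lambda>y. (norm h)\<^sup>2 * (y^2 * beta_kernel a r y))"
        using integrable_beta_kernel_moment[OF a r, of 2] by (rule integrable_mult_right)
      fix y :: real
      show "norm (exp (- ((z + h) * of_real y)) * w y - exp (- (z * of_real y)) * w y
          - h * (- (of_real y * (exp (- (z * of_real y)) * w y)))) \<le> (norm h)\<^sup>2 * (y^2 * beta_kernel a r y)"
      proof (cases "y > 0")
        case y: True
        define e where "e = - (h * complex_of_real y)"
        have ne: "norm e = norm h * y" using y by (simp add: e_def norm_mult)
        have "exp (- ((z + h) * of_real y)) = exp (- (z * of_real y)) * exp e"
          unfolding e_def exp_add[symmetric] by (simp add: distrib_right)
        then have "exp (- ((z + h) * of_real y)) * w y - exp (- (z * of_real y)) * w y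
          - h * (- (of_real y * (exp (- (z * of_real y)) * w y))) = exp (- (z * of_real y)) * w y * (exp e - (1 + e))"
        proof -
          have "A * E * W - A * W - h * (- (Y * (A * W))) = A * W * (E - (1 + - (h * Y)))" for A E W Y :: complex
            by (simp add: algebra_simps)
          then show ?thesis using \<open>exp (- ((z + h) * of_real y)) = exp (- (z * of_real y)) * exp e\<close> by (simp only: e_def)
        qed
        also have "norm \<dots> = exp (- Re z * y) * beta_kernel a 0 y * norm (exp e - (1 + e))"
          by (simp add: norm_mult w_def)
        also have "\<dots> \<le> exp (- Re z * y) * beta_kernel a 0 y * (exp (r * y) * (norm h * y)\<^sup>2)"
        proof (intro mult_left_mono)
          have "norm (exp e - (1 + e)) \<le> exp (norm e) * (norm e)\<^sup>2"
            using Taylor_exp_field[of e 1] by (simp add: numeral_2_eq_2)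
          also have "\<dots> \<le> exp (r * y) * (norm h * y)\<^sup>2"
            unfolding ne using h y by (intro mult_right_mono) auto
          finally show "norm (exp e - (1 + e)) \<le> exp (r * y) * (norm h * y)\<^sup>2" .
        qed auto
        also have "\<dots> = (norm h * y)\<^sup>2 * (exp (- r * y) * beta_kernel a 0 y)"
        proof -
          have "exp (- Re z * y) * exp (r * y) = exp (- r * y)" by (simp add: r_def exp_add[symmetric] algebra_simps)
          then show ?thesis by (metis mult.assoc mult.commute)
        qed
        also have "\<dots> = (norm h)\<^sup>2 * (y^2 * beta_kernel a r y)"
          unfolding beta_kernel_times_exp by (simp add: power_mult_distrib)
        finally show ?thesis .
      qed (simp add: w_def beta_kernel_def)
    qed auto
    also have "\<dots> = (norm h)\<^sup>2 * M" by (simp add: M_def)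
    finally have *: "norm (L (z + h) - L z - h * D) \<le> (norm h)\<^sup>2 * M" .
    have "(L (z + h) - L z) / h - D = (L (z + h) - L z - h * D) / h" using h(1) by (simp add: diff_divide_distrib)
    then have "norm ((L (z + h) - L z) / h - D) = norm (L (z + h) - L z - h * D) / norm h" by (simp add: norm_divide)
    also have "\<dots> \<le> (norm h)\<^sup>2 * M / norm h" using * by (rule divide_right_mono) simp
    also have "\<dots> = norm h * M" using h by (simp add: power2_eq_square)
    finally show ?thesis .
  qed
  have "((\<lambda>h. (L (z + h) - L z) / h - D) \<longlongrightarrow> 0) (at 0)"
  proof (rule Lim_null_comparison)
    show "((\<lambda>h::complex. norm h * M) \<longlongrightarrow> 0) (at 0)" by (auto intro!: tendsto_eq_intros)
    show "\<forall>\<^sub>F h in at 0. norm ((L (z + h) - L z) / h - D) \<le> norm h * M"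
      unfolding eventually_at
    proof (intro exI[of _ r] conjI ballI impI r)
      fix h :: complex assume "h \<noteq> 0 \<and> dist h 0 < r"
      then show "norm ((L (z + h) - L z) / h - D) \<le> norm h * M" by (intro est) simp_all
    qed
  qed
  then have "(L has_field_derivative D) (at z)"
    unfolding DERIV_def by (rule LIM_zero_cancel)
  then show ?thesis by (simp add: L_def[abs_def] D_def w_def)
qed

text \<open>For real z > 0 this is the classical Beta integral. Both sides are holomorphic in the
  right half-plane and the positive reals accumulate at 1, so the identity theorem extends it; a
  complex substitution is never performed.\<close>

theorem laplace_beta_kernel:
  assumes a: "a > 0" and z: "Re z > 0"
  shows "(LINT y|lborel. exp (- (z * of_real y)) * of_real (beta_kernel a 0 y)) = Beta (of_real a) z"
proof -
  define S where "S = {z. Re z > 0}"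
  define U where "U = complex_of_real ` {0<..}"
  have nonpos: "z \<notin> \<int>\<^sub>\<le>\<^sub>0" if "Re z > 0" for z :: complex
    using that by (auto elim!: nonpos_Ints_cases)
  have "(LINT y|lborel. exp (- (z * of_real y)) * of_real (beta_kernel a 0 y)) - Beta (of_real a) z = 0"
  proof (rule analytic_continuation[of "\<lambda>z. (LINT y|lborel. exp (- (z * of_real y)) * of_real (beta_kernel a 0 y)) - Beta (of_real a) z" S U 1])
    have "(\<lambda>z. LINT y|lborel. exp (- (z * of_real y)) * of_real (beta_kernel a 0 y)) holomorphic_on S"
      using has_field_derivative_laplace_beta_kernel[OF a]
      unfolding holomorphic_on_def field_differentiable_def S_def
      by (auto intro: has_field_derivative_at_within)
    moreover have "(\<lambda>z. Beta (complex_of_real a) z) holomorphic_on S"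
      using nonpos a by (intro holomorphic_intros) (auto simp: S_def)
    ultimately show "(\<lambda>z. (LINT y|lborel. exp (- (z * of_real y)) * of_real (beta_kernel a 0 y)) - Beta (of_real a) z) holomorphic_on S"
      by (rule holomorphic_on_diff)
    show "open S" unfolding S_def by (rule open_halfspace_Re_gt)
    show "connected S" unfolding S_def by (intro convex_connected convex_halfspace_Re_gt)
    show "U \<subseteq> S" by (auto simp: U_def S_def)
    show "1 \<in> S" by (simp add: S_def)
    show "1 islimpt U"
      unfolding islimpt_approachable
    proof (intro allI impI)
      fix e :: real assume e: "e > 0"
      define x where "x = 1 + e / 2"
      have x: "x > 0" "x \<noteq> 1" "\<bar>x - 1\<bar> < e" using e by (auto simp: x_def)
      have "complex_of_real x \<in> U" unfolding U_def using x(1) by blast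
      moreover have "complex_of_real x \<noteq> 1" using x(2) by simp
      moreover have "dist (complex_of_real x) 1 < e" using x(3) dist_of_real[of x 1, where 'a = complex] by (simp add: dist_real_def)
      ultimately show "\<exists>x'\<in>U. x' \<noteq> 1 \<and> dist x' 1 < e" by blast
    qed
    show "z \<in> S" using z by (simp add: S_def)
    fix u assume "u \<in> U"
    then obtain c where u: "u = of_real c" and c: "c > 0" by (auto simp: U_def)
    have "(LINT y|lborel. exp (- (u * of_real y)) * complex_of_real (beta_kernel a 0 y)) = (LINT y|lborel. complex_of_real (beta_kernel a c y))"
    proof (intro Bochner_Integration.integral_cong refl)
      fix y
      show "exp (- (u * of_real y)) * complex_of_real (beta_kernel a 0 y) = complex_of_real (beta_kernel a c y)"
      proof -
        have "beta_kernel a c y = exp (- c * y) * beta_kernel a 0 y" unfolding beta_kernel_times_exp by simp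
        moreover have "exp (- (u * of_real y)) = complex_of_real (exp (- c * y))" unfolding u exp_of_real[symmetric] by simp
        ultimately show ?thesis by (simp only: of_real_mult)
      qed
    qed
    also have "\<dots> = complex_of_real (Beta a c)" using integrable_beta_kernel(2)[OF a c] by (simp add: integral_complex_of_real)
    also have "\<dots> = Beta (of_real a) u" unfolding u Beta_def by (simp add: Gamma_complex_of_real[symmetric])
    finally show "(LINT y|lborel. exp (- (u * of_real y)) * of_real (beta_kernel a 0 y)) - Beta (of_real a) u = 0" by simp
  qed
  then show ?thesis by simp
qed

lemma fourier_beta_kernel:
  assumes "a > 0" "c > 0"
  shows "fourier (\<lambda>y. complex_of_real (b * beta_kernel a c y)) \<xi> = of_real b * Beta (of_real a) (of_real c + \<i> * of_real \<xi>)"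
proof -
  have "fourier (\<lambda>y. complex_of_real (b * beta_kernel a c y)) \<xi> = 
     (LINT y|lborel. of_real b * (exp (- ((of_real c + \<i> * of_real \<xi>) * of_real y)) * of_real (beta_kernel a 0 y)))"
    unfolding fourier_def
  proof (intro Bochner_Integration.integral_cong refl)
    fix y
    have "exp (- ((of_real c + \<i> * of_real \<xi>) * of_real y)) = iexp (- (\<xi> * y)) * complex_of_real (exp (- c * y))"
      by (simp add: exp_of_real[symmetric] exp_add[symmetric] algebra_simps)
    moreover have "beta_kernel a c y = exp (- c * y) * beta_kernel a 0 y"
      unfolding beta_kernel_times_exp by simp
    ultimately show "iexp (- (\<xi> * y)) * complex_of_real (b * beta_kernel a c y)
        = of_real b * (exp (- ((of_real c + \<i> * of_real \<xi>) * of_real y)) * of_real (beta_kernel a 0 y))"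
      by (simp add: mult_ac)
  qed
  also have "\<dots> = of_real b * Beta (of_real a) (of_real c + \<i> * of_real \<xi>)"
    using laplace_beta_kernel[OF assms(1), of "of_real c + \<i> * of_real \<xi>"] assms(2) by simp
  finally show ?thesis .
qed

text \<open>The substitution \<open>v = (exp y - 1) / (exp w - 1)\<close> maps [0, w] onto [0, 1].
  Raising the second rate by \<open>a\<close> is what makes it work: the exponentials in y then
  collapse to \<open>exp y\<close>, the derivative of \<open>exp y - 1\<close>, and a Beta integral
  with parameters a and b remains.\<close>

lemma conv_beta_kernel:
  assumes a: "a > 0" and b: "b > 0"
  shows "conv (\<lambda>y. complex_of_real (beta_kernel a c y)) (\<lambda>y. complex_of_real (beta_kernel b (c + a) y)) w
    = complex_of_real (Beta a b * beta_kernel (a + b) c w)"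
proof (cases "w > 0")
  case False
  have z: "complex_of_real (beta_kernel a c y) * complex_of_real (beta_kernel b (c + a) (w - y)) = 0" for y
    using False by (auto simp: beta_kernel_def)
  show ?thesis unfolding conv_def z using False by (simp add: beta_kernel_def)
next
  case w: True
  have B: "Beta a b \<ge> 0" using a b by (simp add: Beta_def)
  define M where "M = exp w - 1"
  have M: "M > 0" using w by (simp add: M_def)
  define f where "f v = ennreal (v powr (a - 1) * (1 - v) powr (b - 1))" for v :: real
  have [measurable]: "f \<in> borel_measurable borel" unfolding f_def by measurable
  define g where "g y = (exp y - 1) / M" for y
  have g0: "g 0 = 0" and gw: "g w = 1" using M by (auto simp: g_def M_def)
  have pt: "ennreal (beta_kernel a c y * beta_kernel b (c + a) (w - y))
     = ennreal (beta_kernel (a + b) c w) * (f (g y) * ennreal (exp y / M) * indicator {0..w} y)" for y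
  proof (cases "0 < y \<and> y < w")
    case True
    then have y: "0 < y" "y < w" by auto
    have e1: "(1 - exp (- y)) powr (a - 1) = exp (- ((a - 1) * y)) * (exp y - 1) powr (a - 1)"
    proof -
      have "1 - exp (- y) = exp (- y) * (exp y - 1)" by (simp add: right_diff_distrib exp_add[symmetric])
      then show ?thesis using y by (simp add: powr_mult exp_powr_real mult.commute)
    qed
    have e2: "(1 - exp (- (w - y))) powr (b - 1) = exp (- ((b - 1) * w)) * (exp w - exp y) powr (b - 1)"
    proof -
      have "1 - exp (- (w - y)) = exp (- w) * (exp w - exp y)" by (simp add: right_diff_distrib exp_add[symmetric])
      then show ?thesis using y by (simp add: powr_mult exp_powr_real mult.commute)
    qed
    have e3: "(1 - exp (- w)) powr (a + b - 1) = exp (- ((a + b - 1) * w)) * M powr (a + b - 1)"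
    proof -
      have "1 - exp (- w) = exp (- w) * M" by (simp add: M_def right_diff_distrib exp_add[symmetric])
      then show ?thesis using M by (simp add: powr_mult exp_powr_real mult.commute)
    qed
    have e4: "g y powr (a - 1) = (exp y - 1) powr (a - 1) / M powr (a - 1)"
      unfolding g_def using M y by (simp add: powr_divide)
    have e5: "(1 - g y) powr (b - 1) = (exp w - exp y) powr (b - 1) / M powr (b - 1)"
    proof -
      have "1 - g y = (exp w - exp y) / M" using M by (simp add: g_def M_def field_simps)
      then show ?thesis using M y by (simp add: powr_divide)
    qed
    have e6: "M powr (a + b - 1) = M powr (a - 1) * M powr (b - 1) * M"
    proof -
      have "M powr (a - 1) * M powr (b - 1) * M powr 1 = M powr ((a - 1) + (b - 1) + 1)" by (simp only: powr_add)
      then show ?thesis using M by (simp add: algebra_simps)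
    qed
    have e7: "exp (- ((a - 1) * y)) * exp (- (c * y)) * (exp (- ((b - 1) * w)) * exp (- ((c + a) * (w - y))))
       = exp (- ((a + b - 1) * w)) * exp (- (c * w)) * exp y"
      unfolding exp_add[symmetric] by (simp add: algebra_simps)
    have "beta_kernel a c y * beta_kernel b (c + a) (w - y)
      = (exp (- ((a - 1) * y)) * exp (- (c * y)) * (exp (- ((b - 1) * w)) * exp (- ((c + a) * (w - y)))))
         * ((exp y - 1) powr (a - 1) * (exp w - exp y) powr (b - 1))"
      using y unfolding beta_kernel_def by (simp only: e1 e2 diff_gt_0_iff_gt if_True) (simp add: mult_ac)
    also have "\<dots> = beta_kernel (a + b) c w * (g y powr (a - 1) * (1 - g y) powr (b - 1) * (exp y / M))"
      using w M unfolding e7 beta_kernel_def e4 e5 by (simp add: e3 e6 field_simps)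
    finally have fin: "beta_kernel a c y * beta_kernel b (c + a) (w - y)
      = beta_kernel (a + b) c w * (g y powr (a - 1) * (1 - g y) powr (b - 1) * (exp y / M))" .
    show ?thesis unfolding fin using y M by (simp add: f_def ennreal_mult[symmetric] less_imp_le)
  next
    case False
    \<comment> \<open>At the endpoints both sides are 0: \<open>0 powr x\<close> is 0 for every x,
      and the beta kernel is 0 at the origin by definition.\<close>
    then consider "y \<le> 0" "y \<noteq> 0" | "y = 0" | "y = w" | "y > w" by linarith
    then show ?thesis using w by cases (auto simp: beta_kernel_def f_def g0 gw)
  qed
  have "(\<integral>\<^sup>+y. ennreal (beta_kernel a c y * beta_kernel b (c + a) (w - y)) \<partial>lborel)
      = ennreal (beta_kernel (a + b) c w) * (\<integral>\<^sup>+y. f (g y) * ennreal (exp y / M) * indicator {0..w} y \<partial>lborel)"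
    unfolding pt by (rule nn_integral_cmult) (simp add: g_def)
  also have "(\<integral>\<^sup>+y. f (g y) * ennreal (exp y / M) * indicator {0..w} y \<partial>lborel) = (\<integral>\<^sup>+v. f v * indicator {g 0..g w} v \<partial>lborel)"
    by (rule nn_integral_substitution_aux[symmetric])
       (use M w in \<open>auto simp: g_def intro!: derivative_eq_intros continuous_intros\<close>)
  also have "\<dots> = ennreal (Beta a b)" unfolding f_def g0 gw by (rule nn_integral_Beta[OF a b])
  finally have nn: "(\<integral>\<^sup>+y. ennreal (beta_kernel a c y * beta_kernel b (c + a) (w - y)) \<partial>lborel) = ennreal (Beta a b * beta_kernel (a + b) c w)"
    using B by (simp add: ennreal_mult mult.commute)
  have "(LINT y|lborel. beta_kernel a c y * beta_kernel b (c + a) (w - y)) = Beta a b * beta_kernel (a + b) c w"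
    using B by (subst integral_eq_nn_integral) (auto simp: nn)
  then show ?thesis
    unfolding conv_def of_real_mult[symmetric] integral_complex_of_real by simp
qed

lemma integrable_complex_beta_kernel: "a > 0 \<Longrightarrow> c > 0 \<Longrightarrow> integrable lborel (\<lambda>y. complex_of_real (beta_kernel a c y))"
  using integrable_beta_kernel(1) by simp

lemma cor_beta_kernel_comp:
  assumes "a > 0" "b > 0" "c > 0" "p \<ge> 1" "F \<in> Lp p"
  shows "AE x in lborel. cor (\<lambda>y. complex_of_real (beta_kernel a c y)) (cor (\<lambda>y. complex_of_real (beta_kernel b (c + a) y)) F) x
    = complex_of_real (Beta a b) * cor (\<lambda>y. complex_of_real (beta_kernel (a + b) c y)) F x"
proof -
  have "conv (\<lambda>y. complex_of_real (beta_kernel a c y)) (\<lambda>y. complex_of_real (beta_kernel b (c + a) y))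
    = (\<lambda>w. complex_of_real (Beta a b) * complex_of_real (beta_kernel (a + b) c w))"
    using conv_beta_kernel[OF assms(1,2)] by auto
  with cor_cor[OF integrable_complex_beta_kernel integrable_complex_beta_kernel assms(5,4), of a c b "c + a"] assms
  show ?thesis by (simp add: cor_kernel_cmult)
qed

section \<open>Mellin convolutions on the half-line\<close>

text \<open>A common form, invariant under dilations, for two operators: with \<open>c = 0\<close>
  it is the dual Cesaro operator up to the factor \<open>a\<close>, and with \<open>c\<close> equal
  to a differentiation order it produces weighted Weyl derivatives, see
  \<open>mellin_op_moment\<close>.\<close>

definition mellin_op :: "real \<Rightarrow> real \<Rightarrow> (real \<Rightarrow> complex) \<Rightarrow> real \<Rightarrow> complex" where
  "mellin_op a c f t = (LINT s:{t<..}|lborel. ((1 - t / s) powr (a - 1) * (t / s) powr c / s) *\<^sub>R f s)"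

text \<open>With \<open>t = exp x\<close> and \<open>s = exp (x + y)\<close> the ratio
  \<open>t / s\<close> is \<open>exp (- y)\<close> and the Jacobian cancels \<open>1 / s\<close>.
  Moving the weight \<open>exp (x / p)\<close> past the translation adds \<open>1 / p\<close> to the
  rate.\<close>

lemma to_line_mellin_op:
  assumes f: "set_borel_measurable lborel {0<..} f"
  shows "to_line p (mellin_op a c f) x = cor (\<lambda>y. complex_of_real (beta_kernel a (c + 1 / p) y)) (to_line p f) x"
proof -
  define t where "t = exp x"
  have t: "t > 0" by (simp add: t_def)
  define G where "G s = indicator {t<..} s *\<^sub>R (((1 - t / s) powr (a - 1) * (t / s) powr c / s) *\<^sub>R f s)" for s
  have [measurable]: "(\<lambda>s. indicator {0<..} s *\<^sub>R f s) \<in> borel_measurable borel"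
    using f by (simp add: set_borel_measurable_def)
  have "(\<lambda>s. indicator {t<..} s *\<^sub>R (((1 - t / s) powr (a - 1) * (t / s) powr c / s) *\<^sub>R (indicator {0<..} s *\<^sub>R f s))) \<in> borel_measurable borel"
    by measurable
  also have "(\<lambda>s. indicator {t<..} s *\<^sub>R (((1 - t / s) powr (a - 1) * (t / s) powr c / s) *\<^sub>R (indicator {0<..} s *\<^sub>R f s)))
     = (\<lambda>s. indicator {0<..} s *\<^sub>R G s)"
    using t by (auto simp: G_def indicator_def)
  finally have Gm: "set_borel_measurable lborel {0<..} G" by (simp add: set_borel_measurable_def)
  have "mellin_op a c f t = (LINT s:{0<..}|lborel. G s)"
    unfolding mellin_op_def set_lebesgue_integral_def
    using t by (intro Bochner_Integration.integral_cong refl) (auto simp: G_def indicator_def)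
  also have "\<dots> = (LINT z|lborel. exp z *\<^sub>R G (exp z))" by (rule set_integral_exp_subst[OF Gm])
  also have "\<dots> = (LINT y|lborel. exp (x + y) *\<^sub>R G (exp (x + y)))"
    by (rule integral_shift[symmetric])
  finally have 1: "mellin_op a c f t = (LINT y|lborel. exp (x + y) *\<^sub>R G (exp (x + y)))" .
  have "to_line p (mellin_op a c f) x = (LINT y|lborel. complex_of_real (exp (x / p)) * (exp (x + y) *\<^sub>R G (exp (x + y))))"
    unfolding integral_mult_right_zero to_line_def using 1 by (simp add: t_def)
  also have "\<dots> = (LINT y|lborel. complex_of_real (beta_kernel a (c + 1 / p) y) * to_line p f (x + y))"
  proof (intro Bochner_Integration.integral_cong refl)
    fix y
    show "complex_of_real (exp (x / p)) * (exp (x + y) *\<^sub>R G (exp (x + y))) = complex_of_real (beta_kernel a (c + 1 / p) y) * to_line p f (x + y)"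
    proof (cases "y > 0")
      case True
      have r: "t / exp (x + y) = exp (- y)" by (simp add: t_def exp_add exp_minus field_simps)
      have tl: "t < exp (x + y)" using True by (simp add: t_def)
      have e: "exp (x / p) * (1 - exp (- y)) powr (a - 1) * exp (- y) powr c = beta_kernel a (c + 1 / p) y * exp ((x + y) / p)"
      proof -
        have "exp (x / p) * exp (- y * c) = exp (- ((c + 1 / p) * y)) * exp ((x + y) / p)"
          unfolding exp_add[symmetric] by (simp add: algebra_simps add_divide_distrib)
        then show ?thesis using True by (simp add: beta_kernel_def exp_powr_real mult_ac)
      qed
      have "complex_of_real (exp (x / p)) * (exp (x + y) *\<^sub>R G (exp (x + y)))
        = complex_of_real (exp (x / p) * (1 - exp (- y)) powr (a - 1) * exp (- y) powr c) * f (exp (x + y))"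
        unfolding G_def r using tl by (simp add: scaleR_conv_of_real)
      also have "\<dots> = complex_of_real (beta_kernel a (c + 1 / p) y) * to_line p f (x + y)"
        unfolding e to_line_def by simp
      finally show ?thesis .
    next
      case False
      then show ?thesis by (simp add: G_def beta_kernel_def t_def)
    qed
  qed
  finally show ?thesis by (simp add: cor_def)
qed

lemma dual_cesaro_eq_mellin_op:
  assumes "t > 0"
  shows "dual_cesaro b f t = complex_of_real b * mellin_op b 0 f t"
proof -
  have eq: "indicator {t<..} s *\<^sub>R (((s - t) powr (b - 1) / s powr b) *\<^sub>R f s)
      = indicator {t<..} s *\<^sub>R (((1 - t / s) powr (b - 1) * (t / s) powr 0 / s) *\<^sub>R f s)" for s
  proof (cases "s > t")
    case True
    have "1 - t / s = (s - t) / s" using assms True by (simp add: field_simps)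
    then have "(1 - t / s) powr (b - 1) / s = (s - t) powr (b - 1) / s powr b"
      using assms True by (simp add: powr_divide powr_diff)
    then show ?thesis using assms True by simp
  qed simp
  show ?thesis unfolding dual_cesaro_def mellin_op_def set_lebesgue_integral_def eq scaleR_conv_of_real[of b] by (rule refl)
qed

lemma to_line_dual_cesaro:
  assumes f: "set_borel_measurable lborel {0<..} f"
  shows "to_line p (dual_cesaro b f) x = cor (\<lambda>y. complex_of_real (b * beta_kernel b (1 / p) y)) (to_line p f) x"
  using to_line_mellin_op[OF f, of p b 0 x] dual_cesaro_eq_mellin_op[of "exp x" b f]
  by (simp add: to_line_def cor_kernel_cmult mult.left_commute)

lemma measurable_of_to_line:
  assumes "to_line p f \<in> borel_measurable borel"
  shows "set_borel_measurable lborel {0<..} f"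
proof -
  have "(\<lambda>s. indicator {0<..} s *\<^sub>R from_line p (to_line p f) s) \<in> borel_measurable borel"
    using measurable_from_line[OF assms, of p] by (simp add: set_borel_measurable_def)
  also have "(\<lambda>s. indicator {0<..} s *\<^sub>R from_line p (to_line p f) s) = (\<lambda>s. indicator {0<..} s *\<^sub>R f s)"
  proof
    fix s show "indicator {0<..} s *\<^sub>R from_line p (to_line p f) s = indicator {0<..} s *\<^sub>R f s"
      by (cases "s > 0") (simp_all add: from_to_line)
  qed
  finally show ?thesis by (simp add: set_borel_measurable_def)
qed

lemma Lp_plus_iff: "p \<ge> 1 \<Longrightarrow> f \<in> Lp_plus p \<longleftrightarrow> to_line p f \<in> Lp p"
  using to_line_Lp(1)[of f p] measurable_of_to_line[of p f] Lp_measurable[of "to_line p f" p] Lp_plus_measurable[of f p] by blast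

lemma to_line_lin: "to_line p (\<lambda>t. c * f t - g t) x = c * to_line p f x - to_line p g x"
  by (simp add: to_line_def algebra_simps)

text \<open>\<open>to_line\<close> is isometric with inverse \<open>from_line\<close> on positive
  arguments, so the two halves of invertibility transfer separately: surjectivity in
  \<open>s1\<close>, the lower bound with the same constant in \<open>s2\<close>.\<close>

theorem spectrum_dual_cesaro_Lp:
  assumes b: "b > 0" and p: "p \<ge> 1"
  shows "spectrum_T 0 p (dual_cesaro b) = closure {complex_of_real b * Beta (complex_of_real b) (complex_of_real (1 / p) + \<i> * complex_of_real t) | t. True}"
proof -
  define k where "k y = complex_of_real (b * beta_kernel b (1 / p) y)" for y
  interpret smooth_kernel "\<lambda>y. b * beta_kernel b (1 / p) y"
    by (rule smooth_kernel_beta) (use b p in auto)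
  have range: "range (fourier k) = {complex_of_real b * Beta (complex_of_real b) (complex_of_real (1 / p) + \<i> * complex_of_real t) | t. True}"
    unfolding k_def using fourier_beta_kernel[of b "1/p" b] b p by auto
  have op: "to_line p (\<lambda>t. c * f t - dual_cesaro b f t) = (\<lambda>x. c * to_line p f x - cor k (to_line p f) x)" if "f \<in> Lp_plus p" for f c
    unfolding k_def using to_line_dual_cesaro[OF Lp_plus_measurable[OF that]] by (auto simp: to_line_lin)
  have meas: "set_borel_measurable lborel {0<..} (\<lambda>t. c * f t - dual_cesaro b f t)" if f: "f \<in> Lp_plus p" for f c
  proof (rule measurable_of_to_line)
    show "to_line p (\<lambda>t. c * f t - dual_cesaro b f t) \<in> borel_measurable borel"
      unfolding op[OF f] k_def using f p cor_Lp(2)[OF integrable_kernel, of "to_line p f" p]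
      by (intro borel_measurable_diff borel_measurable_times) (auto simp: Lp_plus_iff intro: Lp_measurable)
  qed
  have "c \<in> spectrum_T 0 p (dual_cesaro b) \<longleftrightarrow> c \<in> closure (range (fourier k))" for c
  proof -
    have s1: "(\<forall>g\<in>Lp_plus p. \<exists>f\<in>Lp_plus p. ae_eq (\<lambda>t. c * f t - dual_cesaro b f t) g) \<longleftrightarrow>
      (\<forall>G\<in>Lp p. \<exists>F\<in>Lp p. AE x in lborel. c * F x - cor k F x = G x)" (is "?L \<longleftrightarrow> ?R")
    proof (intro iffI ballI)
      fix G assume L: ?L and G: "G \<in> Lp p"
      obtain f where f: "f \<in> Lp_plus p" and e: "ae_eq (\<lambda>t. c * f t - dual_cesaro b f t) (from_line p G)"
        using L from_line_Lp[OF G p] by blast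
      have "AE x in lborel. c * to_line p f x - cor k (to_line p f) x = G x"
        using e unfolding ae_eq_iff_to_line[OF meas[OF f] Lp_plus_measurable[OF from_line_Lp[OF G p]], where p = p] op[OF f] by simp
      then show "\<exists>F\<in>Lp p. AE x in lborel. c * F x - cor k F x = G x"
        using f p by (intro bexI[of _ "to_line p f"]) (auto simp: Lp_plus_iff)
    next
      fix g assume R: ?R and g: "g \<in> Lp_plus p"
      obtain F where F: "F \<in> Lp p" and e: "AE x in lborel. c * F x - cor k F x = to_line p g x"
        using R g p by (auto simp: Lp_plus_iff)
      have F': "from_line p F \<in> Lp_plus p" by (rule from_line_Lp[OF F p])
      have tl: "to_line p (from_line p F) = F" by (rule ext) simp
      have "ae_eq (\<lambda>t. c * from_line p F t - dual_cesaro b (from_line p F) t) g"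
        unfolding ae_eq_iff_to_line[OF meas[OF F'] Lp_plus_measurable[OF g], where p = p] op[OF F'] tl by (rule e)
      then show "\<exists>f\<in>Lp_plus p. ae_eq (\<lambda>t. c * f t - dual_cesaro b f t) g" using F' by blast
    qed
    have s2: "(\<forall>f\<in>Lp_plus p. Lp_norm p f \<le> M * Lp_norm p (\<lambda>t. c * f t - dual_cesaro b f t)) \<longleftrightarrow>
      (\<forall>F\<in>Lp p. Lnorm p F \<le> M * Lnorm p (\<lambda>x. c * F x - cor k F x))" (is "?L \<longleftrightarrow> ?R") for M
    proof -
      have n: "Lp_norm p f = Lnorm p (to_line p f)" "Lp_norm p (\<lambda>t. c * f t - dual_cesaro b f t) = Lnorm p (\<lambda>x. c * to_line p f x - cor k (to_line p f) x)"
        if "f \<in> Lp_plus p" for f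
        using to_line_Lp(2)[OF Lp_plus_measurable[OF that] p] to_line_Lp(2)[OF meas[OF that] p] op[OF that] by simp_all
      show ?thesis
      proof (intro iffI ballI)
        fix F assume L: ?L and F: "F \<in> Lp p"
        have F': "from_line p F \<in> Lp_plus p" by (rule from_line_Lp[OF F p])
        have tl: "to_line p (from_line p F) = F" by (rule ext) simp
        show "Lnorm p F \<le> M * Lnorm p (\<lambda>x. c * F x - cor k F x)" using L[rule_format, OF F'] unfolding n[OF F'] tl .
      next
        fix f assume R: ?R and f: "f \<in> Lp_plus p"
        show "Lp_norm p f \<le> M * Lp_norm p (\<lambda>t. c * f t - dual_cesaro b f t)"
          unfolding n[OF f] using R f p by (auto simp: Lp_plus_iff)
      qed
    qed
    show ?thesis
      using spectrum_cor[OF p, of c]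
      unfolding spectrum_T_def mem_Collect_eq Tsp_def Tnorm_def simp_thms if_True s1 s2 k_def[symmetric]
      by (simp only: not_not)
  qed
  then show ?thesis unfolding range by blast
qed

section \<open>Injectivity of correlation with a beta kernel\<close>

lemma AE_lborel_interval_ex:
  assumes "AE x in lborel. P x" "a < (b::real)"
  shows "\<exists>x\<in>{a<..<b}. P x"
proof (rule ccontr)
  assume *: "\<not> (\<exists>x\<in>{a<..<b}. P x)"
  have "AE x in lborel. x \<notin> {a<..<b}" using assms(1) by eventually_elim (use * in blast)
  then have "emeasure lborel {a<..<b} = 0" by (subst (asm) AE_iff_null_sets[symmetric]) auto
  with assms(2) show False by simp
qed

text \<open>The positive and negative parts of R define measures that are finite and equal on all
  half-lines to the right. Such half-lines determine the measure, and a measure determines its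
  density almost everywhere.\<close>

lemma AE_zero_of_tail_integrals:
  fixes R :: "real \<Rightarrow> real"
  assumes [measurable]: "R \<in> borel_measurable borel"
    and i: "\<And>x. integrable lborel (\<lambda>s. indicator {x<..} s * R s)"
    and z: "\<And>x. (LINT s|lborel. indicator {x<..} s * R s) = 0"
  shows "AE s in lborel. R s = 0"
proof -
  have i1: "integrable lborel (\<lambda>s. indicator {x<..} s * max 0 (R s))" for x
    by (rule Bochner_Integration.integrable_bound[OF i[of x]]) (auto simp: indicator_def intro!: AE_I2)
  have i2: "integrable lborel (\<lambda>s. indicator {x<..} s * max 0 (- R s))" for x
    by (rule Bochner_Integration.integrable_bound[OF i[of x]]) (auto simp: indicator_def intro!: AE_I2)
  have m1: "emeasure (density lborel (\<lambda>s. ennreal (max 0 (R s)))) {x<..} = ennreal (LINT s|lborel. indicator {x<..} s * max 0 (R s))" for x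
    using i1[of x] by (subst nn_integral_eq_integral[symmetric]) (auto simp: emeasure_density ennreal_mult' ennreal_indicator mult.commute intro!: nn_integral_cong)
  have m2: "emeasure (density lborel (\<lambda>s. ennreal (max 0 (- R s)))) {x<..} = ennreal (LINT s|lborel. indicator {x<..} s * max 0 (- R s))" for x
    using i2[of x] by (subst nn_integral_eq_integral[symmetric]) (auto simp: emeasure_density ennreal_mult' ennreal_indicator mult.commute intro!: nn_integral_cong)
  have eq: "(LINT s|lborel. indicator {x<..} s * max 0 (R s)) = (LINT s|lborel. indicator {x<..} s * max 0 (- R s))" for x
  proof -
    have "(LINT s|lborel. indicator {x<..} s * max 0 (R s)) - (LINT s|lborel. indicator {x<..} s * max 0 (- R s))
       = (LINT s|lborel. indicator {x<..} s * max 0 (R s) - indicator {x<..} s * max 0 (- R s))"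
      by (rule Bochner_Integration.integral_diff[OF i1 i2, symmetric])
    also have "\<dots> = (LINT s|lborel. indicator {x<..} s * R s)"
      by (intro Bochner_Integration.integral_cong refl) (auto simp: max_def indicator_def)
    finally show ?thesis using z by simp
  qed
  have "density lborel (\<lambda>s. ennreal (max 0 (R s))) = density lborel (\<lambda>s. ennreal (max 0 (- R s)))"
    by (rule measure_eqI_lessThan, simp, simp, simp only: m1 infinity_ennreal_def ennreal_less_top, simp only: m1 m2 eq)
  then have "AE s in lborel. ennreal (max 0 (R s)) = ennreal (max 0 (- R s))"
    by (intro sigma_finite_measure.density_unique[OF lborel.sigma_finite_measure_axioms]) auto
  then show ?thesis
  proof eventually_elim
    case (elim s)
    then have "max 0 (R s) = max 0 (- R s)" by (subst (asm) ennreal_inj) auto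
    then show ?case by (auto simp: max_def split: if_splits)
  qed
qed

text \<open>The kernel of order 1 is a truncated exponential, so the correlation at x is
  \<open>exp (c * x)\<close> times the integral of \<open>exp (- c * s) * F s\<close> over s > x.
  All these tails vanish, and the previous lemma applies to the real and imaginary parts.\<close>

lemma cor_exp_kernel_inj:
  assumes F: "F \<in> Lp p" and p: "p \<ge> 1" and c: "c > 0"
    and zero: "AE x in lborel. cor (\<lambda>y. complex_of_real (beta_kernel 1 c y)) F x = 0"
  shows "AE x in lborel. F x = 0"
proof -
  note [measurable] = Lp_measurable[OF F]
  define H where "H s = complex_of_real (exp (- c * s)) * F s" for s
  have [measurable]: "H \<in> borel_measurable borel" unfolding H_def by measurable
  define k where "k y = complex_of_real (beta_kernel 1 c y)" for y
  have ki: "integrable lborel k" unfolding k_def by (rule integrable_complex_beta_kernel) (use c in auto)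
  have tr: "k y * F (x + y) = complex_of_real (exp (c * x)) * (indicator {x<..} (x + y) *\<^sub>R H (x + y))" for x y
  proof (cases "y > 0")
    case True
    have "exp (- (c * y)) = exp (c * x) * exp (- c * (x + y))"
      unfolding exp_add[symmetric] by (simp add: algebra_simps)
    then show ?thesis using True by (simp add: k_def beta_kernel_def H_def)
  qed (simp add: k_def beta_kernel_def)
  define I where "I x = (LINT s|lborel. indicator {x<..} s *\<^sub>R H s)" for x
  have good: "AE x in lborel. integrable lborel (\<lambda>s. indicator {x<..} s *\<^sub>R H s) \<and> I x = 0"
    using cor_Lp(1)[OF ki F p] zero
  proof eventually_elim
    case (elim x)
    have "integrable lborel (\<lambda>y. complex_of_real (exp (c * x)) * (indicator {x<..} (x + y) *\<^sub>R H (x + y)))"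
      using elim(1) by (simp only: tr)
    then have "integrable lborel (\<lambda>y. indicator {x<..} (x + y) *\<^sub>R H (x + y))"
    proof -
      have "complex_of_real (exp (- (c * x))) * (complex_of_real (exp (c * x)) * z) = z" for z
        by (simp add: mult.assoc[symmetric] flip: of_real_mult exp_add)
      then show ?thesis
        using integrable_mult_right[OF \<open>integrable lborel (\<lambda>y. complex_of_real (exp (c * x)) * (indicator {x<..} (x + y) *\<^sub>R H (x + y)))\<close>,
            of "complex_of_real (exp (- (c * x)))"] by (simp only:)
    qed
    then have 1: "integrable lborel (\<lambda>s. indicator {x<..} s *\<^sub>R H s)"
      by (subst (asm) integrable_shift_iff)
    have "cor k F x = complex_of_real (exp (c * x)) * (LINT y|lborel. indicator {x<..} (x + y) *\<^sub>R H (x + y))"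
      unfolding cor_def tr by (rule integral_mult_right_zero)
    also have "(LINT y|lborel. indicator {x<..} (x + y) *\<^sub>R H (x + y)) = I x"
      unfolding I_def by (rule integral_shift)
    finally have "I x = 0" using elim(2) unfolding k_def[symmetric] by simp
    with 1 show ?case by blast
  qed
  have int: "integrable lborel (\<lambda>s. indicator {x<..} s *\<^sub>R H s)" for x
  proof -
    obtain y where y: "y < x" "integrable lborel (\<lambda>s. indicator {y<..} s *\<^sub>R H s)"
      using AE_lborel_interval_ex[OF good, of "x - 1" x] by auto
    show ?thesis
      by (rule Bochner_Integration.integrable_bound[OF y(2)]) (use y(1) in \<open>auto simp: indicator_def intro!: AE_I2\<close>)
  qed
  \<comment> \<open>The vanishing is known for almost every x. Points \<open>y n\<close> with that
    property approach x from the right, and \<open>I\<close> is right-continuous by dominated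
    convergence.\<close>
  have zeroI: "I x = 0" for x
  proof -
    have "\<exists>y. x < y \<and> y < x + 1 / real (Suc n) \<and> I y = 0" for n
      using AE_lborel_interval_ex[OF good, of x "x + 1 / real (Suc n)"] by auto
    then obtain y where y: "\<And>n. x < y n" "\<And>n. y n < x + 1 / real (Suc n)" "\<And>n. I (y n) = 0" by metis
    have ylim: "y \<longlonglongrightarrow> x"
    proof (rule tendsto_sandwich[OF _ _ tendsto_const])
      show "(\<lambda>n. x + 1 / real (Suc n)) \<longlonglongrightarrow> x" by real_asymp
    qed (use y in \<open>auto intro!: always_eventually less_imp_le\<close>)
    have "(\<lambda>n. I (y n)) \<longlonglongrightarrow> I x"
      unfolding I_def
    proof (rule integral_dominated_convergence)
      show "integrable lborel (\<lambda>s. norm (indicator {x<..} s *\<^sub>R H s))" using int by (rule integrable_norm)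
      show "AE s in lborel. (\<lambda>n. indicator {y n<..} s *\<^sub>R H s) \<longlonglongrightarrow> indicator {x<..} s *\<^sub>R H s"
      proof (rule AE_I2)
        fix s
        show "(\<lambda>n. indicator {y n<..} s *\<^sub>R H s) \<longlonglongrightarrow> indicator {x<..} s *\<^sub>R H s"
        proof (cases "x < s")
          case True
          have "eventually (\<lambda>n. y n < s) sequentially" using order_tendstoD(2)[OF ylim True] .
          then show ?thesis using True by (intro tendsto_eventually) (auto elim!: eventually_mono)
        next
          case False
          then have "\<not> y n < s" for n using y(1)[of n] by linarith
          then show ?thesis using False by simp
        qed
      qed
      show "AE s in lborel. norm (indicator {y n<..} s *\<^sub>R H s) \<le> norm (indicator {x<..} s *\<^sub>R H s)" for n
        using y(1)[of n] by (auto simp: indicator_def intro!: AE_I2)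
    qed auto
    then have "(\<lambda>n. 0) \<longlonglongrightarrow> I x" using y(3) by simp
    then show ?thesis by (simp add: LIMSEQ_const_iff)
  qed
  have "AE s in lborel. Re (H s) = 0"
  proof (rule AE_zero_of_tail_integrals)
    show "integrable lborel (\<lambda>s. indicator {x<..} s * Re (H s))" for x
      using integrable_Re[OF int[of x]] by simp
    show "(LINT s|lborel. indicator {x<..} s * Re (H s)) = 0" for x
      using integral_Re[OF int[of x]] zeroI[of x] by (simp add: I_def)
  qed measurable
  moreover have "AE s in lborel. Im (H s) = 0"
  proof (rule AE_zero_of_tail_integrals)
    show "integrable lborel (\<lambda>s. indicator {x<..} s * Im (H s))" for x
      using integrable_Im[OF int[of x]] by simp
    show "(LINT s|lborel. indicator {x<..} s * Im (H s)) = 0" for x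
      using integral_Im[OF int[of x]] zeroI[of x] by (simp add: I_def)
  qed measurable
  ultimately show ?thesis
  proof eventually_elim
    case (elim s)
    then have "H s = 0" by (simp add: complex_eq_iff)
    then show ?case by (simp add: H_def)
  qed
qed

text \<open>By the composition law, order n + 2 at rate c is order 1 at rate c applied after order n
  + 1 at rate c + 1. Stripping the outer factor raises the rate, hence the induction with c
  arbitrary.\<close>

lemma cor_nat_beta_kernel_inj:
  assumes F: "F \<in> Lp p" and p: "p \<ge> 1" and c: "c > 0"
    and zero: "AE x in lborel. cor (\<lambda>y. complex_of_real (beta_kernel (real (Suc n)) c y)) F x = 0"
  shows "AE x in lborel. F x = 0"
  using c zero
proof (induction n arbitrary: c)
  case 0
  then show ?case using cor_exp_kernel_inj[OF F p 0(1)] by simp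
next
  case (Suc n)
  define G where "G = cor (\<lambda>y. complex_of_real (beta_kernel (real (Suc n)) (c + 1) y)) F"
  have GL: "G \<in> Lp p" unfolding G_def by (rule cor_Lp(2)[OF integrable_complex_beta_kernel F p]) (use Suc in auto)
  have "AE x in lborel. cor (\<lambda>y. complex_of_real (beta_kernel 1 c y)) G x
    = complex_of_real (Beta 1 (real (Suc n))) * cor (\<lambda>y. complex_of_real (beta_kernel (1 + real (Suc n)) c y)) F x"
    unfolding G_def by (rule cor_beta_kernel_comp[OF _ _ Suc(2) p F]) auto
  moreover have "1 + real (Suc n) = real (Suc (Suc n))" by simp
  ultimately have "AE x in lborel. cor (\<lambda>y. complex_of_real (beta_kernel 1 c y)) G x
    = complex_of_real (Beta 1 (real (Suc n))) * cor (\<lambda>y. complex_of_real (beta_kernel (real (Suc (Suc n))) c y)) F x"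
    by (simp only:)
  then have "AE x in lborel. cor (\<lambda>y. complex_of_real (beta_kernel 1 c y)) G x = 0"
    using Suc(3) by eventually_elim simp
  then have "AE x in lborel. G x = 0" by (rule cor_exp_kernel_inj[OF GL p Suc(2)])
  then show ?case using Suc(1)[of "c + 1"] Suc(2) unfolding G_def by simp
qed

text \<open>A kernel of complementary order b, with a + b an integer, is applied to the vanishing
  correlation. Commuting puts the two kernels into the order in which the composition law merges
  them into one of integer order.\<close>

theorem cor_beta_kernel_inj:
  assumes F: "F \<in> Lp p" and p: "p \<ge> 1" and c: "c > 0" and a: "a > 0"
    and zero: "AE x in lborel. cor (\<lambda>y. complex_of_real (beta_kernel a c y)) F x = 0"
  shows "AE x in lborel. F x = 0"
proof -
  define n where "n = nat \<lfloor>a\<rfloor>"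
  define b where "b = real (Suc n) - a"
  have b: "b > 0" unfolding b_def n_def using a by linarith
  have ab: "a + b = real (Suc n)" by (simp add: b_def)
  let ?ka = "\<lambda>y. complex_of_real (beta_kernel a c y)" and ?kb = "\<lambda>y. complex_of_real (beta_kernel b (c + a) y)"
  have ia: "integrable lborel ?ka" and ib: "integrable lborel ?kb"
    by (rule integrable_complex_beta_kernel; use a b c in simp)+
  have aF: "cor ?ka F \<in> Lp p" by (rule cor_Lp(2)[OF ia F p])
  have "cor ?kb (cor ?ka F) x = cor ?kb (\<lambda>x. 0) x" for x
    by (rule cor_AE_cong[OF zero]) (use ib Lp_measurable[OF aF] in auto)
  then have z: "cor ?kb (cor ?ka F) x = 0" for x by (simp add: cor_def)
  have "Beta a b > 0" unfolding Beta_def by (intro divide_pos_pos mult_pos_pos Gamma_real_pos) (use a b in auto)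
  then have "Beta a b \<noteq> 0" by simp
  moreover have "AE x in lborel. cor ?ka (cor ?kb F) x = complex_of_real (Beta a b) * cor (\<lambda>y. complex_of_real (beta_kernel (a + b) c y)) F x"
    by (rule cor_beta_kernel_comp[OF a b c p F])
  ultimately have "AE x in lborel. cor (\<lambda>y. complex_of_real (beta_kernel (real (Suc n)) c y)) F x = 0"
    using cor_commute[OF ia ib F p] unfolding ab z by (auto elim!: eventually_elim2)
  then show ?thesis by (rule cor_nat_beta_kernel_inj[OF F p c])
qed

section \<open>Weyl derivatives of Schwartz functions\<close>

lemma has_vector_derivative_at_iff_quotient:
  fixes f :: "real \<Rightarrow> 'b :: real_normed_vector"
  shows "(f has_vector_derivative f') (at x) \<longleftrightarrow> ((\<lambda>h. (f (x + h) - f x) /\<^sub>R h) \<longlongrightarrow> f') (at 0)"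
proof -
  have "(f has_vector_derivative f') (at x) \<longleftrightarrow> ((\<lambda>h. norm (f (x + h) - f x - h *\<^sub>R f') / norm h) \<longlongrightarrow> 0) (at 0)"
    by (auto simp: has_vector_derivative_def has_derivative_at bounded_linear_scaleR_left)
  also have "\<dots> \<longleftrightarrow> ((\<lambda>h. norm ((f (x + h) - f x) /\<^sub>R h - f')) \<longlongrightarrow> 0) (at 0)"
  proof (rule tendsto_cong)
    show "\<forall>\<^sub>F h in at 0. norm (f (x + h) - f x - h *\<^sub>R f') / norm h = norm ((f (x + h) - f x) /\<^sub>R h - f')"
      unfolding eventually_at_filter
    proof (rule always_eventually, intro allI impI)
      fix h :: real assume h: "h \<noteq> 0"
      have "(f (x + h) - f x) /\<^sub>R h - f' = (f (x + h) - f x - h *\<^sub>R f') /\<^sub>R h"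
        using h by (simp add: scaleR_diff_right)
      then show "norm (f (x + h) - f x - h *\<^sub>R f') / norm h = norm ((f (x + h) - f x) /\<^sub>R h - f')"
        by (simp add: divide_inverse mult.commute)
    qed
  qed
  also have "\<dots> \<longleftrightarrow> ((\<lambda>h. (f (x + h) - f x) /\<^sub>R h) \<longlongrightarrow> f') (at 0)"
    by (subst tendsto_norm_zero_iff) (rule Lim_null[symmetric])
  finally show ?thesis .
qed

text \<open>Under \<open>u = exp x\<close> the integrand is dominated by exponential tails of rate b
  on both sides, written as two reflected kernels of order 1; on the right this is b - 2 \<le> -b,
  that is b \<le> 1. The origin, where both kernels are 0, is discarded as a null set.\<close>

lemma integrable_weyl_majorant:
  assumes "0 < b" "b \<le> 1"
  shows "set_integrable lborel {0<..} (\<lambda>u::real. u powr (b - 1) * (C / (1 + u)\<^sup>2))"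
proof -
  have m: "set_borel_measurable lborel {0<..} (\<lambda>u::real. u powr (b - 1) * (C / (1 + u)\<^sup>2))"
    unfolding set_borel_measurable_def by measurable
  have i0: "integrable lborel (beta_kernel 1 b)" by (rule integrable_beta_kernel) (use assms in auto)
  have "integrable lborel (\<lambda>x. beta_kernel 1 b x + beta_kernel 1 b (- x))"
    using i0 lborel_integrable_real_affine[OF i0, of "-1" 0] by simp
  then have "integrable lborel (\<lambda>x. \<bar>C\<bar> * (beta_kernel 1 b x + beta_kernel 1 b (- x)))" by (rule integrable_mult_right)
  then have "integrable lborel (\<lambda>x. exp x *\<^sub>R (exp x powr (b - 1) * (C / (1 + exp x)\<^sup>2)))"
  proof (rule Bochner_Integration.integrable_bound)
    have "AE x in lborel. x \<noteq> (0::real)" by (rule AE_lborel_singleton)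
    then show "AE x in lborel. norm (exp x *\<^sub>R (exp x powr (b - 1) * (C / (1 + exp x)\<^sup>2))) \<le> norm (\<bar>C\<bar> * (beta_kernel 1 b x + beta_kernel 1 b (- x)))"
    proof eventually_elim
      case (elim x)
      have e: "exp x * exp x powr (b - 1) = exp (b * x)"
        by (simp add: exp_powr_real exp_add[symmetric] algebra_simps)
      have p: "1 + exp x > 0" by (simp add: add_pos_pos)
      have key: "exp (b * x) / (1 + exp x)\<^sup>2 \<le> beta_kernel 1 b x + beta_kernel 1 b (- x)"
      proof (cases "x > 0")
        case True
        have "exp (b * x) / (1 + exp x)\<^sup>2 \<le> exp (b * x) / (exp x)\<^sup>2"
          using p by (intro divide_left_mono power_mono mult_pos_pos zero_less_power) auto
        also have "\<dots> = exp (b * x - 2 * x)" by (simp add: exp_diff exp_double)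
        also have "\<dots> \<le> exp (- (b * x))"
        proof -
          have "2 * (b * x) \<le> 2 * x" using assms(2) True by simp
          then show ?thesis by simp
        qed
        also have "\<dots> \<le> beta_kernel 1 b x + beta_kernel 1 b (- x)" using True by (simp add: beta_kernel_def)
        finally show ?thesis .
      next
        case False
        have "exp (b * x) / (1 + exp x)\<^sup>2 \<le> exp (b * x) / 1"
          using p by (intro divide_left_mono one_le_power mult_pos_pos zero_less_power) auto
        also have "\<dots> \<le> beta_kernel 1 b x + beta_kernel 1 b (- x)" using False elim by (simp add: beta_kernel_def)
        finally show ?thesis .
      qed
      have "norm (exp x *\<^sub>R (exp x powr (b - 1) * (C / (1 + exp x)\<^sup>2))) = \<bar>C\<bar> * (exp x * exp x powr (b - 1) / (1 + exp x)\<^sup>2)"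
        by (simp add: abs_mult mult_ac)
      also have "\<dots> \<le> \<bar>C\<bar> * (beta_kernel 1 b x + beta_kernel 1 b (- x))"
        unfolding e by (intro mult_left_mono key) auto
      also have "\<dots> = norm (\<bar>C\<bar> * (beta_kernel 1 b x + beta_kernel 1 b (- x)))" by simp
      finally show ?case .
    qed
  qed measurable
  then show ?thesis by (rule iffD2[OF set_integrable_exp_subst[OF m]])
qed

text \<open>\<open>D\<close> carries the whole sequence of derivatives as data, one-sided at 0, so
  that no derivative operator has to be evaluated on the boundary or on negative arguments.\<close>

locale schwartz_derivs =
  fixes D :: "nat \<Rightarrow> real \<Rightarrow> complex"
  assumes deriv: "\<And>n t. t \<ge> 0 \<Longrightarrow> (D n has_vector_derivative D (Suc n) t) (at t within {0..})"
    and decay: "\<And>n k. \<exists>C. \<forall>t\<ge>0. t ^ k * norm (D n t) \<le> C"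
begin

lemma deriv_at: "t > 0 \<Longrightarrow> (D n has_vector_derivative D (Suc n) t) (at t)"
  using deriv[of t n] at_within_interior[of t "{0..}"] by simp

lemma cont: "continuous_on {0..} (D n)"
  by (rule continuous_on_vector_derivative[where f' = "D (Suc n)"]) (simp add: deriv)

lemma decay_shifted: "\<exists>C\<ge>0. \<forall>t\<ge>0. norm (D n t) \<le> C / (1 + t) ^ k"
proof -
  obtain C0 where C0: "\<And>t. t \<ge> 0 \<Longrightarrow> norm (D n t) \<le> C0" using decay[of 0 n] by auto
  obtain C1 where C1: "\<And>t. t \<ge> 0 \<Longrightarrow> t ^ k * norm (D n t) \<le> C1" using decay[of k n] by auto
  have nn: "C0 \<ge> 0" "C1 \<ge> 0"
    using order_trans[OF norm_ge_zero C0[of 0]] order_trans[OF norm_ge_zero, of "D n 1" C1] C1[of 1] by simp_all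
  have "norm (D n t) \<le> 2 ^ k * (C0 + C1) / (1 + t) ^ k" if t: "t \<ge> 0" for t
  proof -
    have "(1 + t) ^ k * norm (D n t) \<le> 2 ^ k * (C0 + C1)"
    proof (cases "t \<le> 1")
      case True
      have "(1 + t) ^ k * norm (D n t) \<le> 2 ^ k * C0" using True t C0[OF t] by (intro mult_mono power_mono) auto
      also have "\<dots> \<le> 2 ^ k * (C0 + C1)" using nn by simp
      finally show ?thesis .
    next
      case False
      have "(1 + t) ^ k * norm (D n t) \<le> (2 * t) ^ k * norm (D n t)" using False t by (intro mult_right_mono power_mono) auto
      also have "\<dots> = 2 ^ k * (t ^ k * norm (D n t))" by (simp add: power_mult_distrib)
      also have "\<dots> \<le> 2 ^ k * (C0 + C1)" using C1[OF t] nn by (intro mult_left_mono) auto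
      finally show ?thesis .
    qed
    then show ?thesis using t by (simp add: field_simps)
  qed
  then show ?thesis using nn by (intro exI[of _ "2 ^ k * (C0 + C1)"]) auto
qed

lemma measurable_shifted:
  assumes "t \<ge> 0"
  shows "(\<lambda>u. indicator {0<..} u *\<^sub>R D n (t + u)) \<in> borel_measurable borel"
proof (rule borel_measurable_continuous_on_indicator)
  show "continuous_on {0<..} (\<lambda>u. D n (t + u))"
    by (rule continuous_on_compose2[OF cont]) (use assms in \<open>auto intro!: continuous_intros\<close>)
qed simp

lemma integrable_weyl:
  assumes b: "0 < b" "b \<le> 1" and t: "t \<ge> 0"
  shows "set_integrable lborel {0<..} (\<lambda>u. u powr (b - 1) *\<^sub>R D n (t + u))"
proof -
  obtain C where C: "C \<ge> 0" "\<And>t. t \<ge> 0 \<Longrightarrow> norm (D n t) \<le> C / (1 + t)\<^sup>2" using decay_shifted[of n 2] by auto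
  note [measurable] = measurable_shifted[OF t, of n]
  have "(\<lambda>u. u powr (b - 1) *\<^sub>R (indicator {0<..} u *\<^sub>R D n (t + u))) \<in> borel_measurable borel" by measurable
  also have "(\<lambda>u. u powr (b - 1) *\<^sub>R (indicator {0<..} u *\<^sub>R D n (t + u))) = (\<lambda>u. indicator {0<..} u *\<^sub>R (u powr (b - 1) *\<^sub>R D n (t + u)))"
    by (simp add: mult.commute)
  finally have m: "(\<lambda>u. indicator {0<..} u *\<^sub>R (u powr (b - 1) *\<^sub>R D n (t + u))) \<in> borel_measurable borel" .
  show ?thesis
    unfolding set_integrable_def
  proof (rule Bochner_Integration.integrable_bound[OF integrable_weyl_majorant[OF b, of C, unfolded set_integrable_def]])
    show "AE u in lborel. norm (indicator {0<..} u *\<^sub>R (u powr (b - 1) *\<^sub>R D n (t + u))) \<le> norm (indicator {0<..} u *\<^sub>R (u powr (b - 1) * (C / (1 + u)\<^sup>2)))"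
    proof (rule AE_I2)
      fix u :: real
      show "norm (indicator {0<..} u *\<^sub>R (u powr (b - 1) *\<^sub>R D n (t + u))) \<le> norm (indicator {0<..} u *\<^sub>R (u powr (b - 1) * (C / (1 + u)\<^sup>2)))"
      proof (cases "u > 0")
        case True
        have "norm (D n (t + u)) \<le> C / (1 + (t + u))\<^sup>2" using C(2) t True by simp
        also have "\<dots> \<le> C / (1 + u)\<^sup>2" using C(1) t True by (intro divide_left_mono power_mono mult_pos_pos) auto
        finally have "u powr (b - 1) * norm (D n (t + u)) \<le> u powr (b - 1) * (C / (1 + u)\<^sup>2)" by (rule mult_left_mono) simp
        then show ?thesis using True C(1) by simp
      qed simp
    qed
  qed (use m in simp)
qed

text \<open>The Weyl integral of order b of \<open>D n\<close> without the factor
  \<open>1 / Gamma b\<close>, in the variable \<open>u = s - t\<close>. The dependence on t thereby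
  moves from the singular weight to the smooth factor, and differentiation under the integral
  becomes possible.\<close>

definition weyl_J :: "real \<Rightarrow> nat \<Rightarrow> real \<Rightarrow> complex" where
  "weyl_J b n t = (LINT u:{0<..}|lborel. u powr (b - 1) *\<^sub>R D n (t + u))"

text \<open>\<open>u\<close> is a lower bound of both points, so the Lipschitz constant decays in
  \<open>u\<close>. In \<open>weyl_J_deriv\<close> it dominates the difference quotients
  independently of the increment.\<close>

lemma lipschitz:
  assumes C: "C \<ge> 0" "\<And>t. t \<ge> 0 \<Longrightarrow> norm (D (Suc n) t) \<le> C / (1 + t)\<^sup>2" and u: "0 \<le> u" "u \<le> x" "u \<le> y"
  shows "norm (D n x - D n y) \<le> C / (1 + u)\<^sup>2 * norm (x - y)"
proof (rule differentiable_bound[where S = "{u..}" and f' = "\<lambda>x h. h *\<^sub>R D (Suc n) x"])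
  show "(D n has_derivative (\<lambda>h. h *\<^sub>R D (Suc n) x)) (at x within {u..})" if "x \<in> {u..}" for x
    using has_vector_derivative_within_subset[OF deriv[of x n], of "{u..}"] that u(1) by (auto simp: has_vector_derivative_def)
  show "onorm (\<lambda>h. h *\<^sub>R D (Suc n) x) \<le> C / (1 + u)\<^sup>2" if "x \<in> {u..}" for x
  proof (rule onorm_bound)
    fix h :: real
    have "norm (D (Suc n) x) \<le> C / (1 + x)\<^sup>2" using C(2) that u by simp
    also have "\<dots> \<le> C / (1 + u)\<^sup>2" using C(1) that u by (intro divide_left_mono power_mono mult_pos_pos) auto
    finally show "norm (h *\<^sub>R D (Suc n) x) \<le> C / (1 + u)\<^sup>2 * norm h"
      unfolding norm_scaleR real_norm_def mult.commute[of "\<bar>h\<bar>"] by (rule mult_right_mono) simp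
  qed (use C(1) in simp)
qed (use u in auto)

text \<open>Dominated convergence for difference quotients along arbitrary null sequences of
  increments; the majorant is that of \<open>integrable_weyl_majorant\<close>, supplied by
  \<open>lipschitz\<close>.\<close>

lemma weyl_J_deriv:
  assumes b: "0 < b" "b \<le> 1" and t: "t > 0"
  shows "(weyl_J b n has_vector_derivative weyl_J b (Suc n) t) (at t)"
proof -
  obtain C where C: "C \<ge> 0" "\<And>t. t \<ge> 0 \<Longrightarrow> norm (D (Suc n) t) \<le> C / (1 + t)\<^sup>2" using decay_shifted[of "Suc n" 2] by auto
  define I where "I h = (weyl_J b n (t + h) - weyl_J b n t) /\<^sub>R h" for h
  \<comment> \<open>Increments of modulus below t keep \<open>t + h\<close> positive, where the
    derivatives exist.\<close>
  have "(I \<longlongrightarrow> weyl_J b (Suc n) t) (at 0 within {-t<..<t})"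
    unfolding tendsto_at_iff_sequentially
  proof (intro allI impI)
    fix X assume X: "\<forall>i. X i \<in> {-t<..<t} - {0}" and X0: "X \<longlonglongrightarrow> 0"
    have Xi: "X i \<noteq> 0" "t + X i > 0" for i using X[rule_format, of i] by auto
    define Q where "Q i u = indicator {0<..} u *\<^sub>R (u powr (b - 1) *\<^sub>R ((D n (t + X i + u) - D n (t + u)) /\<^sub>R X i))" for i u
    have IQ: "I (X i) = (LINT u|lborel. Q i u)" for i
    proof -
      note i1 = integrable_weyl[OF b less_imp_le[OF Xi(2)[of i]], of n, unfolded set_integrable_def]
      note i2 = integrable_weyl[OF b less_imp_le[OF t], of n, unfolded set_integrable_def]
      have "I (X i) = (LINT u|lborel. indicator {0<..} u *\<^sub>R (u powr (b - 1) *\<^sub>R D n (t + X i + u)) 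
         - indicator {0<..} u *\<^sub>R (u powr (b - 1) *\<^sub>R D n (t + u))) /\<^sub>R X i"
        unfolding I_def weyl_J_def set_lebesgue_integral_def Bochner_Integration.integral_diff[OF i1 i2] ..
      also have "\<dots> = (LINT u|lborel. (indicator {0<..} u *\<^sub>R (u powr (b - 1) *\<^sub>R D n (t + X i + u)) 
         - indicator {0<..} u *\<^sub>R (u powr (b - 1) *\<^sub>R D n (t + u))) /\<^sub>R X i)"
        by (rule integral_scaleR_right[symmetric])
      also have "\<dots> = (LINT u|lborel. Q i u)"
        by (intro Bochner_Integration.integral_cong refl) (simp add: Q_def scaleR_diff_right mult_ac)
      finally show ?thesis .
    qed
    have "(\<lambda>i. LINT u|lborel. Q i u) \<longlonglongrightarrow> (LINT u|lborel. indicator {0<..} u *\<^sub>R (u powr (b - 1) *\<^sub>R D (Suc n) (t + u)))"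
    proof (rule integral_dominated_convergence)
      show "integrable lborel (\<lambda>u. indicator {0<..} u *\<^sub>R (u powr (b - 1) * (C / (1 + u)\<^sup>2)))"
        using integrable_weyl_majorant[OF b, of C] by (simp only: set_integrable_def)
      show "(\<lambda>u. indicator {0<..} u *\<^sub>R (u powr (b - 1) *\<^sub>R D (Suc n) (t + u))) \<in> borel_measurable lborel"
        using integrable_weyl[OF b less_imp_le[OF t], of "Suc n", unfolded set_integrable_def] by (rule borel_measurable_integrable)
      show "Q i \<in> borel_measurable lborel" for i
      proof -
        note [measurable] = measurable_shifted[OF less_imp_le[OF t], of n] measurable_shifted[OF less_imp_le[OF Xi(2)[of i]], of n]
        have "(\<lambda>u. u powr (b - 1) *\<^sub>R ((indicator {0<..} u *\<^sub>R D n (t + X i + u) - indicator {0<..} u *\<^sub>R D n (t + u)) /\<^sub>R X i)) \<in> borel_measurable borel"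
          by measurable
        also have "(\<lambda>u. u powr (b - 1) *\<^sub>R ((indicator {0<..} u *\<^sub>R D n (t + X i + u) - indicator {0<..} u *\<^sub>R D n (t + u)) /\<^sub>R X i)) = Q i"
          by (rule ext) (simp add: Q_def scaleR_diff_right mult_ac)
        finally show ?thesis by simp
      qed
      show "AE u in lborel. (\<lambda>i. Q i u) \<longlonglongrightarrow> indicator {0<..} u *\<^sub>R (u powr (b - 1) *\<^sub>R D (Suc n) (t + u))"
      proof (rule AE_I2)
        fix u :: real
        show "(\<lambda>i. Q i u) \<longlonglongrightarrow> indicator {0<..} u *\<^sub>R (u powr (b - 1) *\<^sub>R D (Suc n) (t + u))"
        proof (cases "u > 0")
          case True
          have "((\<lambda>h. (D n (t + u + h) - D n (t + u)) /\<^sub>R h) \<longlongrightarrow> D (Suc n) (t + u)) (at 0)"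
            using deriv_at[of "t + u" n] t True by (simp add: has_vector_derivative_at_iff_quotient)
          then have "((\<lambda>h. (D n (t + u + h) - D n (t + u)) /\<^sub>R h) \<circ> X) \<longlonglongrightarrow> D (Suc n) (t + u)"
            using Xi(1) X0 unfolding tendsto_at_iff_sequentially by auto
          then have "(\<lambda>i. (D n (t + X i + u) - D n (t + u)) /\<^sub>R X i) \<longlonglongrightarrow> D (Suc n) (t + u)"
            by (simp add: o_def add_ac)
          then show ?thesis unfolding Q_def by (intro tendsto_intros)
        qed (simp add: Q_def)
      qed
      show "AE u in lborel. norm (Q i u) \<le> indicator {0<..} u *\<^sub>R (u powr (b - 1) * (C / (1 + u)\<^sup>2))" for i
      proof (rule AE_I2)
        fix u :: real
        show "norm (Q i u) \<le> indicator {0<..} u *\<^sub>R (u powr (b - 1) * (C / (1 + u)\<^sup>2))"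
        proof (cases "u > 0")
          case True
          have "norm (D n (t + X i + u) - D n (t + u)) \<le> C / (1 + u)\<^sup>2 * norm ((t + X i + u) - (t + u))"
            by (rule lipschitz[OF C]) (use True t Xi(2)[of i] in auto)
          then have "norm ((D n (t + X i + u) - D n (t + u)) /\<^sub>R X i) \<le> C / (1 + u)\<^sup>2"
            using Xi(1)[of i] by (simp add: divide_inverse[symmetric] pos_divide_le_eq mult.commute[of "inverse \<bar>X i\<bar>"])
          then have "u powr (b - 1) * norm ((D n (t + X i + u) - D n (t + u)) /\<^sub>R X i) \<le> u powr (b - 1) * (C / (1 + u)\<^sup>2)"
            by (rule mult_left_mono) simp
          then show ?thesis using True by (simp add: Q_def abs_mult)
        qed (simp add: Q_def)
      qed
    qed
    then show "(I \<circ> X) \<longlonglongrightarrow> weyl_J b (Suc n) t"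
      by (simp add: o_def IQ weyl_J_def set_lebesgue_integral_def)
  qed
  moreover have "at 0 within {-t<..<t} = at (0::real)" using t by (intro at_within_open) auto
  ultimately show ?thesis unfolding has_vector_derivative_at_iff_quotient I_def by simp
qed

lemma weyl_int_eq:
  assumes t: "t \<ge> 0" and f: "\<And>t. t \<ge> 0 \<Longrightarrow> f t = D 0 t"
  shows "weyl_int b f t = (1 / Gamma b) *\<^sub>R weyl_J b 0 t"
proof -
  have "(LINT s:{t<..}|lborel. ((s - t) powr (b - 1)) *\<^sub>R f s) = (LINT u|lborel. indicator {t<..} (t + u) *\<^sub>R (((t + u) - t) powr (b - 1) *\<^sub>R f (t + u)))"
    unfolding set_lebesgue_integral_def by (rule integral_shift[symmetric])
  also have "\<dots> = weyl_J b 0 t"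
    unfolding weyl_J_def set_lebesgue_integral_def
    by (intro Bochner_Integration.integral_cong refl) (use t f in \<open>auto simp: indicator_def\<close>)
  finally show ?thesis by (simp add: weyl_int_def)
qed

lemma vderiv_weyl_int:
  assumes b: "0 < b" "b \<le> 1" and t: "t > 0" and f: "\<And>t. t \<ge> 0 \<Longrightarrow> f t = D 0 t"
  shows "(vderiv ^^ m) (weyl_int b f) t = (1 / Gamma b) *\<^sub>R weyl_J b m t"
  using t
proof (induction m arbitrary: t)
  case 0
  then show ?case using weyl_int_eq[of t f b] f by simp
next
  case (Suc m)
  have "((\<lambda>t. (1 / Gamma b) *\<^sub>R weyl_J b m t) has_vector_derivative (1 / Gamma b) *\<^sub>R weyl_J b (Suc m) t) (at t)"
    using weyl_J_deriv[OF b Suc(2), of m] by (auto intro!: derivative_eq_intros)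
  \<comment> \<open>The iterate is identified with the formula only on the open half-line, so the
    derivative is transferred along that open set.\<close>
  then have "((vderiv ^^ m) (weyl_int b f) has_vector_derivative (1 / Gamma b) *\<^sub>R weyl_J b (Suc m) t) (at t)"
    by (rule has_vector_derivative_transform_within_open[where S = "{0<..}"]) (use Suc in auto)
  then show ?case by (simp add: vderiv_def[of "(vderiv ^^ m) (weyl_int b f)"] vector_derivative_at)
qed

lemma weyl_der_eq:
  assumes a: "a \<ge> 0" and t: "t > 0" and f: "\<And>t. t \<ge> 0 \<Longrightarrow> f t = D 0 t" and n: "n = nat \<lfloor>a\<rfloor> + 1"
  shows "weyl_der a f t = ((-1) ^ n / Gamma (real n - a)) *\<^sub>R weyl_J (real n - a) n t"
proof -
  have b: "0 < real n - a" "real n - a \<le> 1" unfolding n using a by linarith+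
  have "(vderiv ^^ n) (weyl_int (real n - a) f) t = (1 / Gamma (real n - a)) *\<^sub>R weyl_J (real n - a) n t"
    by (rule vderiv_weyl_int[OF b t]) (rule f)
  then show ?thesis unfolding weyl_der_def Let_def n[symmetric] by simp
qed

end

section \<open>Taylor's formula at infinity and Weyl derivatives as Mellin convolutions\<close>

lemma set_integrable_of_decay:
  fixes f :: "real \<Rightarrow> complex"
  assumes "continuous_on {0<..} f" "\<And>u. u > 0 \<Longrightarrow> norm (f u) \<le> C / (1 + u)\<^sup>2"
  shows "set_integrable lborel {0<..} f"
  unfolding set_integrable_def
proof (rule Bochner_Integration.integrable_bound[OF integrable_inverse_one_plus_square[of C]])
  show "(\<lambda>x. indicat_real {0<..} x *\<^sub>R f x) \<in> borel_measurable lborel"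
    using borel_measurable_continuous_on_indicator[OF _ assms(1)] by simp
  have C: "C \<ge> 0" using order_trans[OF norm_ge_zero assms(2)[of 1]] by simp
  show "AE u in lborel. norm (indicat_real {0<..} u *\<^sub>R f u) \<le> norm (C / (1 + u\<^sup>2))"
  proof (rule AE_I2)
    fix u :: real
    show "norm (indicat_real {0<..} u *\<^sub>R f u) \<le> norm (C / (1 + u\<^sup>2))"
    proof (cases "u > 0")
      case True
      have "norm (f u) \<le> C / (1 + u)\<^sup>2" by (rule assms(2)[OF True])
      also have "\<dots> \<le> C / (1 + u\<^sup>2)"
        using True C by (intro divide_left_mono mult_pos_pos) (auto simp: power2_sum add_pos_nonneg)
      finally show ?thesis using True C by simp
    qed simp
  qed
qed

context schwartz_derivs
begin

text \<open>The weight \<open>s ^ n\<close> makes the n-th derivative commute with dilations; this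
  is the common source from which both f and its weighted Weyl derivative are obtained by beta
  kernels.\<close>

definition moment :: "nat \<Rightarrow> real \<Rightarrow> complex" where
  "moment n s = complex_of_real (s ^ n) * D n s"

lemma power_decay: "\<exists>C\<ge>0. \<forall>t\<ge>0. \<forall>u\<ge>0. u ^ m * norm (D n (t + u)) \<le> C / (1 + u)\<^sup>2"
proof -
  obtain C where C: "C \<ge> 0" "\<And>t. t \<ge> 0 \<Longrightarrow> norm (D n t) \<le> C / (1 + t) ^ (m + 2)" using decay_shifted[of n "m + 2"] by auto
  have "u ^ m * norm (D n (t + u)) \<le> C / (1 + u)\<^sup>2" if t: "t \<ge> 0" and u: "u \<ge> 0" for t u
  proof -
    have "norm (D n (t + u)) \<le> C / (1 + (t + u)) ^ (m + 2)" using C(2) t u by simp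
    also have "\<dots> \<le> C / (1 + u) ^ (m + 2)" using C(1) t u by (intro divide_left_mono power_mono mult_pos_pos) auto
    finally have "u ^ m * norm (D n (t + u)) \<le> (1 + u) ^ m * (C / (1 + u) ^ (m + 2))"
      using u by (intro mult_mono power_mono) auto
    also have "\<dots> = C / (1 + u)\<^sup>2" using u by (simp add: power_add power2_eq_square)
    finally show ?thesis .
  qed
  then show ?thesis using C(1) by blast
qed

lemma cont_shifted: "t \<ge> 0 \<Longrightarrow> continuous_on {0..} (\<lambda>u. D n (t + u))"
  by (rule continuous_on_compose2[OF cont]) (auto intro!: continuous_intros)

lemma integrable_power:
  assumes "t \<ge> 0"
  shows "set_integrable lborel {0<..} (\<lambda>u. u ^ m *\<^sub>R D n (t + u))"
proof -
  obtain C where C: "\<And>u. u \<ge> 0 \<Longrightarrow> u ^ m * norm (D n (t + u)) \<le> C / (1 + u)\<^sup>2" using power_decay[of m n] assms by blast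
  show ?thesis
  proof (rule set_integrable_of_decay[where C = C])
    show "continuous_on {0<..} (\<lambda>u. u ^ m *\<^sub>R D n (t + u))"
      by (intro continuous_intros continuous_on_subset[OF cont_shifted[OF assms]]) auto
  qed (use C in auto)
qed

lemma power_tendsto_0:
  assumes "t \<ge> 0"
  shows "((\<lambda>u. u ^ m *\<^sub>R D n (t + u)) \<longlongrightarrow> 0) at_top"
proof -
  obtain C where C: "\<And>u. u \<ge> 0 \<Longrightarrow> u ^ m * norm (D n (t + u)) \<le> C / (1 + u)\<^sup>2" using power_decay[of m n] assms by blast
  show ?thesis
  proof (rule Lim_null_comparison)
    show "\<forall>\<^sub>F u in at_top. norm (u ^ m *\<^sub>R D n (t + u)) \<le> C / (1 + u)\<^sup>2"
      using eventually_ge_at_top[of 0] by eventually_elim (use C in auto)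
    show "((\<lambda>u. C / (1 + u)\<^sup>2) \<longlongrightarrow> 0) at_top" by real_asymp
  qed
qed

text \<open>The integrand is the derivative of \<open>u ^ m *\<^sub>R D n (t + u)\<close>, which
  vanishes at infinity. The boundary value at 0 carries \<open>0 ^ m\<close>, equal to 1 for m = 0
  and to 0 otherwise.\<close>

lemma integral_power_step:
  assumes t: "t \<ge> 0"
  shows "(LINT u:{0<..}|lborel. (real m * u ^ (m - 1)) *\<^sub>R D n (t + u) + u ^ m *\<^sub>R D (Suc n) (t + u)) = - ((0 ^ m) *\<^sub>R D n t)"
proof -
  define F where "F u = u ^ m *\<^sub>R D n (t + u)" for u
  define f where "f u = (real m * u ^ (m - 1)) *\<^sub>R D n (t + u) + u ^ m *\<^sub>R D (Suc n) (t + u)" for u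
  have cf: "continuous_on {0<..} f"
    unfolding f_def by (intro continuous_intros continuous_on_subset[OF cont_shifted[OF t]]) auto
  have "(LBINT u=ereal 0..\<infinity>. f u) = 0 - F 0"
  proof (rule interval_integral_FTC_integrable[where F = F])
    fix u assume "ereal 0 < ereal u"
    then have u: "u > 0" by simp
    have "((\<lambda>u. t + u) has_real_derivative 1) (at u)" by (auto intro!: derivative_eq_intros)
    then have "((\<lambda>u. t + u) has_vector_derivative 1) (at u)"
      by (simp only: has_real_derivative_iff_has_vector_derivative)
    then have d1: "((\<lambda>u. D n (t + u)) has_vector_derivative D (Suc n) (t + u)) (at u)"
      using vector_diff_chain_at[of "\<lambda>u. t + u" 1 u "D n" "D (Suc n) (t + u)"] deriv_at[of "t + u" n] t u
      by (simp add: o_def)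
    have d2: "((\<lambda>u. u ^ m) has_real_derivative real m * u ^ (m - 1)) (at u)"
      by (auto intro!: derivative_eq_intros)
    show "(F has_vector_derivative f u) (at u)"
      using has_vector_derivative_scaleR[OF d2 d1] unfolding F_def f_def by (simp add: add.commute)
    show "isCont f u" using cf u by (simp add: continuous_on_eq_continuous_at)
  next
    have "set_integrable lborel {0<..} (\<lambda>u. real m *\<^sub>R (u ^ (m - 1) *\<^sub>R D n (t + u)))"
      by (rule set_integrable_scaleR_right) (rule integrable_power[OF t])
    from set_integral_add(1)[OF this integrable_power[OF t, of m "Suc n"]]
    have "set_integrable lborel {0<..} f" unfolding f_def scaleR_scaleR .
    then show "set_integrable lborel (einterval (ereal 0) \<infinity>) f" by (simp add: einterval_eq)
    have "continuous_on {0..} F" unfolding F_def by (intro continuous_intros cont_shifted[OF t])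
    then have "(F \<longlongrightarrow> F 0) (at 0 within {0..})" by (simp add: continuous_on_def)
    then have "(F \<longlongrightarrow> F 0) (at_right 0)" by (rule tendsto_within_subset) auto
    then show "((F \<circ> real_of_ereal) \<longlongrightarrow> F 0) (at_right (ereal 0))" by (simp add: ereal_tendsto_simps)
    show "((F \<circ> real_of_ereal) \<longlongrightarrow> 0) (at_left \<infinity>)"
      using power_tendsto_0[OF t, of m n] by (simp add: ereal_tendsto_simps F_def[abs_def])
  qed simp
  then show ?thesis unfolding interval_integral_to_infinity_eq f_def F_def by simp
qed

text \<open>Taylor's formula with base point at infinity: each partial integration lowers the power
  of u, and only the last one leaves a boundary term.\<close>

lemma integral_taylor:
  assumes t: "t \<ge> 0"
  shows "(LINT u:{0<..}|lborel. u ^ m *\<^sub>R D (Suc m) (t + u)) = ((-1) ^ Suc m * fact m) * D 0 t"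
proof (induction m)
  case 0
  then show ?case using integral_power_step[OF t, of 0 0] by simp
next
  case (Suc m)
  have "(LINT u:{0<..}|lborel. (real (Suc m) * u ^ m) *\<^sub>R D (Suc m) (t + u) + u ^ Suc m *\<^sub>R D (Suc (Suc m)) (t + u)) = 0"
    using integral_power_step[OF t, of "Suc m" "Suc m"] by simp
  moreover have "(LINT u:{0<..}|lborel. (real (Suc m) * u ^ m) *\<^sub>R D (Suc m) (t + u) + u ^ Suc m *\<^sub>R D (Suc (Suc m)) (t + u))
    = (LINT u:{0<..}|lborel. real (Suc m) *\<^sub>R (u ^ m *\<^sub>R D (Suc m) (t + u))) + (LINT u:{0<..}|lborel. u ^ Suc m *\<^sub>R D (Suc (Suc m)) (t + u))"
  proof -
    have "set_integrable lborel {0<..} (\<lambda>u. real (Suc m) *\<^sub>R (u ^ m *\<^sub>R D (Suc m) (t + u)))"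
      by (rule set_integrable_scaleR_right) (rule integrable_power[OF t])
    from set_integral_add(2)[OF this integrable_power[OF t, of "Suc m" "Suc (Suc m)"]]
    show ?thesis unfolding scaleR_scaleR .
  qed
  moreover have "(LINT u:{0<..}|lborel. real (Suc m) *\<^sub>R (u ^ m *\<^sub>R D (Suc m) (t + u))) = real (Suc m) *\<^sub>R ((-1) ^ Suc m * fact m * D 0 t)"
    by (simp only: set_integral_scaleR_right Suc)
  ultimately have "(LINT u:{0<..}|lborel. u ^ Suc m *\<^sub>R D (Suc (Suc m)) (t + u)) = - (real (Suc m) *\<^sub>R ((-1) ^ Suc m * fact m * D 0 t))"
    by (simp add: add_eq_0_iff)
  then show ?case by (simp add: scaleR_conv_of_real algebra_simps)
qed

text \<open>Since \<open>b + a = n\<close>, the weight \<open>s ^ n\<close> cancels exactly the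
  powers of s in the denominators, and a Weyl integral of the n-th derivative remains. For
  \<open>a = 0\<close> and integer order, \<open>integral_taylor\<close> turns it back into the
  function itself.\<close>

lemma mellin_op_moment:
  assumes t: "t > 0" and b: "b = real n - a"
  shows "mellin_op b a (moment n) t = t powr a *\<^sub>R weyl_J b n t"
proof -
  have "t powr a *\<^sub>R weyl_J b n t = (LINT u|lborel. t powr a *\<^sub>R (indicator {0<..} u *\<^sub>R (u powr (b - 1) *\<^sub>R D n (t + u))))"
    unfolding weyl_J_def set_lebesgue_integral_def by (rule integral_scaleR_right[symmetric])
  also have "\<dots> = (LINT u|lborel. indicator {t<..} (t + u) *\<^sub>R (((1 - t / (t + u)) powr (b - 1) * (t / (t + u)) powr a / (t + u)) *\<^sub>R moment n (t + u)))"
  proof (intro Bochner_Integration.integral_cong refl)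
    fix u
    show "t powr a *\<^sub>R (indicator {0<..} u *\<^sub>R (u powr (b - 1) *\<^sub>R D n (t + u)))
      = indicator {t<..} (t + u) *\<^sub>R (((1 - t / (t + u)) powr (b - 1) * (t / (t + u)) powr a / (t + u)) *\<^sub>R moment n (t + u))"
    proof (cases "u > 0")
      case True
      define s where "s = t + u"
      have s: "s > 0" using t True by (simp add: s_def)
      have e1: "(1 - t / s) powr (b - 1) = u powr (b - 1) / s powr (b - 1)"
      proof -
        have "1 - t / s = u / s" using s by (simp add: s_def field_simps)
        then show ?thesis using True s by (simp add: powr_divide)
      qed
      have e2: "(t / s) powr a = t powr a / s powr a" using t s by (simp add: powr_divide)
      have e3: "s ^ n = s powr (b - 1) * s powr a * s"
      proof -
        have "s powr (b - 1) * s powr a * s powr 1 = s powr ((b - 1) + a + 1)" by (simp only: powr_add)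
        then show ?thesis using s by (simp add: b powr_realpow)
      qed
      have "(1 - t / s) powr (b - 1) * (t / s) powr a / s * s ^ n = t powr a * u powr (b - 1)"
        unfolding e1 e2 e3 using s by simp
      then have "complex_of_real ((1 - t / s) powr (b - 1) * (t / s) powr a / s) * complex_of_real (s ^ n) = complex_of_real (t powr a * u powr (b - 1))"
        by (simp only: of_real_mult[symmetric])
      then show ?thesis using True unfolding s_def[symmetric]
        by (simp add: moment_def scaleR_conv_of_real mult.assoc[symmetric] s_def)
    qed simp
  qed
  also have "\<dots> = mellin_op b a (moment n) t"
    unfolding mellin_op_def set_lebesgue_integral_def by (rule integral_shift)
  finally show ?thesis ..
qed

lemma mellin_op_moment_nat:
  assumes t: "t > 0"
  shows "mellin_op (real (Suc m)) 0 (moment (Suc m)) t = ((-1) ^ Suc m * fact m) * D 0 t"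
proof -
  have "weyl_J (real (Suc m)) (Suc m) t = (LINT u:{0<..}|lborel. u ^ m *\<^sub>R D (Suc m) (t + u))"
    unfolding weyl_J_def set_lebesgue_integral_def
    by (intro Bochner_Integration.integral_cong refl) (auto simp: indicator_def powr_realpow)
  then show ?thesis using mellin_op_moment[OF t, of "real (Suc m)" "Suc m" 0] t integral_taylor[of t m] by simp
qed

lemma moment_Lp:
  assumes p: "p \<ge> 1"
  shows "moment n \<in> Lp_plus p"
proof -
  obtain C where C: "C \<ge> 0" "\<forall>t\<ge>0. \<forall>u\<ge>0. u ^ n * norm (D n (t + u)) \<le> C / (1 + u)\<^sup>2" using power_decay[of n n] by auto
  have cm: "continuous_on {0<..} (moment n)"
    unfolding moment_def by (intro continuous_intros continuous_on_subset[OF cont]) auto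
  have "set_integrable lborel {0<..} (\<lambda>t. complex_of_real (norm (moment n t) powr p))"
  proof (rule set_integrable_of_decay)
    show "continuous_on {0<..} (\<lambda>t. complex_of_real (norm (moment n t) powr p))"
      using p by (intro continuous_intros continuous_on_powr' cm) auto
    fix u :: real assume u: "u > 0"
    have "norm (moment n u) powr p \<le> (C / (1 + u)\<^sup>2) powr p"
      using C(2)[rule_format, of 0 u] u p by (intro powr_mono2) (auto simp: moment_def norm_mult norm_power)
    also have "\<dots> = C powr p * (1 / (1 + u)\<^sup>2) powr p" using C(1) by (simp add: powr_divide)
    \<comment> \<open>The base is at most 1, so lowering the exponent from p to 1 enlarges the
      value.\<close>
    also have "\<dots> \<le> C powr p * (1 / (1 + u)\<^sup>2) powr 1"
      using u p by (intro mult_left_mono powr_mono') (auto simp: one_le_power)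
    also have "\<dots> = C powr p / (1 + u)\<^sup>2" using u by simp
    finally show "norm (complex_of_real (norm (moment n u) powr p)) \<le> C powr p / (1 + u)\<^sup>2" by simp
  qed
  then have "integrable lborel (\<lambda>x. complex_of_real (indicator {0<..} x * norm (moment n x) powr p))"
    by (simp add: set_integrable_def scaleR_conv_of_real)
  then have "set_integrable lborel {0<..} (\<lambda>t. norm (moment n t) powr p)"
    by (simp only: set_integrable_def real_scaleR_def complex_of_real_integrable_eq)
  moreover have "set_borel_measurable lborel {0<..} (moment n)"
    using borel_measurable_continuous_on_indicator[OF _ cm] by (simp add: set_borel_measurable_def)
  ultimately show ?thesis by (simp add: Lp_plus_def)
qed

end

definition weyl_gen :: "real \<Rightarrow> (real \<Rightarrow> complex) \<Rightarrow> real \<Rightarrow> complex" where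
  "weyl_gen a f t = t powr a *\<^sub>R weyl_der a f t"

lemma schwartz_plus_iff: "f \<in> schwartz_plus \<longleftrightarrow> (\<exists>D. schwartz_derivs D \<and> (\<forall>t\<ge>0. f t = D 0 t))"
proof -
  have "(\<forall>t\<ge>0. D 0 t = f t) \<longleftrightarrow> (\<forall>t\<ge>0. f t = D 0 t)" for D :: "nat \<Rightarrow> real \<Rightarrow> complex" by metis
  then show ?thesis unfolding schwartz_plus_def schwartz_derivs_def mem_Collect_eq by (simp only: conj_ac)
qed

lemma snorm_eq_Lp_norm: "snorm a p f = Lp_norm p (weyl_gen a f) / Gamma (a + 1)"
proof -
  have "(LINT t:{0<..}|lborel. norm (weyl_der a f t) powr p * t powr (a * p)) = (LINT t:{0<..}|lborel. norm (weyl_gen a f t) powr p)"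
    unfolding set_lebesgue_integral_def
    by (intro Bochner_Integration.integral_cong refl) (auto simp: weyl_gen_def indicator_def powr_mult powr_powr)
  then show ?thesis by (simp add: snorm_def Lp_norm_def)
qed

context schwartz_derivs
begin

lemma weyl_gen_eq_mellin:
  assumes "a \<ge> 0" "t > 0" "\<And>t. t \<ge> 0 \<Longrightarrow> f t = D 0 t" "n = nat \<lfloor>a\<rfloor> + 1" "b = real n - a"
  shows "weyl_gen a f t = complex_of_real ((-1) ^ n / Gamma b) * mellin_op b a (moment n) t"
proof -
  have "weyl_der a f t = ((-1) ^ n / Gamma b) *\<^sub>R weyl_J b n t"
    unfolding assms(5) by (rule weyl_der_eq[OF assms(1,2) _ assms(4)]) (rule assms(3))
  then show ?thesis unfolding mellin_op_moment[OF assms(2,5)] weyl_gen_def by (simp add: scaleR_conv_of_real)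
qed

lemma to_line_weyl_gen:
  assumes a: "a \<ge> 0" and p: "p \<ge> 1" and f: "\<And>t. t \<ge> 0 \<Longrightarrow> f t = D 0 t" and n: "n = nat \<lfloor>a\<rfloor> + 1" and b: "b = real n - a"
  shows "to_line p (weyl_gen a f) = (\<lambda>x. complex_of_real ((-1) ^ n / Gamma b) *
      cor (\<lambda>y. complex_of_real (beta_kernel b (a + 1 / p) y)) (to_line p (moment n)) x)"
proof
  fix x
  have "to_line p (weyl_gen a f) x = complex_of_real ((-1) ^ n / Gamma b) * to_line p (mellin_op b a (moment n)) x"
    using weyl_gen_eq_mellin[OF a exp_gt_zero[of x] f n b] by (simp add: to_line_def)
  also have "to_line p (mellin_op b a (moment n)) x = cor (\<lambda>y. complex_of_real (beta_kernel b (a + 1 / p) y)) (to_line p (moment n)) x"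
    by (rule to_line_mellin_op[OF Lp_plus_measurable[OF moment_Lp[OF p]]])
  finally show "to_line p (weyl_gen a f) x = complex_of_real ((-1) ^ n / Gamma b) *
      cor (\<lambda>y. complex_of_real (beta_kernel b (a + 1 / p) y)) (to_line p (moment n)) x" .
qed

text \<open>Both functions come from \<open>moment n\<close>: the weighted Weyl derivative by order
  b at rate a + 1/p, up to a constant, and f by order n at rate 1/p. As n = a + b, the composition
  law says that order a at rate 1/p leads from the former to the latter.\<close>

lemma weyl_gen_repr:
  assumes a: "a > 0" and p: "p \<ge> 1" and f: "\<And>t. t \<ge> 0 \<Longrightarrow> f t = D 0 t"
  shows "weyl_gen a f \<in> Lp_plus p"
    "AE x in lborel. complex_of_real (Gamma (a + 1)) * to_line p f x
      = cor (\<lambda>y. complex_of_real (a * beta_kernel a (1 / p) y)) (to_line p (weyl_gen a f)) x"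
proof -
  define m where "m = nat \<lfloor>a\<rfloor>"
  define n where "n = Suc m"
  define b where "b = real n - a"
  have b: "b > 0" unfolding b_def n_def m_def using a by linarith
  have n': "n = nat \<lfloor>a\<rfloor> + 1" by (simp add: n_def m_def)
  define X where "X = to_line p (moment n)"
  have XL: "X \<in> Lp p" unfolding X_def using moment_Lp[OF p, of n] p by (simp add: Lp_plus_iff)
  define s where "s = complex_of_real ((-1) ^ n / Gamma b)"
  have tl: "to_line p (weyl_gen a f) = (\<lambda>x. s * cor (\<lambda>y. complex_of_real (beta_kernel b (a + 1 / p) y)) X x)"
    unfolding s_def X_def using to_line_weyl_gen[OF less_imp_le[OF a] p f n' b_def] .
  have i: "integrable lborel (\<lambda>y. complex_of_real (beta_kernel b (a + 1 / p) y))"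
    by (rule integrable_complex_beta_kernel) (use a b p in \<open>auto intro: add_pos_pos\<close>)
  have "to_line p (weyl_gen a f) \<in> Lp p" unfolding tl by (rule Lp_cmult(1)[OF cor_Lp(2)[OF i XL p] p])
  then show "weyl_gen a f \<in> Lp_plus p" using p by (simp add: Lp_plus_iff)
  have 1: "to_line p (mellin_op (real n) 0 (moment n)) x = cor (\<lambda>y. complex_of_real (beta_kernel (real n) (1 / p) y)) X x" for x
    unfolding X_def using to_line_mellin_op[OF Lp_plus_measurable[OF moment_Lp[OF p, of n]], of p "real n" 0 x] by simp
  have 2: "to_line p (mellin_op (real n) 0 (moment n)) x = ((-1) ^ n * fact m) * to_line p f x" for x
    using mellin_op_moment_nat[of "exp x" m] f[of "exp x"] by (simp add: to_line_def n_def)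
  have 3: "cor (\<lambda>y. complex_of_real (beta_kernel (real n) (1 / p) y)) X x = ((-1) ^ n * fact m) * to_line p f x" for x
    using 1 2 by simp
  have "AE x in lborel. cor (\<lambda>y. complex_of_real (beta_kernel a (1 / p) y)) (cor (\<lambda>y. complex_of_real (beta_kernel b (1 / p + a) y)) X) x
    = complex_of_real (Beta a b) * cor (\<lambda>y. complex_of_real (beta_kernel (a + b) (1 / p) y)) X x"
    by (rule cor_beta_kernel_comp[OF a b _ p XL]) (use p in auto)
  then show "AE x in lborel. complex_of_real (Gamma (a + 1)) * to_line p f x
      = cor (\<lambda>y. complex_of_real (a * beta_kernel a (1 / p) y)) (to_line p (weyl_gen a f)) x"
  proof eventually_elim
    case (elim x)
    have ab: "a + b = real n" by (simp add: b_def)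
    have "cor (\<lambda>y. complex_of_real (a * beta_kernel a (1 / p) y)) (to_line p (weyl_gen a f)) x
      = complex_of_real a * (s * (complex_of_real (Beta a b) * (((-1) ^ n * fact m) * to_line p f x)))"
      unfolding tl of_real_mult cor_kernel_cmult cor_cmult using elim unfolding ab 3 by (simp add: add.commute)
    also have "\<dots> = complex_of_real (a * ((-1) ^ n / Gamma b) * Beta a b * ((-1) ^ n * fact m)) * to_line p f x"
      by (simp add: s_def)
    \<comment> \<open>The signs square to 1, and \<open>Gamma b\<close> and
      \<open>Gamma n = fact m\<close> cancel against the Beta function, leaving
      \<open>a * Gamma a\<close>.\<close>
    also have "a * ((-1) ^ n / Gamma b) * Beta a b * ((-1) ^ n * fact m) = Gamma (a + 1)"
    proof -
      have "Gamma (real n) = fact m" using Gamma_fact[of m, where 'a = real] by (simp add: n_def)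
      moreover have "Gamma b \<noteq> 0" using Gamma_real_pos[OF b] by linarith
      moreover have "Gamma (a + 1) = a * Gamma a" by (rule Gamma_plus1) (use a in \<open>auto elim!: nonpos_Ints_cases\<close>)
      moreover have "((-1::real) ^ n) * (-1) ^ n = 1" by (simp flip: power_mult_distrib)
      ultimately show ?thesis unfolding Beta_def ab by (simp add: field_simps)
    qed
    finally show ?case ..
  qed
qed

end

lemma schwartz_plus_repr:
  assumes "f \<in> schwartz_plus" "a > 0" "p \<ge> 1"
  shows "weyl_gen a f \<in> Lp_plus p"
    "AE x in lborel. complex_of_real (Gamma (a + 1)) * to_line p f x
      = cor (\<lambda>y. complex_of_real (a * beta_kernel a (1 / p) y)) (to_line p (weyl_gen a f)) x"
proof -
  obtain D where "schwartz_derivs D" and D: "\<And>t. t \<ge> 0 \<Longrightarrow> f t = D 0 t" using assms(1) unfolding schwartz_plus_iff by blast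
  then interpret schwartz_derivs D by simp
  show "weyl_gen a f \<in> Lp_plus p" by (rule weyl_gen_repr(1)[OF assms(2,3)]) (rule D)
  show "AE x in lborel. complex_of_real (Gamma (a + 1)) * to_line p f x
      = cor (\<lambda>y. complex_of_real (a * beta_kernel a (1 / p) y)) (to_line p (weyl_gen a f)) x"
    by (rule weyl_gen_repr(2)[OF assms(2,3)]) (rule D)
qed

lemma schwartz_plus_measurable:
  assumes "f \<in> schwartz_plus"
  shows "set_borel_measurable lborel {0<..} f"
proof -
  obtain D where "schwartz_derivs D" and D: "\<And>t. t \<ge> 0 \<Longrightarrow> f t = D 0 t" using assms unfolding schwartz_plus_iff by blast
  then interpret schwartz_derivs D by simp
  have "(\<lambda>u. indicator {0<..} u *\<^sub>R f u) = (\<lambda>u. indicator {0<..} u *\<^sub>R D 0 (0 + u))" 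
  proof
    fix u show "indicator {0<..} u *\<^sub>R f u = indicator {0<..} u *\<^sub>R D 0 (0 + u)" using D[of u] by (cases "u > 0") simp_all
  qed
  then show ?thesis using measurable_shifted[of 0 0] by (simp add: set_borel_measurable_def)
qed

text \<open>Linearity of \<open>weyl_der\<close> is not automatic, since integrals and derivatives
  take default values when they do not exist; it is read off from the representation by
  \<open>weyl_J\<close>.\<close>

lemma schwartz_plus_diff:
  assumes "f \<in> schwartz_plus" "g \<in> schwartz_plus"
  shows "(\<lambda>t. f t - g t) \<in> schwartz_plus"
    "a \<ge> 0 \<Longrightarrow> t > 0 \<Longrightarrow> weyl_gen a (\<lambda>t. f t - g t) t = weyl_gen a f t - weyl_gen a g t"
proof -
  obtain D where D: "schwartz_derivs D" and fD: "\<And>t. t \<ge> 0 \<Longrightarrow> f t = D 0 t" using assms(1) unfolding schwartz_plus_iff by blast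
  obtain E where E: "schwartz_derivs E" and gE: "\<And>t. t \<ge> 0 \<Longrightarrow> g t = E 0 t" using assms(2) unfolding schwartz_plus_iff by blast
  interpret D: schwartz_derivs D by fact
  interpret E: schwartz_derivs E by fact
  have DE: "schwartz_derivs (\<lambda>n t. D n t - E n t)"
  proof
    show "((\<lambda>t. D n t - E n t) has_vector_derivative D (Suc n) t - E (Suc n) t) (at t within {0..})" if "t \<ge> 0" for n t
      by (rule has_vector_derivative_diff[OF D.deriv[OF that] E.deriv[OF that]])
    fix n k
    obtain C1 where C1: "\<And>t. t \<ge> 0 \<Longrightarrow> t ^ k * norm (D n t) \<le> C1" using D.decay[of k n] by auto
    obtain C2 where C2: "\<And>t. t \<ge> 0 \<Longrightarrow> t ^ k * norm (E n t) \<le> C2" using E.decay[of k n] by auto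
    have "t ^ k * norm (D n t - E n t) \<le> C1 + C2" if t: "t \<ge> 0" for t
    proof -
      have "t ^ k * norm (D n t - E n t) \<le> t ^ k * (norm (D n t) + norm (E n t))"
        using t by (intro mult_left_mono norm_triangle_ineq4) auto
      also have "\<dots> \<le> C1 + C2" unfolding distrib_left by (intro add_mono C1 C2 t)
      finally show ?thesis .
    qed
    then show "\<exists>C. \<forall>t\<ge>0. t ^ k * norm (D n t - E n t) \<le> C" by blast
  qed
  interpret DE: schwartz_derivs "\<lambda>n t. D n t - E n t" by (rule DE)
  have fg: "f t - g t = D 0 t - E 0 t" if "t \<ge> 0" for t using fD[OF that] gE[OF that] by simp
  show "(\<lambda>t. f t - g t) \<in> schwartz_plus" unfolding schwartz_plus_iff using DE fg by (intro exI[of _ "\<lambda>n t. D n t - E n t"]) auto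
  assume a: "a \<ge> 0" and t: "t > 0"
  define n where "n = nat \<lfloor>a\<rfloor> + 1"
  have b: "0 < real n - a" "real n - a \<le> 1" unfolding n_def using a by linarith+
  have 1: "weyl_der a (\<lambda>t. f t - g t) t = ((-1) ^ n / Gamma (real n - a)) *\<^sub>R DE.weyl_J (real n - a) n t"
    by (rule DE.weyl_der_eq[OF a t _ n_def]) (rule fg)
  have 2: "weyl_der a f t = ((-1) ^ n / Gamma (real n - a)) *\<^sub>R D.weyl_J (real n - a) n t"
    by (rule D.weyl_der_eq[OF a t _ n_def]) (rule fD)
  have 3: "weyl_der a g t = ((-1) ^ n / Gamma (real n - a)) *\<^sub>R E.weyl_J (real n - a) n t"
    by (rule E.weyl_der_eq[OF a t _ n_def]) (rule gE)
  have "DE.weyl_J (real n - a) n t = D.weyl_J (real n - a) n t - E.weyl_J (real n - a) n t"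
    unfolding DE.weyl_J_def D.weyl_J_def E.weyl_J_def scaleR_diff_right
    by (rule set_integral_diff(2)[OF D.integrable_weyl[OF b less_imp_le[OF t]] E.integrable_weyl[OF b less_imp_le[OF t]]])
  then show "weyl_gen a (\<lambda>t. f t - g t) t = weyl_gen a f t - weyl_gen a g t"
    unfolding weyl_gen_def 1 2 3 by (simp add: scaleR_diff_right)
qed

section \<open>Weyl derivatives of exponential sums\<close>

lemma Gamma_integral_scaled:
  assumes b: "b > 0" and c: "c > (0::real)"
  shows "set_integrable lborel {0<..} (\<lambda>u. u powr (b - 1) * exp (- c * u))"
    "(LINT u:{0<..}|lborel. u powr (b - 1) * exp (- c * u)) = Gamma b * c powr (- b)"
proof -
  define f where "f x = ennreal (indicator {0..} x * (x powr (b - 1) / exp x))" for x :: real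
  have [measurable]: "f \<in> borel_measurable borel" unfolding f_def by measurable
  have "(\<integral>\<^sup>+x. f x \<partial>lborel) = ennreal (Gamma b)"
    unfolding f_def using nn_integral_has_integral_lebesgue[OF _ Gamma_integral_real[OF b]] by simp
  then have "ennreal (Gamma b) = ennreal c * (\<integral>\<^sup>+u. f (c * u) \<partial>lborel)"
    using nn_integral_real_affine[of f c 0] c by simp
  also have "\<dots> = (\<integral>\<^sup>+u. ennreal c * f (c * u) \<partial>lborel)" by (rule nn_integral_cmult[symmetric]) simp
  also have "\<dots> = (\<integral>\<^sup>+u. ennreal (c powr b) * ennreal (indicator {0<..} u * (u powr (b - 1) * exp (- c * u))) \<partial>lborel)"
  proof (intro nn_integral_cong)
    fix u
    show "ennreal c * f (c * u) = ennreal (c powr b) * ennreal (indicator {0<..} u * (u powr (b - 1) * exp (- c * u)))"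
    proof (cases "u > 0")
      case True
      have "c * ((c * u) powr (b - 1) / exp (c * u)) = c powr b * (u powr (b - 1) * exp (- c * u))"
        using c True by (simp add: powr_mult powr_diff exp_minus field_simps)
      then show ?thesis using c True by (simp add: f_def ennreal_mult'[symmetric])
    qed (use c in \<open>auto simp: f_def indicator_def zero_le_mult_iff\<close>)
  qed
  also have "\<dots> = ennreal (c powr b) * (\<integral>\<^sup>+u. ennreal (indicator {0<..} u * (u powr (b - 1) * exp (- c * u))) \<partial>lborel)"
    by (rule nn_integral_cmult) measurable
  finally have "ennreal (c powr (- b)) * ennreal (Gamma b) = ennreal (c powr (- b)) * (ennreal (c powr b) * (\<integral>\<^sup>+u. ennreal (indicator {0<..} u * (u powr (b - 1) * exp (- c * u))) \<partial>lborel))"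
    by simp
  moreover have "ennreal (c powr (- b)) * ennreal (c powr b) = 1" using c by (simp add: ennreal_mult'[symmetric] powr_add[symmetric])
  ultimately have "(\<integral>\<^sup>+u. ennreal (indicator {0<..} u * (u powr (b - 1) * exp (- c * u))) \<partial>lborel) = ennreal (c powr (- b)) * ennreal (Gamma b)"
    by (simp only: mult.assoc[symmetric] mult_1_left)
  also have "\<dots> = ennreal (Gamma b * c powr (- b))"
    using Gamma_real_pos[OF b] by (subst ennreal_mult[symmetric]) (auto simp: mult.commute)
  finally have "(\<integral>\<^sup>+u. ennreal (indicator {0<..} u * (u powr (b - 1) * exp (- c * u))) \<partial>lborel) = ennreal (Gamma b * c powr (- b))" .
  then have "has_bochner_integral lborel (\<lambda>u. indicator {0<..} u * (u powr (b - 1) * exp (- c * u))) (Gamma b * c powr (- b))"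
    using Gamma_real_pos[OF b] by (intro has_bochner_integral_nn_integral) auto
  then show "set_integrable lborel {0<..} (\<lambda>u. u powr (b - 1) * exp (- c * u))"
    "(LINT u:{0<..}|lborel. u powr (b - 1) * exp (- c * u)) = Gamma b * c powr (- b)"
    by (simp_all add: has_bochner_integral_iff set_integrable_def set_lebesgue_integral_def)
qed

text \<open>The rates \<open>Suc i\<close> start at 1, so every term decays, including the one with
  index 0.\<close>

lemma schwartz_exp_sum:
  "schwartz_derivs (\<lambda>m t. \<Sum>i\<le>N. A i * complex_of_real ((- real (Suc i)) ^ m * exp (- real (Suc i) * t)))"
proof
  fix m t
  show "((\<lambda>t. \<Sum>i\<le>N. A i * complex_of_real ((- real (Suc i)) ^ m * exp (- real (Suc i) * t))) has_vector_derivative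
     (\<Sum>i\<le>N. A i * complex_of_real ((- real (Suc i)) ^ Suc m * exp (- real (Suc i) * t)))) (at t within {0..})"
  proof (intro has_vector_derivative_sum has_vector_derivative_mult_right has_vector_derivative_of_real)
    fix i
    show "((\<lambda>t. (- real (Suc i)) ^ m * exp (- real (Suc i) * t)) has_real_derivative (- real (Suc i)) ^ Suc m * exp (- real (Suc i) * t)) (at t within {0..})"
      by (auto intro!: derivative_eq_intros)
  qed
next
  fix n k
  have "\<exists>C::real. (\<forall>t\<ge>0. t ^ k \<le> C * exp t) \<and> C \<ge> 0"
  proof (rule power_le_exp[of 1 k])
    fix C :: real assume "\<And>y. 0 \<le> y \<Longrightarrow> y ^ k \<le> C * exp (1 * y)" "0 \<le> C"
    then show ?thesis by (intro exI[of _ C]) simp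
  qed simp
  then obtain C :: real where C': "\<forall>t\<ge>0. t ^ k \<le> C * exp t" and "C \<ge> 0" by (elim exE conjE)
  note C = C'[rule_format] \<open>C \<ge> 0\<close>
  define B where "B = (\<Sum>i\<le>N. norm (A i) * real (Suc i) ^ n * C)"
  have "t ^ k * norm (\<Sum>i\<le>N. A i * complex_of_real ((- real (Suc i)) ^ n * exp (- real (Suc i) * t))) \<le> B" if t: "t \<ge> 0" for t
  proof -
    have "t ^ k * norm (\<Sum>i\<le>N. A i * complex_of_real ((- real (Suc i)) ^ n * exp (- real (Suc i) * t)))
       \<le> t ^ k * (\<Sum>i\<le>N. norm (A i * complex_of_real ((- real (Suc i)) ^ n * exp (- real (Suc i) * t))))"
      using t by (intro mult_left_mono norm_sum) auto
    also have "\<dots> = (\<Sum>i\<le>N. norm (A i) * real (Suc i) ^ n * (t ^ k * exp (- real (Suc i) * t)))"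
      unfolding sum_distrib_left
      by (intro sum.cong refl) (simp only: norm_mult norm_of_real abs_mult power_abs abs_exp_cancel abs_minus_cancel abs_of_nat mult_ac)
    also have "\<dots> \<le> B" unfolding B_def
    proof (intro sum_mono mult_left_mono)
      fix i
      have "real (Suc i) * t \<ge> t" using t by (simp add: distrib_right)
      then have "exp (- real (Suc i) * t) \<le> exp (- t)" unfolding exp_le_cancel_iff by linarith
      then have "t ^ k * exp (- real (Suc i) * t) \<le> C * exp t * exp (- t)"
        using C t by (intro mult_mono) auto
      also have "\<dots> = C" by (simp add: mult.assoc exp_minus)
      finally show "t ^ k * exp (- real (Suc i) * t) \<le> C" .
    qed auto
    finally show ?thesis .
  qed
  then show "\<exists>C. \<forall>t\<ge>0. t ^ k * norm (\<Sum>i\<le>N. A i * complex_of_real ((- real (Suc i)) ^ n * exp (- real (Suc i) * t))) \<le> C" by blast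
qed

text \<open>The function \<open>exp (- r * t)\<close> is an eigenfunction of the Weyl derivative of
  order a with eigenvalue \<open>r powr a\<close>. Dividing the coefficients by these eigenvalues,
  as in \<open>A\<close>, realises every polynomial in \<open>exp (- t)\<close> with the fixed
  weight \<open>t powr a * exp (- t)\<close> in front.\<close>

lemma weyl_gen_exp_sum:
  assumes a: "a > 0"
  obtains \<phi> where "\<phi> \<in> schwartz_plus"
    "\<And>t. t > 0 \<Longrightarrow> weyl_gen a \<phi> t = complex_of_real (t powr a * exp (- t)) * (\<Sum>i\<le>N. c i * complex_of_real (exp (- t)) ^ i)"
proof -
  define A where "A i = c i * complex_of_real (real (Suc i) powr (- a))" for i
  define D where "D m t = (\<Sum>i\<le>N. A i * complex_of_real ((- real (Suc i)) ^ m * exp (- real (Suc i) * t)))" for m t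
  have SD: "schwartz_derivs D" unfolding D_def[abs_def] by (rule schwartz_exp_sum)
  interpret schwartz_derivs D by (rule SD)
  have "D 0 \<in> schwartz_plus" unfolding schwartz_plus_iff using SD by blast
  moreover have "weyl_gen a (D 0) t = complex_of_real (t powr a * exp (- t)) * (\<Sum>i\<le>N. c i * complex_of_real (exp (- t)) ^ i)" if t: "t > 0" for t
  proof -
    define n where "n = nat \<lfloor>a\<rfloor> + 1"
    define b where "b = real n - a"
    have b: "0 < b" unfolding b_def n_def using a by linarith
    have 1: "weyl_der a (D 0) t = ((-1) ^ n / Gamma b) *\<^sub>R weyl_J b n t"
      unfolding b_def by (rule weyl_der_eq[OF less_imp_le[OF a] t _ n_def]) simp
    define B where "B i = A i * complex_of_real ((- real (Suc i)) ^ n * exp (- real (Suc i) * t))" for i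
    have "weyl_J b n t = (LINT u|lborel. (\<Sum>i\<le>N. B i * complex_of_real (indicator {0<..} u * (u powr (b - 1) * exp (- real (Suc i) * u)))))"
      unfolding weyl_J_def set_lebesgue_integral_def
    proof (intro Bochner_Integration.integral_cong refl)
      fix u
      have "exp (- real (Suc i) * (t + u)) = exp (- real (Suc i) * t) * exp (- real (Suc i) * u)" for i
        unfolding exp_add[symmetric] by (simp add: algebra_simps)
      then show "indicator {0<..} u *\<^sub>R (u powr (b - 1) *\<^sub>R D n (t + u)) = (\<Sum>i\<le>N. B i * complex_of_real (indicator {0<..} u * (u powr (b - 1) * exp (- real (Suc i) * u))))"
        unfolding D_def B_def scaleR_conv_of_real sum_distrib_left by (intro sum.cong refl) (simp only: of_real_mult mult_ac)
    qed
    also have "\<dots> = (\<Sum>i\<le>N. LINT u|lborel. B i * complex_of_real (indicator {0<..} u * (u powr (b - 1) * exp (- real (Suc i) * u))))"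
    proof (rule Bochner_Integration.integral_sum)
      fix i
      have "integrable lborel (\<lambda>u. indicator {0<..} u * (u powr (b - 1) * exp (- real (Suc i) * u)))"
        using Gamma_integral_scaled(1)[OF b, of "real (Suc i)"] by (simp add: set_integrable_def)
      then show "integrable lborel (\<lambda>u. B i * complex_of_real (indicator {0<..} u * (u powr (b - 1) * exp (- real (Suc i) * u))))"
        by (intro integrable_mult_right) (simp only: complex_of_real_integrable_eq)
    qed
    also have "\<dots> = (\<Sum>i\<le>N. B i * complex_of_real (Gamma b * real (Suc i) powr (- b)))"
    proof (intro sum.cong refl)
      fix i
      have "(LINT u|lborel. indicator {0<..} u * (u powr (b - 1) * exp (- real (Suc i) * u))) = Gamma b * real (Suc i) powr (- b)"
        using Gamma_integral_scaled(2)[OF b, of "real (Suc i)"] by (simp add: set_lebesgue_integral_def)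
      then show "(LINT u|lborel. B i * complex_of_real (indicator {0<..} u * (u powr (b - 1) * exp (- real (Suc i) * u)))) = B i * complex_of_real (Gamma b * real (Suc i) powr (- b))"
        by (simp only: integral_mult_right_zero integral_complex_of_real)
    qed
    finally have J: "weyl_J b n t = (\<Sum>i\<le>N. B i * complex_of_real (Gamma b * real (Suc i) powr (- b)))" .
    have trm: "complex_of_real ((-1) ^ n / Gamma b) * (B i * complex_of_real (Gamma b * real (Suc i) powr (- b))) = complex_of_real (exp (- t)) * (c i * complex_of_real (exp (- t)) ^ i)" for i
    proof -
      define r where "r = real (Suc i)"
      have r: "r > 0" by (simp add: r_def)
      have e: "exp (- r * t) = exp (- t) * exp (- t) ^ i"
        by (simp add: r_def exp_of_nat_mult[symmetric] exp_add[symmetric] algebra_simps)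
      have g: "Gamma b \<noteq> 0" using Gamma_real_pos[OF b] by linarith
      have "r ^ n = r powr b * r powr a" using r by (simp add: b_def powr_add[symmetric] powr_realpow)
      moreover have "r powr b * r powr (- b) = 1" "r powr a * r powr (- a) = 1" using r by (simp_all add: powr_add[symmetric])
      ultimately have rr: "r ^ n * r powr (- b) * r powr (- a) = 1" by (metis mult.assoc mult.commute mult.left_neutral)
      have "(- 1) ^ n / Gamma b * (r powr (- a) * ((- r) ^ n * exp (- r * t)) * (Gamma b * r powr (- b))) 
         = ((-1) ^ n * (- r) ^ n) * (r powr (- b) * r powr (- a)) * exp (- r * t)" using g by (simp add: field_simps)
      also have "(-1) ^ n * (- r) ^ n = r ^ n" by (simp flip: power_mult_distrib)
      also have "r ^ n * (r powr (- b) * r powr (- a)) * exp (- r * t) = exp (- t) * exp (- t) ^ i"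
        using rr e by (simp add: mult.assoc)
      finally have "complex_of_real ((- 1) ^ n / Gamma b * (r powr (- a) * ((- r) ^ n * exp (- r * t)) * (Gamma b * r powr (- b)))) = complex_of_real (exp (- t) * exp (- t) ^ i)"
        by (simp only:)
      then show ?thesis unfolding B_def A_def r_def[symmetric] of_real_mult of_real_power by (simp only: mult_ac)
    qed
    have "complex_of_real ((-1) ^ n / Gamma b) * weyl_J b n t = complex_of_real (exp (- t)) * (\<Sum>i\<le>N. c i * complex_of_real (exp (- t)) ^ i)"
      by (simp only: J sum_distrib_left trm)
    then show ?thesis
      unfolding weyl_gen_def 1 scaleR_conv_of_real of_real_mult mult.assoc by (simp only:)
  qed
  ultimately show ?thesis by (rule that)
qed

section \<open>Density\<close>

lemma Lnorm_less_of_tendsto: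
  assumes "(\<lambda>n. LINT x|lborel. norm (G n x) powr p) \<longlonglongrightarrow> 0" "e > 0" "p \<ge> 1"
  shows "\<exists>n. Lnorm p (G n) < e"
proof -
  have "eventually (\<lambda>n. (LINT x|lborel. norm (G n x) powr p) < e powr p) sequentially"
    using assms(2) by (intro order_tendstoD(2)[OF assms(1)]) simp
  then obtain n where n: "(LINT x|lborel. norm (G n x) powr p) < e powr p"
    by (auto simp: eventually_sequentially)
  then have "Lnorm p (G n) < (e powr p) powr (1/p)"
    unfolding Lnorm_def using assms(3) by (intro powr_less_mono2) auto
  also have "\<dots> = e" using assms by (simp add: powr_powr)
  finally show ?thesis by blast
qed

lemma Lp_truncate:
  assumes F: "F \<in> Lp p" and p: "p \<ge> 1" and e: "e > 0"
  shows "\<exists>(N::nat) G. G \<in> Lp p \<and> (\<forall>x. norm (G x) \<le> real N) \<and> (\<forall>x. \<bar>x\<bar> > real N \<longrightarrow> G x = 0) \<and> Lnorm p (\<lambda>x. F x - G x) < e"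
proof -
  note [measurable] = Lp_measurable[OF F]
  define T where "T n x = (if \<bar>x\<bar> \<le> real n \<and> norm (F x) \<le> real n then F x else 0)" for n x
  have [measurable]: "T n \<in> borel_measurable borel" for n unfolding T_def by measurable
  have "(\<lambda>n. LINT x|lborel. norm (F x - T n x) powr p) \<longlonglongrightarrow> integral\<^sup>L lborel (\<lambda>x::real. 0::real)"
  proof (rule integral_dominated_convergence)
    show "integrable lborel (\<lambda>x. norm (F x) powr p)" by (rule Lp_integrable[OF F])
    show "AE x in lborel. (\<lambda>n. norm (F x - T n x) powr p) \<longlonglongrightarrow> 0"
    proof (rule AE_I2)
      fix x
      define M where "M = nat \<lceil>max \<bar>x\<bar> (norm (F x))\<rceil>"
      have "T n x = F x" if "n \<ge> M" for n
      proof -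
        have "max \<bar>x\<bar> (norm (F x)) \<le> real M" unfolding M_def by (rule real_nat_ceiling_ge)
        then have "max \<bar>x\<bar> (norm (F x)) \<le> real n" using that by linarith
        then show ?thesis by (simp add: T_def)
      qed
      then have "eventually (\<lambda>n. norm (F x - T n x) powr p = 0) sequentially"
        unfolding eventually_sequentially by (intro exI[of _ M]) simp
      then show "(\<lambda>n. norm (F x - T n x) powr p) \<longlonglongrightarrow> 0" by (rule tendsto_eventually)
    qed
    show "AE x in lborel. norm (norm (F x - T n x) powr p) \<le> norm (F x) powr p" for n
      using p by (intro AE_I2) (auto simp: T_def)
  qed auto
  then obtain N where N: "Lnorm p (\<lambda>x. F x - T N x) < e"
    using Lnorm_less_of_tendsto[of "\<lambda>n x. F x - T n x" p e] e p by auto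
  show ?thesis
  proof (intro exI[of _ N] exI[of _ "T N"] conjI)
    have "integrable lborel (\<lambda>x. norm (T N x) powr p)"
      by (rule Bochner_Integration.integrable_bound[OF Lp_integrable[OF F]]) (auto simp: T_def)
    then show "T N \<in> Lp p" by (simp add: Lp_def)
  qed (use N in \<open>auto simp: T_def\<close>)
qed

text \<open>A measurable function is an almost-everywhere limit of continuous ones, but these need
  be neither bounded nor compactly supported. Clipping the values and cutting off the domain repairs
  both without disturbing the limit, and dominated convergence gives L^p convergence.\<close>

lemma Lp_dense_continuous:
  assumes F: "F \<in> Lp p" and p: "p \<ge> 1" and e: "e > 0"
  shows "\<exists>H R. H \<in> Lp p \<and> continuous_on UNIV H \<and> (\<forall>x. \<bar>x\<bar> > R \<longrightarrow> H x = 0) \<and> Lnorm p (\<lambda>x. F x - H x) < e"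
proof -
  have "e / 2 > 0" using e by simp
  from Lp_truncate[OF F p this] obtain N0 :: nat and G where GL: "G \<in> Lp p" and Gb': "\<forall>x. norm (G x) \<le> real N0"
    and Gs': "\<forall>x. \<bar>x\<bar> > real N0 \<longrightarrow> G x = 0" and Ge: "Lnorm p (\<lambda>x. F x - G x) < e / 2"
    by (elim exE conjE)
  note Gb = Gb'[rule_format] and Gs = Gs'[rule_format]
  note [measurable] = Lp_measurable[OF GL]
  \<comment> \<open>The added 1 keeps \<open>N\<close> positive even for \<open>N0 = 0\<close>, as
    the division in \<open>clip\<close> requires.\<close>
  define N where "N = real N0 + 1"
  have N: "N > 0" "\<And>x. norm (G x) \<le> N" using Gb by (auto simp: N_def add_increasing2)
  have "G \<in> borel_measurable lebesgue" by (simp add: measurable_completion)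
  then have "G measurable_on UNIV" by (intro lebesgue_measurable_imp_measurable_on) auto
  then obtain Z g where Z: "negligible Z" and cg: "\<And>n::nat. continuous_on UNIV (g n)" and lim: "\<And>x. x \<notin> Z \<Longrightarrow> (\<lambda>n. g n x) \<longlonglongrightarrow> G x"
    unfolding measurable_on_def by auto
  \<comment> \<open>The radial retraction onto the closed disc of radius \<open>N\<close>:
    continuous, and the identity on the values of \<open>G\<close>.\<close>
  define clip where "clip z = (N / max N (norm z)) *\<^sub>R z" for z :: complex
  have clip_le: "norm (clip z) \<le> N" for z
  proof -
    have "norm z / max N (norm z) \<le> 1" using N(1) by (auto simp: divide_le_eq_1 less_max_iff_disj)
    then have "N * (norm z / max N (norm z)) \<le> N * 1" using N(1) by (intro mult_left_mono) auto
    then show ?thesis using N(1) by (simp add: clip_def)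
  qed
  have clip_id: "clip z = z" if "norm z \<le> N" for z using that N(1) by (simp add: clip_def max_def)
  have clip_cont: "continuous_on UNIV clip" unfolding clip_def using N(1) by (intro continuous_intros) (auto simp: max_def)
  define cut where "cut x = max 0 (min 1 (N + 1 - \<bar>x\<bar>))" for x :: real
  have cut_bd: "0 \<le> cut x" "cut x \<le> 1" for x by (auto simp: cut_def)
  have cut_0: "cut x = 0" if "\<bar>x\<bar> > N + 1" for x using that by (simp add: cut_def)
  have cut_1: "cut x = 1" if "\<bar>x\<bar> \<le> N" for x using that by (simp add: cut_def)
  define H where "H n x = cut x *\<^sub>R clip (g n x)" for n x
  have cH: "continuous_on UNIV (H n)" for n
    unfolding H_def cut_def by (intro continuous_intros continuous_on_compose2[OF clip_cont cg]) auto
  have [measurable]: "H n \<in> borel_measurable borel" for n by (rule borel_measurable_continuous_onI[OF cH])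
  have Hb: "norm (H n x) \<le> N" for n x
  proof -
    have "norm (H n x) = cut x * norm (clip (g n x))" using cut_bd[of x] by (simp add: H_def)
    also have "\<dots> \<le> 1 * N" using cut_bd[of x] clip_le by (intro mult_mono) auto
    finally show ?thesis by simp
  qed
  have H0: "H n x = 0" if "\<bar>x\<bar> > N + 1" for n x using cut_0[OF that] by (simp add: H_def)
  have box: "integrable lborel (\<lambda>x. (2 * N) powr p * indicator {-(N+1)..N+1} x)"
    by (intro integrable_mult_right integrable_real_indicator) (auto simp: emeasure_lborel_Icc_eq)
  have bd: "norm (norm (G x - H n x) powr p) \<le> (2 * N) powr p * indicator {-(N+1)..N+1} x" for n x
  proof (cases "\<bar>x\<bar> > N + 1")
    case True
    then show ?thesis using H0[OF True] Gs[of x] p by (simp add: N_def)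
  next
    case False
    have "norm (G x - H n x) \<le> 2 * N" using norm_triangle_ineq4[of "G x" "H n x"] N(2)[of x] Hb[of n x] by linarith
    then have "norm (G x - H n x) powr p \<le> (2 * N) powr p" using p by (intro powr_mono2) auto
    moreover have "x \<in> {-(N+1)..N+1}" using False by auto
    ultimately show ?thesis by simp
  qed
  have "(\<lambda>n. LINT x|lborel. norm (G x - H n x) powr p) \<longlonglongrightarrow> integral\<^sup>L lborel (\<lambda>x::real. 0::real)"
  proof (rule integral_dominated_convergence[OF _ _ box])
    have "AE x in lebesgue. x \<notin> Z" using Z by (simp add: negligible_iff_null_sets AE_not_in)
    then have "AE x in lborel. x \<notin> Z" by (simp add: AE_completion_iff)
    then show "AE x in lborel. (\<lambda>n. norm (G x - H n x) powr p) \<longlonglongrightarrow> 0"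
    proof eventually_elim
      case (elim x)
      have "(\<lambda>n. H n x) \<longlonglongrightarrow> cut x *\<^sub>R clip (G x)"
        unfolding H_def using clip_cont lim[OF elim]
        by (intro tendsto_intros continuous_on_tendsto_compose[OF clip_cont]) auto
      also have "cut x *\<^sub>R clip (G x) = G x"
        using clip_id[OF N(2)[of x]] cut_1[of x] Gs[of x] by (cases "\<bar>x\<bar> \<le> N") (auto simp: N_def)
      finally have "(\<lambda>n. H n x) \<longlonglongrightarrow> G x" .
      then have "(\<lambda>n. norm (G x - H n x) powr p) \<longlonglongrightarrow> norm (G x - G x) powr p"
        using p by (intro tendsto_powr2 tendsto_intros) auto
      then show ?case using p by simp
    qed
    show "AE x in lborel. norm (norm (G x - H n x) powr p) \<le> (2 * N) powr p * indicator {-(N+1)..N+1} x" for n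
      using bd by (intro AE_I2)
  qed auto
  then obtain n where n: "Lnorm p (\<lambda>x. G x - H n x) < e / 2"
    using Lnorm_less_of_tendsto[of "\<lambda>n x. G x - H n x" p "e/2"] e p by auto
  have "(\<lambda>x. G x - H n x) \<in> Lp p"
    using Bochner_Integration.integrable_bound[OF box, of "\<lambda>x. norm (G x - H n x) powr p"] order_trans[OF bd abs_ge_self]
    by (auto simp: Lp_def intro!: AE_I2)
  note GH = this
  have HL: "H n \<in> Lp p" using Lp_diff(1)[OF GL GH p] by simp
  have "Lnorm p (\<lambda>x. F x - H n x) = Lnorm p (\<lambda>x. (F x - G x) + (G x - H n x))" by simp
  also have "\<dots> \<le> Lnorm p (\<lambda>x. F x - G x) + Lnorm p (\<lambda>x. G x - H n x)" by (rule Lp_add(2)[OF Lp_diff(1)[OF F GL p] GH p])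
  also have "\<dots> < e" using Ge n by linarith
  finally show ?thesis using HL cH H0 by (intro exI[of _ "H n"] exI[of _ "N + 1"] conjI allI impI)
qed

lemma polynomial_function_complex_sum:
  fixes g :: "real \<Rightarrow> complex"
  assumes "polynomial_function g"
  obtains c :: "nat \<Rightarrow> complex" and N :: nat where "\<And>x. g x = (\<Sum>i\<le>N. c i * complex_of_real x ^ i)"
proof -
  have "real_polynomial_function (Re \<circ> g)" "real_polynomial_function (Im \<circ> g)"
    using assms bounded_linear_Re bounded_linear_Im unfolding polynomial_function_def by blast+
  then obtain a n b m where a: "Re \<circ> g = (\<lambda>x. \<Sum>i\<le>(n::nat). a i * x ^ i)" and b: "Im \<circ> g = (\<lambda>x. \<Sum>i\<le>(m::nat). b i * x ^ i)"
    unfolding real_polynomial_function_iff_sum by blast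
  define N where "N = max n m"
  have pad: "(\<Sum>i\<le>k. f i * x ^ i) = (\<Sum>i\<le>N. (if i \<le> k then f i else 0) * x ^ i)" if "k \<le> N" for k x and f :: "nat \<Rightarrow> real"
    using that by (intro sum.mono_neutral_cong_left) auto
  show ?thesis
  proof (rule that[of "\<lambda>i. Complex (if i \<le> n then a i else 0) (if i \<le> m then b i else 0)" N])
    fix x
    have "Re (g x) = (\<Sum>i\<le>N. (if i \<le> n then a i else 0) * x ^ i)"
      using fun_cong[OF a, of x] pad[of n a x] by (simp add: N_def)
    moreover have "Im (g x) = (\<Sum>i\<le>N. (if i \<le> m then b i else 0) * x ^ i)"
      using fun_cong[OF b, of x] pad[of m b x] by (simp add: N_def)
    moreover have "Re (Complex u v * complex_of_real x ^ i) = u * x ^ i" "Im (Complex u v * complex_of_real x ^ i) = v * x ^ i" for u v i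
      by (simp_all flip: of_real_power)
    ultimately show "g x = (\<Sum>i\<le>N. Complex (if i \<le> n then a i else 0) (if i \<le> m then b i else 0) * complex_of_real x ^ i)"
      by (simp only: complex_eq_iff Re_sum Im_sum) 
  qed
qed

text \<open>In the variable \<open>exp (- t)\<close> the approximants are polynomials, so Weierstrass' theorem applies.\<close>

lemma weyl_gen_dense:
  assumes a: "a > 0" and p: "p \<ge> 1" and F: "F \<in> Lp p" and e: "e > 0"
  obtains \<phi> where "\<phi> \<in> schwartz_plus" "Lnorm p (\<lambda>x. to_line p (weyl_gen a \<phi>) x - F x) < e"
proof -
  have "e / 2 > 0" using e by simp
  from Lp_dense_continuous[OF F p this] obtain H R where HL: "H \<in> Lp p" and cH: "continuous_on UNIV H"
    and Hs': "\<forall>x. \<bar>x\<bar> > R \<longrightarrow> H x = 0" and He: "Lnorm p (\<lambda>x. F x - H x) < e / 2"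
    by (elim exE conjE)
  note Hs = Hs'[rule_format]
  define h where "h t = from_line p H t" for t
  \<comment> \<open>The weight \<open>t powr a * exp (- t)\<close> is itself of the form
    \<open>weyl_gen a \<psi>\<close>, so it has finite norm already; a uniform error \<delta> of the
    polynomial becomes an error of at most \<delta> times that norm.\<close>
  obtain \<psi> where \<psi>: "\<psi> \<in> schwartz_plus" and \<psi>': "\<And>t. t > 0 \<Longrightarrow> weyl_gen a \<psi> t = complex_of_real (t powr a * exp (- t)) * (\<Sum>i\<le>0. (1::complex) * complex_of_real (exp (- t)) ^ i)"
    using weyl_gen_exp_sum[OF a, of "\<lambda>_. 1" 0] by blast
  define W where "W = to_line p (weyl_gen a \<psi>)"
  have WL: "W \<in> Lp p" unfolding W_def using schwartz_plus_repr(1)[OF \<psi> a p] p by (simp add: Lp_plus_iff)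
  define \<delta> where "\<delta> = e / (2 * (Lnorm p W + 1))"
  have den: "2 * (Lnorm p W + 1) > 0" using add_nonneg_pos[OF Lnorm_nonneg[of p W] zero_less_one] by simp
  have \<delta>: "\<delta> > 0" using e den by (simp add: \<delta>_def)
  \<comment> \<open>The target divided by the weight, in the variable \<open>x = exp (- t)\<close>.
    Where \<open>x\<close> is near 0 or 1 the target vanishes, so setting \<open>q\<close> to 0
    outside (0, 1) is a continuous extension.\<close>
  define q where "q x = (if 0 < x \<and> x < 1 then h (- ln x) * complex_of_real ((- ln x) powr (- a) * exp (- ln x)) else 0)" for x :: real
  \<comment> \<open>As \<open>ln (- ln x)\<close> is \<open>ln t\<close>, the support condition
    \<open>\<bar>ln t\<bar> \<le> R\<close> becomes membership of x in [x0, x1].\<close>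
  define x0 where "x0 = exp (- exp R)"
  define x1 where "x1 = exp (- exp (- R))"
  have x01: "0 < x0" "x1 < 1" by (auto simp: x0_def x1_def)
  have q0: "q x = 0" if "x < x0 \<or> x > x1" for x
  proof (cases "0 < x \<and> x < 1")
    case True
    have "\<bar>ln (- ln x)\<bar> > R"
    proof (cases "x < x0")
      case l: True
      then have "ln x < - exp R" using True by (metis x0_def exp_less_cancel_iff exp_ln)
      then have "exp R < - ln x" by simp
      then have "R < ln (- ln x)" by (metis exp_gt_zero exp_less_cancel_iff exp_ln order_less_trans)
      then show ?thesis by simp
    next
      case False
      then have "x > x1" using that by simp
      then have "ln x > - exp (- R)" using True by (metis x1_def exp_less_cancel_iff exp_ln)
      then have l: "- ln x < exp (- R)" by simp
      have "- ln x > 0" using True by simp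
      then have "ln (- ln x) < - R" using l by (metis exp_less_cancel_iff exp_ln)
      then show ?thesis by simp
    qed
    then show ?thesis using Hs by (simp add: q_def h_def from_line_def)
  qed (auto simp: q_def)
  have cont_in: "continuous_on {0<..<1} q"
  proof -
    have "continuous_on {0<..<1} (\<lambda>x::real. complex_of_real (exp (- (ln (- ln x) / p))) * H (ln (- ln x)) * complex_of_real ((- ln x) powr (- a) * exp (- ln x)))"
      using p by (intro continuous_intros continuous_on_compose2[OF cH]) auto
    then show ?thesis by (rule continuous_on_eq) (simp add: q_def h_def from_line_def)
  qed
  have "continuous_on {0..1} q"
    unfolding continuous_on_eq_continuous_within
  proof
    fix x :: real assume x: "x \<in> {0..1}"
    show "continuous (at x within {0..1}) q"
    proof (cases "0 < x \<and> x < 1")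
      case True
      then have "isCont q x" using cont_in by (simp add: continuous_on_eq_continuous_at)
      then show ?thesis by (rule continuous_at_imp_continuous_at_within)
    next
      case False
      then have "x < x0 \<or> x > x1" using x x01 by auto
      then have "x \<in> {..<x0} \<union> {x1<..}" by auto
      moreover have "open ({..<x0} \<union> {x1<..})" by auto
      ultimately have "eventually (\<lambda>y. y \<in> {..<x0} \<union> {x1<..}) (nhds x)" by (rule eventually_nhds_in_open[rotated])
      then have "eventually (\<lambda>y. q y = 0) (nhds x)" by eventually_elim (use q0 in auto)
      then have "isCont q x" by (subst isCont_cong) auto
      then show ?thesis by (rule continuous_at_imp_continuous_at_within)
    qed
  qed
  then obtain g where g: "polynomial_function g" "\<And>x. x \<in> {0..1} \<Longrightarrow> norm (q x - g x) < \<delta>"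
    using Stone_Weierstrass_polynomial_function[of "{0..1}" q \<delta>] \<delta> by auto
  obtain c N where c: "\<And>x. g x = (\<Sum>i\<le>N. c i * complex_of_real x ^ i)" using polynomial_function_complex_sum[OF g(1)] by blast
  obtain \<phi> where \<phi>: "\<phi> \<in> schwartz_plus" and \<phi>': "\<And>t. t > 0 \<Longrightarrow> weyl_gen a \<phi> t = complex_of_real (t powr a * exp (- t)) * (\<Sum>i\<le>N. c i * complex_of_real (exp (- t)) ^ i)"
    using weyl_gen_exp_sum[OF a, of c N] by blast
  have \<phi>L: "to_line p (weyl_gen a \<phi>) \<in> Lp p" using schwartz_plus_repr(1)[OF \<phi> a p] p by (simp add: Lp_plus_iff)
  have pt: "norm (weyl_gen a \<phi> t - h t) \<le> \<delta> * norm (weyl_gen a \<psi> t)" if t: "t > 0" for t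
  proof -
    define w where "w = t powr a * exp (- t)"
    have w: "w > 0" using t by (simp add: w_def)
    have "q (exp (- t)) = h t * complex_of_real (t powr (- a) * exp t)" using t by (simp add: q_def)
    moreover have "w * (t powr (- a) * exp t) = 1"
    proof -
      have "t powr a * t powr (- a) = 1" using t by (simp flip: powr_add)
      moreover have "exp (- t) * exp t = 1" by (simp flip: exp_add)
      ultimately show ?thesis unfolding w_def by (metis mult.assoc mult.commute mult.left_neutral)
    qed
    then have "complex_of_real w * complex_of_real (t powr (- a) * exp t) = 1" by (metis of_real_1 of_real_mult)
    ultimately have "h t = complex_of_real w * q (exp (- t))" by (simp add: mult.left_commute)
    moreover have "weyl_gen a \<phi> t = complex_of_real w * g (exp (- t))" using \<phi>'[OF t] c by (simp add: w_def)
    ultimately have "norm (weyl_gen a \<phi> t - h t) = w * norm (g (exp (- t)) - q (exp (- t)))"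
      using w by (simp add: norm_mult flip: right_diff_distrib)
    also have "\<dots> \<le> w * \<delta>" using g(2)[of "exp (- t)"] t w by (intro mult_left_mono) (auto simp: norm_minus_commute less_imp_le)
    also have "\<dots> = \<delta> * norm (weyl_gen a \<psi> t)" using \<psi>'[OF t] w by (simp add: w_def norm_mult)
    finally show ?thesis .
  qed
  have Hh: "to_line p h x = H x" for x unfolding h_def by simp
  have D1: "(\<lambda>x. to_line p (weyl_gen a \<phi>) x - H x) \<in> Lp p" by (rule Lp_diff(1)[OF \<phi>L HL p])
  have "Lnorm p (\<lambda>x. to_line p (weyl_gen a \<phi>) x - H x) \<le> \<delta> * Lnorm p W"
  proof (rule Lnorm_leI(2)[OF Lp_measurable[OF D1] p])
    show "0 \<le> \<delta> * Lnorm p W" using \<delta> by simp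
    have "norm (to_line p (weyl_gen a \<phi>) x - H x) \<le> norm (complex_of_real \<delta> * W x)" for x
    proof -
      have "to_line p (weyl_gen a \<phi>) x - H x = complex_of_real (exp (x / p)) * (weyl_gen a \<phi> (exp x) - h (exp x))"
        using Hh[of x] by (simp add: to_line_def right_diff_distrib)
      then have "norm (to_line p (weyl_gen a \<phi>) x - H x) = exp (x / p) * norm (weyl_gen a \<phi> (exp x) - h (exp x))" by (simp add: norm_mult)
      also have "\<dots> \<le> exp (x / p) * (\<delta> * norm (weyl_gen a \<psi> (exp x)))" by (intro mult_left_mono pt) auto
      also have "\<dots> = norm (complex_of_real \<delta> * W x)" using \<delta> by (simp add: W_def to_line_def norm_mult)
      finally show ?thesis .
    qed
    then have "(\<integral>\<^sup>+x. ennreal (norm (to_line p (weyl_gen a \<phi>) x - H x) powr p) \<partial>lborel) \<le> (\<integral>\<^sup>+x. ennreal (norm (complex_of_real \<delta> * W x) powr p) \<partial>lborel)"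
      using p by (intro nn_integral_mono ennreal_leI powr_mono2) auto
    also have "\<dots> = ennreal ((\<delta> * Lnorm p W) powr p)"
      using nn_integral_Lp[OF Lp_cmult(1)[OF WL p, of "complex_of_real \<delta>"] p] Lp_cmult(2)[OF WL p, of "complex_of_real \<delta>"] \<delta> by simp
    finally show "(\<integral>\<^sup>+x. ennreal (norm (to_line p (weyl_gen a \<phi>) x - H x) powr p) \<partial>lborel) \<le> ennreal ((\<delta> * Lnorm p W) powr p)" .
  qed
  also have "\<dots> < e / 2"
  proof -
    have "\<delta> * Lnorm p W < \<delta> * (Lnorm p W + 1)" using \<delta> by simp
    also have "\<dots> = e / 2" using den by (simp add: \<delta>_def field_simps)
    finally show ?thesis .
  qed
  finally have 1: "Lnorm p (\<lambda>x. to_line p (weyl_gen a \<phi>) x - H x) < e / 2" .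
  have HF: "(\<lambda>x. H x - F x) \<in> Lp p" by (rule Lp_diff(1)[OF HL F p])
  have "Lnorm p (\<lambda>x. H x - F x) = Lnorm p (\<lambda>x. F x - H x)" using Lp_uminus(2)[OF HF p] by simp
  moreover have "Lnorm p (\<lambda>x. to_line p (weyl_gen a \<phi>) x - F x) \<le> Lnorm p (\<lambda>x. to_line p (weyl_gen a \<phi>) x - H x) + Lnorm p (\<lambda>x. H x - F x)"
    using Lp_add(2)[OF D1 HF p] by simp
  ultimately have "Lnorm p (\<lambda>x. to_line p (weyl_gen a \<phi>) x - F x) < e" using 1 He by linarith
  with \<phi> show ?thesis by (rule that)
qed

section \<open>The completed spaces\<close>

locale weyl_space =
  fixes a p :: real
  assumes a: "a > 0" and p: "p \<ge> 1"
begin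

definition \<kappa> :: "real \<Rightarrow> complex" where
  "\<kappa> y = complex_of_real (1 / Gamma (a + 1)) * complex_of_real (a * beta_kernel a (1 / p) y)"

text \<open>\<open>G\<close> is the line version of \<open>t powr a\<close> times the Weyl
  derivative. For a general member of the completion no classical derivative exists, and this
  relation takes its place; \<open>cor_\<kappa>_inj\<close> makes \<open>G\<close> unique almost
  everywhere.\<close>

definition generates :: "(real \<Rightarrow> complex) \<Rightarrow> (real \<Rightarrow> complex) \<Rightarrow> bool" where
  "generates G f \<longleftrightarrow> G \<in> Lp p \<and> f \<in> Lp_plus p \<and> (AE x in lborel. to_line p f x = cor \<kappa> G x)"

lemma Gamma_pos: "Gamma (a + 1) > 0"
  using a by (intro Gamma_real_pos) simp

lemma integrable_\<kappa>: "integrable lborel \<kappa>"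
  unfolding \<kappa>_def of_real_mult using integrable_complex_beta_kernel[of a "1/p"] a p by (intro integrable_mult_right) auto

lemma measurable_\<kappa> [measurable]: "\<kappa> \<in> borel_measurable borel"
  using integrable_\<kappa> by auto

lemma cor_\<kappa>_inj:
  assumes F: "F \<in> Lp p" and G: "G \<in> Lp p" and eq: "AE x in lborel. cor \<kappa> F x = cor \<kappa> G x"
  shows "AE x in lborel. F x = G x"
proof -
  have D: "(\<lambda>x. F x - G x) \<in> Lp p" by (rule Lp_diff(1)[OF F G p])
  have s: "cor \<kappa> H x = complex_of_real (a / Gamma (a + 1)) * cor (\<lambda>y. complex_of_real (beta_kernel a (1 / p) y)) H x" for H x
    unfolding \<kappa>_def of_real_mult cor_kernel_cmult by simp
  have "a / Gamma (a + 1) > 0" using a Gamma_pos by (rule divide_pos_pos)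
  then have nz: "complex_of_real (a / Gamma (a + 1)) \<noteq> 0" unfolding of_real_eq_0_iff by linarith
  have "AE x in lborel. cor (\<lambda>y. complex_of_real (beta_kernel a (1 / p) y)) (\<lambda>x. F x - G x) x = 0"
    using eq cor_diff[OF integrable_\<kappa> F G p]
  proof eventually_elim
    case (elim x)
    then have "cor \<kappa> (\<lambda>x. F x - G x) x = 0" by simp
    then show ?case unfolding s using nz by simp
  qed
  moreover have "1 / p > 0" using p by simp
  ultimately have "AE x in lborel. F x - G x = 0" using cor_beta_kernel_inj[OF D p _ a] by blast
  then show ?thesis by eventually_elim simp
qed

lemma schwartz_generated:
  assumes "\<phi> \<in> schwartz_plus"
  shows "generates (to_line p (weyl_gen a \<phi>)) \<phi>"
proof -
  have L: "to_line p (weyl_gen a \<phi>) \<in> Lp p" using schwartz_plus_repr(1)[OF assms a p] p by (simp add: Lp_plus_iff)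
  have "AE x in lborel. cor \<kappa> (to_line p (weyl_gen a \<phi>)) x = to_line p \<phi> x"
    using schwartz_plus_repr(2)[OF assms a p]
  proof eventually_elim
    case (elim x)
    have "cor \<kappa> (to_line p (weyl_gen a \<phi>)) x = complex_of_real (1 / Gamma (a + 1)) * (complex_of_real (Gamma (a + 1)) * to_line p \<phi> x)"
      unfolding \<kappa>_def[abs_def] cor_kernel_cmult elim ..
    also have "\<dots> = complex_of_real (1 / Gamma (a + 1) * Gamma (a + 1)) * to_line p \<phi> x"
      by (simp only: of_real_mult mult.assoc)
    also have "1 / Gamma (a + 1) * Gamma (a + 1) = 1" using Gamma_pos by simp
    finally show ?case by simp
  qed
  note eq = this
  have "to_line p \<phi> \<in> Lp p"
    by (rule Lp_AE_cong(1)[OF cor_Lp(2)[OF integrable_\<kappa> L p] measurable_to_line[OF schwartz_plus_measurable[OF assms]] eq])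
  then show ?thesis unfolding generates_def using L eq p by (auto simp: Lp_plus_iff elim: eventually_mono)
qed

lemma snorm_diff:
  assumes "\<phi> \<in> schwartz_plus" "\<psi> \<in> schwartz_plus"
  shows "snorm a p (\<lambda>t. \<phi> t - \<psi> t) = Lnorm p (\<lambda>x. to_line p (weyl_gen a \<phi>) x - to_line p (weyl_gen a \<psi>) x) / Gamma (a + 1)"
proof -
  have "weyl_gen a (\<lambda>t. \<phi> t - \<psi> t) \<in> Lp_plus p" by (rule schwartz_plus_repr(1)[OF schwartz_plus_diff(1)[OF assms] a p])
  then have "Lp_norm p (weyl_gen a (\<lambda>t. \<phi> t - \<psi> t)) = Lnorm p (to_line p (weyl_gen a (\<lambda>t. \<phi> t - \<psi> t)))"
    by (intro to_line_Lp(2) Lp_plus_measurable p)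
  also have "to_line p (weyl_gen a (\<lambda>t. \<phi> t - \<psi> t)) = (\<lambda>x. to_line p (weyl_gen a \<phi>) x - to_line p (weyl_gen a \<psi>) x)"
    using schwartz_plus_diff(2)[OF assms, of a] a by (auto simp: to_line_def right_diff_distrib)
  finally show ?thesis by (simp add: snorm_eq_Lp_norm)
qed

lemma snorm_schwartz:
  assumes "\<phi> \<in> schwartz_plus"
  shows "snorm a p \<phi> = Lnorm p (to_line p (weyl_gen a \<phi>)) / Gamma (a + 1)"
  unfolding snorm_eq_Lp_norm using to_line_Lp(2)[OF Lp_plus_measurable[OF schwartz_plus_repr(1)[OF assms a p]] p] by simp

lemma Lp_norm_diff:
  assumes "f \<in> Lp_plus p" "g \<in> Lp_plus p"
  shows "Lp_norm p (\<lambda>t. f t - g t) = Lnorm p (\<lambda>x. to_line p f x - to_line p g x)"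
proof -
  have eq: "to_line p (\<lambda>t. f t - g t) = (\<lambda>x. to_line p f x - to_line p g x)" by (auto simp: to_line_def right_diff_distrib)
  have "(\<lambda>x. to_line p f x - to_line p g x) \<in> Lp p" using assms p by (intro Lp_diff(1)) (auto simp: Lp_plus_iff)
  then have "(\<lambda>t. f t - g t) \<in> Lp_plus p" using p eq by (simp add: Lp_plus_iff)
  then show ?thesis using to_line_Lp(2)[OF Lp_plus_measurable p] eq by metis
qed

text \<open>\<open>snorm\<close> is, up to \<open>Gamma (a + 1)\<close>, the L^p norm of the
  generators, so these are Cauchy and have a limit \<open>H\<close>. Both f and the function
  generated by \<open>H\<close> are L^p limits of \<phi>, because \<open>cor \<kappa>\<close> is
  bounded; hence they agree.\<close>

lemma approx_seq_generates:
  assumes ap: "approx_seq a p \<phi> f" and f: "f \<in> Lp_plus p"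
  shows "\<exists>G. generates G f \<and> (\<lambda>n. snorm a p (\<phi> n)) \<longlonglongrightarrow> Lnorm p G / Gamma (a + 1)"
proof -
  have S: "\<phi> n \<in> schwartz_plus" for n using ap by (simp add: approx_seq_def)
  have Cau: "\<exists>N. \<forall>m\<ge>N. \<forall>n\<ge>N. snorm a p (\<lambda>t. \<phi> m t - \<phi> n t) < e" if "e > 0" for e using ap that by (simp add: approx_seq_def)
  have lim: "(\<lambda>n. Lp_norm p (\<lambda>t. \<phi> n t - f t)) \<longlonglongrightarrow> 0" using ap by (simp add: approx_seq_def)
  define G where "G n = to_line p (weyl_gen a (\<phi> n))" for n
  have gen: "generates (G n) (\<phi> n)" for n unfolding G_def by (rule schwartz_generated[OF S])
  have GL: "G n \<in> Lp p" and \<phi>L: "\<phi> n \<in> Lp_plus p" for n using gen[of n] by (auto simp: generates_def)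
  have C: "\<exists>N. \<forall>m\<ge>N. \<forall>n\<ge>N. Lnorm p (\<lambda>x. G m x - G n x) < e" if e: "e > 0" for e
  proof -
    have "e / Gamma (a + 1) > 0" using e Gamma_pos by simp
    from Cau[OF this] obtain N where N: "\<forall>m\<ge>N. \<forall>n\<ge>N. snorm a p (\<lambda>t. \<phi> m t - \<phi> n t) < e / Gamma (a + 1)" by blast
    have "Lnorm p (\<lambda>x. G m x - G n x) < e" if "m \<ge> N" "n \<ge> N" for m n
      using N[rule_format, OF that] Gamma_pos unfolding snorm_diff[OF S S] G_def by (simp add: divide_less_cancel)
    then show ?thesis by blast
  qed
  from Lp_complete[OF GL p C] obtain H where H: "H \<in> Lp p" and Hlim: "(\<lambda>n. Lnorm p (\<lambda>x. G n x - H x)) \<longlonglongrightarrow> 0" by blast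
  have fl: "to_line p f \<in> Lp p" using f p by (simp add: Lp_plus_iff)
  have \<phi>l: "to_line p (\<phi> n) \<in> Lp p" for n using \<phi>L[of n] p by (simp add: Lp_plus_iff)
  have KH: "cor \<kappa> H \<in> Lp p" by (rule cor_Lp(2)[OF integrable_\<kappa> H p])
  define Z where "Z x = to_line p f x - cor \<kappa> H x" for x
  have ZL: "Z \<in> Lp p" unfolding Z_def by (rule Lp_diff(1)[OF fl KH p])
  have bound: "Lnorm p Z \<le> Lp_norm p (\<lambda>t. \<phi> n t - f t) + L1 \<kappa> * Lnorm p (\<lambda>x. G n x - H x)" for n
  proof -
    have GH: "(\<lambda>x. G n x - H x) \<in> Lp p" by (rule Lp_diff(1)[OF GL H p])
    have cGH: "cor \<kappa> (\<lambda>x. G n x - H x) \<in> Lp p" by (rule cor_Lp(2)[OF integrable_\<kappa> GH p])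
    have d: "(\<lambda>x. to_line p (\<phi> n) x - to_line p f x) \<in> Lp p" by (rule Lp_diff(1)[OF \<phi>l fl p])
    have "AE x in lborel. to_line p (\<phi> n) x = cor \<kappa> (G n) x" using gen[of n] by (simp add: generates_def)
    then have "AE x in lborel. cor \<kappa> (\<lambda>x. G n x - H x) x - (to_line p (\<phi> n) x - to_line p f x) = Z x"
      using cor_diff[OF integrable_\<kappa> GL[of n] H p] by eventually_elim (simp add: Z_def)
    then have "Lnorm p Z = Lnorm p (\<lambda>x. cor \<kappa> (\<lambda>x. G n x - H x) x - (to_line p (\<phi> n) x - to_line p f x))"
      by (rule Lp_AE_cong(2)[OF Lp_diff(1)[OF cGH d p] Lp_measurable[OF ZL]])
    also have "\<dots> \<le> Lnorm p (cor \<kappa> (\<lambda>x. G n x - H x)) + Lnorm p (\<lambda>x. to_line p (\<phi> n) x - to_line p f x)"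
      by (rule Lp_diff(2)[OF cGH d p])
    also have "\<dots> \<le> L1 \<kappa> * Lnorm p (\<lambda>x. G n x - H x) + Lp_norm p (\<lambda>t. \<phi> n t - f t)"
      unfolding Lp_norm_diff[OF \<phi>L f] using cor_Lp(3)[OF integrable_\<kappa> GH p] by simp
    finally show ?thesis by simp
  qed
  have "(\<lambda>n. Lp_norm p (\<lambda>t. \<phi> n t - f t) + L1 \<kappa> * Lnorm p (\<lambda>x. G n x - H x)) \<longlonglongrightarrow> 0 + L1 \<kappa> * 0"
    by (intro tendsto_intros lim Hlim)
  then have "Lnorm p Z \<le> 0" using bound by (intro LIMSEQ_le_const[of _ 0]) auto
  then have "AE x in lborel. Z x = 0" using Lnorm_eq_0_iff[OF ZL p] Lnorm_nonneg[of p Z] by linarith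
  then have "generates H f" unfolding generates_def using H f by (auto simp: Z_def elim: eventually_mono)
  moreover have "(\<lambda>n. snorm a p (\<phi> n)) \<longlonglongrightarrow> Lnorm p H / Gamma (a + 1)"
  proof -
    have "(\<lambda>n. Lnorm p (G n) - Lnorm p H) \<longlonglongrightarrow> 0"
      by (rule Lim_null_comparison[OF _ Hlim]) (use Lnorm_diff_ge[OF GL H p] in \<open>auto intro!: always_eventually\<close>)
    then have "(\<lambda>n. Lnorm p (G n)) \<longlonglongrightarrow> Lnorm p H" by (rule LIM_zero_cancel)
    then have "(\<lambda>n. Lnorm p (G n) / Gamma (a + 1)) \<longlonglongrightarrow> Lnorm p H / Gamma (a + 1)" using Gamma_pos by (intro tendsto_intros) auto
    then show ?thesis unfolding snorm_schwartz[OF S] G_def .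
  qed
  ultimately show ?thesis by blast
qed

text \<open>Density supplies Schwartz functions whose generators converge to \<open>G\<close>.
  Convergence of the generators is the Cauchy property for \<open>snorm\<close>, and applying the
  bounded operator \<open>cor \<kappa>\<close> gives convergence in L^p.\<close>

lemma generates_approx_seq:
  assumes gen: "generates G f"
  shows "\<exists>\<phi>. approx_seq a p \<phi> f"
proof -
  have G: "G \<in> Lp p" and f: "f \<in> Lp_plus p" and eq: "AE x in lborel. to_line p f x = cor \<kappa> G x" using gen by (auto simp: generates_def)
  have "\<exists>\<phi>. \<phi> \<in> schwartz_plus \<and> Lnorm p (\<lambda>x. to_line p (weyl_gen a \<phi>) x - G x) < 1 / real (Suc n)" for n
  proof -
    have "1 / real (Suc n) > 0" by simp
    from weyl_gen_dense[OF a p G this] show ?thesis by blast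
  qed
  then obtain \<phi> where S: "\<And>n. \<phi> n \<in> schwartz_plus" and d: "\<And>n. Lnorm p (\<lambda>x. to_line p (weyl_gen a (\<phi> n)) x - G x) < 1 / real (Suc n)" by metis
  define H where "H n = to_line p (weyl_gen a (\<phi> n))" for n
  have genH: "generates (H n) (\<phi> n)" for n unfolding H_def by (rule schwartz_generated[OF S])
  have HL: "H n \<in> Lp p" and \<phi>L: "\<phi> n \<in> Lp_plus p" for n using genH[of n] by (auto simp: generates_def)
  have HG: "(\<lambda>x. H n x - G x) \<in> Lp p" for n by (rule Lp_diff(1)[OF HL G p])
  have d': "Lnorm p (\<lambda>x. H n x - G x) < 1 / real (Suc n)" for n unfolding H_def by (rule d)
  have inv0: "(\<lambda>n. 1 / real (Suc n)) \<longlonglongrightarrow> 0" by real_asymp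
  have "\<exists>N. \<forall>m\<ge>N. \<forall>n\<ge>N. snorm a p (\<lambda>t. \<phi> m t - \<phi> n t) < e" if e: "e > 0" for e
  proof -
    define e' where "e' = e * Gamma (a + 1) / 2"
    have "e' > 0" using e Gamma_pos by (simp add: e'_def)
    then have "eventually (\<lambda>n. 1 / real (Suc n) < e') sequentially" by (rule order_tendstoD(2)[OF inv0])
    then obtain N where N: "\<And>n. n \<ge> N \<Longrightarrow> 1 / real (Suc n) < e'" by (auto simp: eventually_sequentially)
    have "snorm a p (\<lambda>t. \<phi> m t - \<phi> n t) < e" if "m \<ge> N" "n \<ge> N" for m n
    proof -
      have "Lnorm p (\<lambda>x. H m x - H n x) = Lnorm p (\<lambda>x. (H m x - G x) - (H n x - G x))" by simp
      also have "\<dots> \<le> Lnorm p (\<lambda>x. H m x - G x) + Lnorm p (\<lambda>x. H n x - G x)" by (rule Lp_diff(2)[OF HG HG p])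
      also have "\<dots> < e' + e'" using d'[of m] d'[of n] N[OF that(1)] N[OF that(2)] by linarith
      also have "\<dots> = e * Gamma (a + 1)" by (simp add: e'_def)
      finally show ?thesis unfolding snorm_diff[OF S S] H_def using Gamma_pos by (simp add: divide_less_eq)
    qed
    then show ?thesis by blast
  qed
  moreover have "(\<lambda>n. Lp_norm p (\<lambda>t. \<phi> n t - f t)) \<longlonglongrightarrow> 0"
  proof (rule Lim_null_comparison)
    show "(\<lambda>n. L1 \<kappa> * (1 / real (Suc n))) \<longlonglongrightarrow> 0" using inv0 by (rule tendsto_mult_right_zero)
    have fl: "to_line p f \<in> Lp p" using f p by (simp add: Lp_plus_iff)
    have \<phi>l: "to_line p (\<phi> n) \<in> Lp p" for n using \<phi>L[of n] p by (simp add: Lp_plus_iff)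
    have "Lp_norm p (\<lambda>t. \<phi> n t - f t) \<le> L1 \<kappa> * (1 / real (Suc n))" for n
    proof -
      have "AE x in lborel. to_line p (\<phi> n) x = cor \<kappa> (H n) x" using genH[of n] by (simp add: generates_def)
      then have "AE x in lborel. cor \<kappa> (\<lambda>x. H n x - G x) x = to_line p (\<phi> n) x - to_line p f x"
        using eq cor_diff[OF integrable_\<kappa> HL[of n] G p] by eventually_elim simp
      then have "Lnorm p (\<lambda>x. to_line p (\<phi> n) x - to_line p f x) = Lnorm p (cor \<kappa> (\<lambda>x. H n x - G x))"
        by (rule Lp_AE_cong(2)[OF cor_Lp(2)[OF integrable_\<kappa> HG p] Lp_measurable[OF Lp_diff(1)[OF \<phi>l fl p]]])
      also have "\<dots> \<le> L1 \<kappa> * Lnorm p (\<lambda>x. H n x - G x)" by (rule cor_Lp(3)[OF integrable_\<kappa> HG p])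
      also have "\<dots> \<le> L1 \<kappa> * (1 / real (Suc n))" using d'[of n] by (intro mult_left_mono) auto
      finally show ?thesis unfolding Lp_norm_diff[OF \<phi>L f] .
    qed
    then show "\<forall>\<^sub>F n in sequentially. norm (Lp_norm p (\<lambda>t. \<phi> n t - f t)) \<le> L1 \<kappa> * (1 / real (Suc n))"
      by (intro always_eventually allI) (simp add: Lp_norm_def)
  qed
  ultimately show ?thesis using S unfolding approx_seq_def by blast
qed

lemma Tsp_iff: "f \<in> Tsp a p \<longleftrightarrow> (\<exists>G. generates G f)"
proof
  assume "f \<in> Tsp a p"
  then obtain \<phi> where "f \<in> Lp_plus p" "approx_seq a p \<phi> f" using a by (auto simp: Tsp_def)
  then show "\<exists>G. generates G f" using approx_seq_generates by blast
next
  assume "\<exists>G. generates G f"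
  then obtain G where G: "generates G f" by blast
  then show "f \<in> Tsp a p" using generates_approx_seq[OF G] a by (auto simp: Tsp_def generates_def)
qed

text \<open>The sequence picked by \<open>SOME\<close> does not matter: whichever it is, its
  generators converge to some generator of f, and injectivity of \<open>cor \<kappa>\<close>
  identifies that limit with \<open>G\<close>.\<close>

lemma Tnorm_eq:
  assumes G: "generates G f"
  shows "Tnorm a p f = Lnorm p G / Gamma (a + 1)"
proof -
  define \<phi> where "\<phi> = (SOME \<phi>. approx_seq a p \<phi> f)"
  have ap: "approx_seq a p \<phi> f" unfolding \<phi>_def by (rule someI_ex[OF generates_approx_seq[OF G]])
  have f: "f \<in> Lp_plus p" using G by (simp add: generates_def)
  obtain H where H: "generates H f" and lim: "(\<lambda>n. snorm a p (\<phi> n)) \<longlonglongrightarrow> Lnorm p H / Gamma (a + 1)"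
    using approx_seq_generates[OF ap f] by blast
  have HL: "H \<in> Lp p" and GL: "G \<in> Lp p" using H G by (auto simp: generates_def)
  have "AE x in lborel. to_line p f x = cor \<kappa> H x" "AE x in lborel. to_line p f x = cor \<kappa> G x" using H G by (auto simp: generates_def)
  then have "AE x in lborel. cor \<kappa> H x = cor \<kappa> G x" by eventually_elim simp
  then have "AE x in lborel. H x = G x" by (rule cor_\<kappa>_inj[OF HL GL])
  then have "Lnorm p G = Lnorm p H" by (rule Lp_AE_cong(2)[OF HL Lp_measurable[OF GL]])
  then show ?thesis using limI[OF lim] a unfolding Tnorm_def \<phi>_def by simp
qed

lemma generates_from_line:
  assumes "G \<in> Lp p"
  shows "generates G (from_line p (cor \<kappa> G))"
  unfolding generates_def using assms from_line_Lp[OF cor_Lp(2)[OF integrable_\<kappa> assms p] p] by simp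

text \<open>On generators the dual Cesaro operator acts as \<open>cor k\<close> again, since
  \<open>cor k\<close> and \<open>cor \<kappa>\<close> commute. The generators fill all of L^p,
  norms agree up to a fixed factor, and injectivity brings equations between generated functions
  back to their generators; so both conditions for invertibility are those on L^p.\<close>

theorem spectrum_eq:
  assumes b: "b > 0"
  shows "spectrum_T a p (dual_cesaro b) = spectrum_T 0 p (dual_cesaro b)"
proof -
  define k where "k y = complex_of_real (b * beta_kernel b (1 / p) y)" for y
  interpret smooth_kernel "\<lambda>y. b * beta_kernel b (1 / p) y"
    by (rule smooth_kernel_beta) (use b p in auto)
  have ki: "integrable lborel k" unfolding k_def by (rule integrable_kernel)
  have range: "range (fourier k) = {complex_of_real b * Beta (complex_of_real b) (complex_of_real (1 / p) + \<i> * complex_of_real t) | t. True}"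
    unfolding k_def using fourier_beta_kernel[of b "1/p" b] b p by auto
  have RL: "(\<lambda>x. c * F x - cor k F x) \<in> Lp p" if "F \<in> Lp p" for F c
    by (rule Lp_diff(1)[OF Lp_cmult(1)[OF that p] cor_Lp(2)[OF ki that p] p])
  have genR: "generates (\<lambda>x. c * F x - cor k F x) (\<lambda>t. c * f t - dual_cesaro b f t)" if gen: "generates F f" for F f c
  proof -
    have F: "F \<in> Lp p" and f: "f \<in> Lp_plus p" and eq: "AE x in lborel. to_line p f x = cor \<kappa> F x" using gen by (auto simp: generates_def)
    have fl: "to_line p f \<in> Lp p" using f p by (simp add: Lp_plus_iff)
    have \<kappa>F: "cor \<kappa> F \<in> Lp p" by (rule cor_Lp(2)[OF integrable_\<kappa> F p])
    have op: "to_line p (\<lambda>t. c * f t - dual_cesaro b f t) = (\<lambda>x. c * to_line p f x - cor k (to_line p f) x)"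
      unfolding k_def using to_line_dual_cesaro[OF Lp_plus_measurable[OF f]] by (auto simp: to_line_lin)
    have "(\<lambda>t. c * f t - dual_cesaro b f t) \<in> Lp_plus p" using RL[OF fl] p op by (simp add: Lp_plus_iff)
    moreover have "AE x in lborel. to_line p (\<lambda>t. c * f t - dual_cesaro b f t) x = cor \<kappa> (\<lambda>x. c * F x - cor k F x) x"
      using eq cor_commute[OF ki integrable_\<kappa> F p] cor_diff[OF integrable_\<kappa> Lp_cmult(1)[OF F p] cor_Lp(2)[OF ki F p] p, of c]
    proof eventually_elim
      case (elim x)
      have "cor k (to_line p f) x = cor k (cor \<kappa> F) x"
        by (rule cor_AE_cong[OF eq borel_measurable_integrable[OF ki, simplified] Lp_measurable[OF fl] Lp_measurable[OF \<kappa>F]])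
      then show ?case unfolding op using elim by (simp add: cor_cmult)
    qed
    ultimately show ?thesis unfolding generates_def using RL[OF F] by blast
  qed
  have "c \<in> spectrum_T a p (dual_cesaro b) \<longleftrightarrow> c \<in> closure (range (fourier k))" for c
  proof -
    have s1: "(\<forall>g\<in>Tsp a p. \<exists>f\<in>Tsp a p. ae_eq (\<lambda>t. c * f t - dual_cesaro b f t) g) \<longleftrightarrow>
      (\<forall>G\<in>Lp p. \<exists>F\<in>Lp p. AE x in lborel. c * F x - cor k F x = G x)" (is "?L \<longleftrightarrow> ?R")
    proof (intro iffI ballI)
      fix G assume L: ?L and G: "G \<in> Lp p"
      define g where "g = from_line p (cor \<kappa> G)"
      have gG: "generates G g" unfolding g_def by (rule generates_from_line[OF G])
      then have "g \<in> Tsp a p" unfolding Tsp_iff by blast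
      with L obtain f where f: "f \<in> Tsp a p" and e: "ae_eq (\<lambda>t. c * f t - dual_cesaro b f t) g" by blast
      obtain F where F: "generates F f" using f unfolding Tsp_iff by blast
      note R = genR[OF F, of c]
      have FL: "F \<in> Lp p" using F by (simp add: generates_def)
      have "AE x in lborel. to_line p (\<lambda>t. c * f t - dual_cesaro b f t) x = to_line p g x"
        using e R gG ae_eq_iff_to_line[OF Lp_plus_measurable Lp_plus_measurable, where p = p] unfolding generates_def by blast
      moreover have "AE x in lborel. to_line p (\<lambda>t. c * f t - dual_cesaro b f t) x = cor \<kappa> (\<lambda>x. c * F x - cor k F x) x"
        "AE x in lborel. to_line p g x = cor \<kappa> G x" using R gG by (auto simp: generates_def)
      ultimately have "AE x in lborel. cor \<kappa> (\<lambda>x. c * F x - cor k F x) x = cor \<kappa> G x" by eventually_elim simp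
      then have "AE x in lborel. c * F x - cor k F x = G x" by (rule cor_\<kappa>_inj[OF RL[OF FL] G])
      then show "\<exists>F\<in>Lp p. AE x in lborel. c * F x - cor k F x = G x" using FL by blast
    next
      fix g assume R: ?R and g: "g \<in> Tsp a p"
      obtain G where G: "generates G g" using g unfolding Tsp_iff by blast
      then have GL: "G \<in> Lp p" by (simp add: generates_def)
      with R obtain F where F: "F \<in> Lp p" and e: "AE x in lborel. c * F x - cor k F x = G x" by blast
      define f where "f = from_line p (cor \<kappa> F)"
      have gf: "generates F f" unfolding f_def by (rule generates_from_line[OF F])
      note R' = genR[OF gf, of c]
      have e': "cor \<kappa> (\<lambda>x. c * F x - cor k F x) x = cor \<kappa> G x" for x
        by (rule cor_AE_cong[OF e measurable_\<kappa> Lp_measurable[OF RL[OF F]] Lp_measurable[OF GL]])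
      have "AE x in lborel. to_line p (\<lambda>t. c * f t - dual_cesaro b f t) x = cor \<kappa> (\<lambda>x. c * F x - cor k F x) x"
        "AE x in lborel. to_line p g x = cor \<kappa> G x" using R' G by (auto simp: generates_def)
      then have "AE x in lborel. to_line p (\<lambda>t. c * f t - dual_cesaro b f t) x = to_line p g x" unfolding e' by eventually_elim simp
      then have "ae_eq (\<lambda>t. c * f t - dual_cesaro b f t) g"
        using R' G ae_eq_iff_to_line[OF Lp_plus_measurable Lp_plus_measurable, where p = p] unfolding generates_def by blast
      moreover have "f \<in> Tsp a p" using gf unfolding Tsp_iff by blast
      ultimately show "\<exists>f\<in>Tsp a p. ae_eq (\<lambda>t. c * f t - dual_cesaro b f t) g" by blast
    qed
    have s2: "(\<forall>f\<in>Tsp a p. Tnorm a p f \<le> M * Tnorm a p (\<lambda>t. c * f t - dual_cesaro b f t)) \<longleftrightarrow>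
      (\<forall>F\<in>Lp p. Lnorm p F \<le> M * Lnorm p (\<lambda>x. c * F x - cor k F x))" (is "?L \<longleftrightarrow> ?R") for M
    proof -
      have n: "Tnorm a p f \<le> M * Tnorm a p (\<lambda>t. c * f t - dual_cesaro b f t) \<longleftrightarrow> Lnorm p F \<le> M * Lnorm p (\<lambda>x. c * F x - cor k F x)"
        if "generates F f" for F f
        unfolding Tnorm_eq[OF that] Tnorm_eq[OF genR[OF that]] using Gamma_pos by (simp add: divide_le_cancel)
      show ?thesis
      proof (intro iffI ballI)
        fix F assume L: ?L and F: "F \<in> Lp p"
        note gf = generates_from_line[OF F]
        have "from_line p (cor \<kappa> F) \<in> Tsp a p" unfolding Tsp_iff using gf by blast
        then show "Lnorm p F \<le> M * Lnorm p (\<lambda>x. c * F x - cor k F x)"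
          by (rule iffD1[OF n[OF gf] L[rule_format]])
      next
        fix f assume R: ?R and f: "f \<in> Tsp a p"
        obtain F where F: "generates F f" using f unfolding Tsp_iff by blast
        then have "F \<in> Lp p" by (simp add: generates_def)
        then show "Tnorm a p f \<le> M * Tnorm a p (\<lambda>t. c * f t - dual_cesaro b f t)" using R n[OF F] by blast
      qed
    qed
    show ?thesis
      using spectrum_cor[OF p, of c]
      unfolding spectrum_T_def mem_Collect_eq s1 s2 k_def[symmetric] by (simp only: not_not)
  qed
  then show ?thesis unfolding spectrum_dual_cesaro_Lp[OF b p] range by blast
qed

end

lemma spectrum_dual_cesaro:
  assumes "\<beta> > 0" "\<alpha> \<ge> 0" "1 \<le> p"
  shows "spectrum_T \<alpha> p (dual_cesaro \<beta>) =
    closure {complex_of_real \<beta> * Beta (complex_of_real \<beta>) (complex_of_real (1 / p) + \<i> * complex_of_real t) | t. True}"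
proof (cases "\<alpha> = 0")
  case True
  then show ?thesis using spectrum_dual_cesaro_Lp[OF assms(1,3)] by simp
next
  case False
  then interpret weyl_space \<alpha> p by unfold_locales (use assms in auto)
  show ?thesis using spectrum_eq[OF assms(1)] spectrum_dual_cesaro_Lp[OF assms(1,3)] by simp
qed

lemma closure_of_real_mult:
  assumes "r \<noteq> 0"
  shows "(\<lambda>z. complex_of_real r * z) ` closure {f t | t. True} = closure {complex_of_real r * f t | t. True}"
proof -
  have "(*\<^sub>R) r ` closure (range f) = closure ((*\<^sub>R) r ` range f)" by (rule closure_scaleR)
  moreover have "(*\<^sub>R) r = (\<lambda>z. complex_of_real r * z)" by (auto simp: scaleR_conv_of_real)
  ultimately show ?thesis by (simp add: full_SetCompr_eq image_image)
qed

theorem theorem3p9: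
  fixes \<beta> \<alpha> p :: real
  assumes "\<beta> > 0" and "\<alpha> \<ge> 0" and "1 \<le> p"
  shows "spectrum_T \<alpha> p (dual_cesaro \<beta>) =
           (\<lambda>z. complex_of_real (Gamma (\<beta> + 1)) * z) `
             closure {Gamma (complex_of_real (1 / p) + \<i> * complex_of_real t) /
                      Gamma (complex_of_real (\<beta> + 1 / p) + \<i> * complex_of_real t) | t. True} \<and>
         spectrum_T \<alpha> p (dual_cesaro \<beta>) =
           (\<lambda>z. complex_of_real \<beta> * z) `
             closure {Beta (complex_of_real \<beta>) (complex_of_real (1 / p) + \<i> * complex_of_real t) | t. True}"
proof -
  have "Gamma (\<beta> + 1) > 0" by (rule Gamma_real_pos) (use assms(1) in simp)
  then have g: "Gamma (\<beta> + 1) \<noteq> 0" by linarith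
  \<comment> \<open>The recursion splits off the \<open>Gamma \<beta>\<close> contained in the Beta
    function, so the two parametrised sets coincide point by point.\<close>
  have "Gamma (\<beta> + 1) = \<beta> * Gamma \<beta>" by (rule Gamma_plus1) (use assms(1) in \<open>auto elim!: nonpos_Ints_cases\<close>)
  then have eq: "complex_of_real (Gamma (\<beta> + 1)) * (Gamma (complex_of_real (1 / p) + \<i> * complex_of_real t) /
      Gamma (complex_of_real (\<beta> + 1 / p) + \<i> * complex_of_real t))
    = complex_of_real \<beta> * Beta (complex_of_real \<beta>) (complex_of_real (1 / p) + \<i> * complex_of_real t)" for t
    by (simp add: Beta_def Gamma_complex_of_real add.assoc)
  show ?thesis
    unfolding closure_of_real_mult[OF g] closure_of_real_mult[OF less_imp_neq[OF assms(1), symmetric]] eq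
    using spectrum_dual_cesaro[OF assms] by simp
qed

end
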